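(* Let $\mathbb{F}$ be a field with $\operatorname{char}\mathbb{F}\neq 2$. Let $a\geqslant 1$ and $b\geqslant 2$ be integers, $n=a+b$, and, if $n$ is odd, assume $b<n/2$. Then the Specht module $S_{(a,1^b)}$ for $\mathscr{H}_n=\mathscr{H}_{\mathbb{F},-1}(\mathfrak{S}_n)$ is indecomposable if and only if either $n$ is even, or $b\in\{2,3\}$ and $\operatorname{char}\mathbb{F}$ divides $\lceil a/2\rceil$.
   Context: The algebra. $\mathbb{F}$ is a field, $q=-1$. $\mathscr{H}_n=\mathscr{H}_{\mathbb{F},-1}(\mathfrak{S}_n)$ is the Iwahori--Hecke algebra: the unital associative $\mathbb{F}$-algebra generated by $T_1,\dots,T_{n-1}$ with relations $(T_i-q)(T_i+1)=0$, $T_iT_j=T_jT_i$ for $|i-j|>1$, $T_iT_{i+1}T_i=T_{i+1}T_iT_{i+1}$. By a theorem of Brundan and Kleshchev it is isomorphic to, and is identified with, the unital associative $\mathbb{F}$-algebra with generators $y_1,\dots,y_n$, $\psi_1,\dots,\psi_{n-1}$, $e(i)$ ($i=(i_1,\dots,i_n)\in\{0,1\}^n$) and relations: $y_1=0$; $e(i)=0$ if $i_1=1$; $e(i)e(j)=\delta_{ij}e(i)$; $\sum_i e(i)=1$; $y_re(i)=e(i)y_r$; $\psi_re(i)=e(s_r\cdot i)\psi_r$, where $s_r\cdot i$ swaps the $r$-th and $(r+1)$-th terms of $i$; $y_sy_r=y_ry_s$; $y_s\psi_r=\psi_ry_s$ if $s\neq r,r+1$; $y_r\psi_re(i)=(\psi_ry_{r+1}-\delta_{i_r,i_{r+1}})e(i)$;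 $y_{r+1}\psi_re(i)=(\psi_ry_r+\delta_{i_r,i_{r+1}})e(i)$; $\psi_s\psi_r=\psi_r\psi_s$ if $s\neq r\pm1$; $\psi_r^2e(i)=0$ if $i_r=i_{r+1}$ and $\psi_r^2e(i)=-(y_r-y_{r+1})^2e(i)$ if $i_r\neq i_{r+1}$; $\psi_r\psi_{r+1}\psi_re(i)=\psi_{r+1}\psi_r\psi_{r+1}e(i)$ if $i_r=i_{r+1}$ or $i_{r+1}=i_{r+2}$; $\psi_r\psi_{r+1}\psi_re(i)=(\psi_{r+1}\psi_r\psi_{r+1}+y_r-2y_{r+1}+y_{r+2})e(i)$ if $i_r\neq i_{r+1}\neq i_{r+2}$. The Specht module. For a hook partition $\lambda=(a,1^b)$ of $n=a+b$, the node in row $r$ and column $c$ has residue $c-r\pmod 2$; $T_\lambda$ is the tableau with $1,\dots,n$ entered consecutively down the columns (so $1,\dots,b+1$ down the first column, then $b+2,\dots,n$ along the rest of the first row), and $i_\lambda\in\{0,1\}^n$ is the sequence whose $k$-th term is the residue of the node containing $k$ in $T_\lambda$. $S_\lambda$ is the left $\mathscr{H}_n$-module generated by $z$ subject to: $y_kz=0$ for all $k$; $e(i)z=\delta_{i,i_\lambda}z$ for all $i$; $\psi_jz=0$ for all $j\neq b+1$; $\psi_1\psi_2\cdots\psi_{b+1}z=0$ (the last relation being omitted when $a=1$). Convention: $0$ divides only $0$. *)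

theory Defs
  imports Complex_Main "HOL-Library.Poly_Mapping" "HOL-Algebra.Module" "HOL-Algebra.QuotRing"
begin

section \<open>Free algebras\<close>

text \<open>The monoid algebra \<open>'x free_monoid \<Rightarrow>\<^sub>0 'f\<close> is the free unital associative algebra over \<open>'f\<close>
  on the alphabet \<open>'x\<close>: the library multiplies finitely supported functions by convolution along
  the (additively written) monoid of words.\<close>

datatype 'x free_monoid = Word (letters: "'x list")

instantiation free_monoid :: (type) monoid_add
begin

definition zero_free_monoid :: "'a free_monoid" where
  "0 = Word []"

definition plus_free_monoid :: "'a free_monoid \<Rightarrow> 'a free_monoid \<Rightarrow> 'a free_monoid" where
  "u + v = Word (letters u @ letters v)"

instance
  by standard (simp_all add: zero_free_monoid_def plus_free_monoid_def)

end

definition gen :: "'x \<Rightarrow> 'x free_monoid \<Rightarrow>\<^sub>0 'f::field" where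
  "gen x = Poly_Mapping.single (Word [x]) 1"

definition free_algebra :: "'x set \<Rightarrow> ('x free_monoid \<Rightarrow>\<^sub>0 'f::field) ring" where
  "free_algebra A = \<lparr>carrier = {p. \<forall>w\<in>Poly_Mapping.keys p. set (letters w) \<subseteq> A},
     mult = (*), one = 1, zero = 0, add = (+)\<rparr>"


section \<open>Left modules over noncommutative rings\<close>

text \<open>The record \<^typ>\<open>('a, 'b) module\<close> and the predicate \<^const>\<open>submodule\<close> from the library do not
  refer to commutativity; only the locale \<^locale>\<open>module\<close> does.  As there, the
  fields \<open>mult\<close> and \<open>one\<close> of a module play no role.\<close>

locale left_module = R?: ring R + M?: abelian_group M for R (structure) and M (structure) +
  assumes smult_closed:
      "\<lbrakk>a \<in> carrier R; x \<in> carrier M\<rbrakk> \<Longrightarrow> a \<odot>\<^bsub>M\<^esub> x \<in> carrier M"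
    and smult_l_distr:
      "\<lbrakk>a \<in> carrier R; b \<in> carrier R; x \<in> carrier M\<rbrakk> \<Longrightarrow>
        (a \<oplus>\<^bsub>R\<^esub> b) \<odot>\<^bsub>M\<^esub> x = a \<odot>\<^bsub>M\<^esub> x \<oplus>\<^bsub>M\<^esub> b \<odot>\<^bsub>M\<^esub> x"
    and smult_r_distr:
      "\<lbrakk>a \<in> carrier R; x \<in> carrier M; y \<in> carrier M\<rbrakk> \<Longrightarrow>
        a \<odot>\<^bsub>M\<^esub> (x \<oplus>\<^bsub>M\<^esub> y) = a \<odot>\<^bsub>M\<^esub> x \<oplus>\<^bsub>M\<^esub> a \<odot>\<^bsub>M\<^esub> y"
    and smult_assoc:
      "\<lbrakk>a \<in> carrier R; b \<in> carrier R; x \<in> carrier M\<rbrakk> \<Longrightarrow>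
        (a \<otimes>\<^bsub>R\<^esub> b) \<odot>\<^bsub>M\<^esub> x = a \<odot>\<^bsub>M\<^esub> (b \<odot>\<^bsub>M\<^esub> x)"
    and smult_one:
      "x \<in> carrier M \<Longrightarrow> \<one>\<^bsub>R\<^esub> \<odot>\<^bsub>M\<^esub> x = x"

definition regular_module :: "('a, 'm) ring_scheme \<Rightarrow> ('a, 'a) module" where
  "regular_module R = \<lparr>carrier = carrier R, mult = mult R, one = one R, zero = zero R,
     add = add R, smult = mult R\<rparr>"

definition span_submodule ::
    "('a, 'm) ring_scheme \<Rightarrow> ('a, 'b, 'k) module_scheme \<Rightarrow> 'b set \<Rightarrow> 'b set" where
  "span_submodule R M S = \<Inter>{N. submodule N R M \<and> S \<subseteq> N}"

definition quot_module :: "('a, 'b, 'k) module_scheme \<Rightarrow> 'b set \<Rightarrow> ('a, 'b set) module" where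
  "quot_module M N = \<lparr>carrier = a_rcosets\<^bsub>M\<^esub> N, mult = undefined, one = undefined, zero = N,
     add = set_add M, smult = (\<lambda>r C. \<Union>x\<in>C. N +>\<^bsub>M\<^esub> (r \<odot>\<^bsub>M\<^esub> x))\<rparr>"

text \<open>The left \<open>R\<close>-module generated by one element \<open>z\<close> subject to the relations \<open>x z = 0\<close> for
  \<open>x \<in> S\<close>; here \<open>z\<close> is the coset of \<open>1\<close>.\<close>

definition cyclic_module :: "('a, 'm) ring_scheme \<Rightarrow> 'a set \<Rightarrow> ('a, 'a set) module" where
  "cyclic_module R S =
     quot_module (regular_module R) (span_submodule R (regular_module R) S)"

definition indecomposable ::
    "('a, 'm) ring_scheme \<Rightarrow> ('a, 'b, 'k) module_scheme \<Rightarrow> bool" where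
  "indecomposable R M \<longleftrightarrow> carrier M \<noteq> {\<zero>\<^bsub>M\<^esub>} \<and>
     (\<forall>A B. submodule A R M \<and> submodule B R M \<and> A <+>\<^bsub>M\<^esub> B = carrier M \<and> A \<inter> B = {\<zero>\<^bsub>M\<^esub>}
        \<longrightarrow> A = {\<zero>\<^bsub>M\<^esub>} \<or> B = {\<zero>\<^bsub>M\<^esub>})"


section \<open>The Hecke algebra with \<open>q = -1\<close>\<close>

text \<open>The algebra is given by the Khovanov--Lauda--Rouquier presentation, through which Brundan and
  Kleshchev identify it with the Iwahori--Hecke algebra of the symmetric group.  Sequences
  \<open>i = (i\<^sub>1, \<dots>, i\<^sub>n)\<close> are lists, but all subscripts count from 1.\<close>

datatype klr_gen = Y nat | Psi nat | E "nat list"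

definition res_seqs :: "nat \<Rightarrow> nat list set" where
  "res_seqs n = {i. length i = n \<and> set i \<subseteq> {0, 1}}"

definition klr_gens :: "nat \<Rightarrow> klr_gen set" where
  "klr_gens n = Y ` {1..n} \<union> Psi ` {1..<n} \<union> E ` res_seqs n"

abbreviation entry :: "nat list \<Rightarrow> nat \<Rightarrow> nat" where
  "entry i r \<equiv> i ! (r - 1)"

definition swap :: "nat \<Rightarrow> nat list \<Rightarrow> nat list" where
  "swap r i = i[r - 1 := entry i (r + 1), r := entry i r]"

type_synonym 'f klr_free = "klr_gen free_monoid \<Rightarrow>\<^sub>0 'f"

abbreviation ygen :: "nat \<Rightarrow> 'f::field klr_free" where "ygen r \<equiv> gen (Y r)"
abbreviation psigen :: "nat \<Rightarrow> 'f::field klr_free" where "psigen r \<equiv> gen (Psi r)"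
abbreviation egen :: "nat list \<Rightarrow> 'f::field klr_free" where "egen i \<equiv> gen (E i)"

inductive klr_rel :: "nat \<Rightarrow> 'f::field klr_free \<Rightarrow> 'f klr_free \<Rightarrow> bool" for n where
  y_one: "klr_rel n (ygen 1) 0"
| e_first: "\<lbrakk>i \<in> res_seqs n; entry i 1 = 1\<rbrakk> \<Longrightarrow> klr_rel n (egen i) 0"
| e_e: "\<lbrakk>i \<in> res_seqs n; j \<in> res_seqs n\<rbrakk> \<Longrightarrow>
    klr_rel n (egen i * egen j) (if i = j then egen i else 0)"
| e_sum: "klr_rel n (\<Sum>i\<in>res_seqs n. egen i) 1"
| y_e: "\<lbrakk>i \<in> res_seqs n; r \<in> {1..n}\<rbrakk> \<Longrightarrow> klr_rel n (ygen r * egen i) (egen i * ygen r)"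
| psi_e: "\<lbrakk>i \<in> res_seqs n; r \<in> {1..<n}\<rbrakk> \<Longrightarrow>
    klr_rel n (psigen r * egen i) (egen (swap r i) * psigen r)"
| y_y: "\<lbrakk>r \<in> {1..n}; s \<in> {1..n}\<rbrakk> \<Longrightarrow> klr_rel n (ygen s * ygen r) (ygen r * ygen s)"
| y_psi: "\<lbrakk>r \<in> {1..<n}; s \<in> {1..n}; s \<noteq> r; s \<noteq> r + 1\<rbrakk> \<Longrightarrow>
    klr_rel n (ygen s * psigen r) (psigen r * ygen s)"
| y_psi_e: "\<lbrakk>i \<in> res_seqs n; r \<in> {1..<n}\<rbrakk> \<Longrightarrow>
    klr_rel n (ygen r * psigen r * egen i)
      ((psigen r * ygen (r + 1) - (if entry i r = entry i (r + 1) then 1 else 0)) * egen i)"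
| y_Suc_psi_e: "\<lbrakk>i \<in> res_seqs n; r \<in> {1..<n}\<rbrakk> \<Longrightarrow>
    klr_rel n (ygen (r + 1) * psigen r * egen i)
      ((psigen r * ygen r + (if entry i r = entry i (r + 1) then 1 else 0)) * egen i)"
| psi_psi: "\<lbrakk>r \<in> {1..<n}; s \<in> {1..<n}; s \<noteq> r + 1; r \<noteq> s + 1\<rbrakk> \<Longrightarrow>
    klr_rel n (psigen s * psigen r) (psigen r * psigen s)"
| psi_sq_eq: "\<lbrakk>i \<in> res_seqs n; r \<in> {1..<n}; entry i r = entry i (r + 1)\<rbrakk> \<Longrightarrow>
    klr_rel n (psigen r ^ 2 * egen i) 0"
| psi_sq_neq: "\<lbrakk>i \<in> res_seqs n; r \<in> {1..<n}; entry i r \<noteq> entry i (r + 1)\<rbrakk> \<Longrightarrow>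
    klr_rel n (psigen r ^ 2 * egen i) (- ((ygen r - ygen (r + 1)) ^ 2) * egen i)"
| braid: "\<lbrakk>i \<in> res_seqs n; 1 \<le> r; r + 1 < n;
      entry i r = entry i (r + 1) \<or> entry i (r + 1) = entry i (r + 2)\<rbrakk> \<Longrightarrow>
    klr_rel n (psigen r * psigen (r + 1) * psigen r * egen i)
      (psigen (r + 1) * psigen r * psigen (r + 1) * egen i)"
| braid_neq: "\<lbrakk>i \<in> res_seqs n; 1 \<le> r; r + 1 < n;
      entry i r \<noteq> entry i (r + 1); entry i (r + 1) \<noteq> entry i (r + 2)\<rbrakk> \<Longrightarrow>
    klr_rel n (psigen r * psigen (r + 1) * psigen r * egen i)
      ((psigen (r + 1) * psigen r * psigen (r + 1) + ygen r - 2 * ygen (r + 1) + ygen (r + 2)) * egen i)"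

abbreviation klr_free_algebra :: "nat \<Rightarrow> 'f::field klr_free ring" where
  "klr_free_algebra n \<equiv> free_algebra (klr_gens n)"

text \<open>Two-sided ideals of the free algebra are closed under the scalars, which lie in its
  centre, so the ideal generated as in a ring is also the ideal generated as in an algebra.
  For the same reason submodules of a module over the quotient are subspaces.\<close>

definition klr_ideal :: "nat \<Rightarrow> 'f::field klr_free set" where
  "klr_ideal n = Idl\<^bsub>klr_free_algebra n\<^esub> {l - r | l r. klr_rel n l r}"

definition hecke :: "nat \<Rightarrow> 'f::field klr_free set ring" where
  "hecke n = klr_free_algebra n Quot klr_ideal n"

definition to_hecke :: "nat \<Rightarrow> 'f::field klr_free \<Rightarrow> 'f klr_free set" where
  "to_hecke n p = klr_ideal n +>\<^bsub>klr_free_algebra n\<^esub> p"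


section \<open>Specht modules of hook partitions\<close>

text \<open>\<open>hook_node b k\<close> is the node (row, column) that contains \<open>k\<close> in the column-initial tableau
  of shape \<open>(a, 1\<^sup>b)\<close>.\<close>

definition hook_node :: "nat \<Rightarrow> nat \<Rightarrow> nat \<times> nat" where
  "hook_node b k = (if k \<le> b + 1 then (k, 1) else (1, k - b))"

definition residue :: "nat \<times> nat \<Rightarrow> nat" where
  "residue node = (case node of (r, c) \<Rightarrow> nat ((int c - int r) mod 2))"

definition hook_seq :: "nat \<Rightarrow> nat \<Rightarrow> nat list" where
  "hook_seq a b = map (\<lambda>k. residue (hook_node b k)) [1..<a + b + 1]"

inductive_set specht_rels :: "nat \<Rightarrow> nat \<Rightarrow> 'f::field klr_free set" for a b where
  y: "k \<in> {1..a + b} \<Longrightarrow> ygen k \<in> specht_rels a b"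
| e: "i \<in> res_seqs (a + b) \<Longrightarrow>
    egen i - (if i = hook_seq a b then 1 else 0) \<in> specht_rels a b"
| psi: "\<lbrakk>j \<in> {1..<a + b}; j \<noteq> b + 1\<rbrakk> \<Longrightarrow> psigen j \<in> specht_rels a b"
| psi_prod: "a \<noteq> 1 \<Longrightarrow> prod_list (map psigen [1..<b + 2]) \<in> specht_rels a b"

definition specht :: "nat \<Rightarrow> nat \<Rightarrow> ('f::field klr_free set, 'f klr_free set set) module" where
  "specht a b = cyclic_module (hecke (a + b)) (to_hecke (a + b) ` specht_rels a b)"


section \<open>The constructions yield a ring and a left module\<close>

lemma free_algebra_add_closed:
  assumes "x \<in> carrier (free_algebra A)" "y \<in> carrier (free_algebra A)"
  shows "x + y \<in> carrier (free_algebra A)"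
  using assms Poly_Mapping.keys_add[of x y] unfolding free_algebra_def by fastforce

lemma free_algebra_diff_closed:
  assumes "x \<in> carrier (free_algebra A)" "y \<in> carrier (free_algebra A)"
  shows "x - y \<in> carrier (free_algebra A)"
proof -
  have "- y \<in> carrier (free_algebra A)"
    using assms(2) by (simp add: free_algebra_def)
  from free_algebra_add_closed[OF assms(1) this] show ?thesis by simp
qed

lemma free_algebra_mult_closed:
  assumes "x \<in> carrier (free_algebra A)" "y \<in> carrier (free_algebra A)"
  shows "x * y \<in> carrier (free_algebra A)"
proof -
  have "set (letters w) \<subseteq> A" if w: "w \<in> Poly_Mapping.keys (x * y)" for w
  proof -
    obtain u v where "w = u + v" "u \<in> Poly_Mapping.keys x" "v \<in> Poly_Mapping.keys y"
      using w keys_mult[of x y] by blast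
    then show ?thesis using assms by (simp add: free_algebra_def plus_free_monoid_def)
  qed
  then show ?thesis by (simp add: free_algebra_def)
qed

lemma ring_free_algebra: "ring (free_algebra A :: ('x free_monoid \<Rightarrow>\<^sub>0 'f::field) ring)"
proof (rule ringI)
  let ?F = "free_algebra A :: ('x free_monoid \<Rightarrow>\<^sub>0 'f::field) ring"
  have add: "add ?F = (+)" and mult: "mult ?F = (*)" and zero: "zero ?F = 0" and one: "one ?F = 1"
    by (simp_all add: free_algebra_def)
  have z: "0 \<in> carrier ?F" and o: "1 \<in> carrier ?F"
    by (simp_all add: free_algebra_def zero_free_monoid_def)
  have m: "- x \<in> carrier ?F" if "x \<in> carrier ?F" for x
    using that by (simp add: free_algebra_def)
  show "abelian_group ?F"
    by (rule abelian_groupI)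
      (auto simp: add zero z free_algebra_add_closed ac_simps intro!: bexI[OF _ m])
  show "Group.monoid ?F"
    by (rule Group.monoidI) (auto simp: mult one o free_algebra_mult_closed mult.assoc)
qed (simp_all add: free_algebra_def algebra_simps)

lemma gen_closed: "x \<in> A \<Longrightarrow> gen x \<in> carrier (free_algebra A)"
  by (simp add: gen_def free_algebra_def)


lemma quot_module_left_module:
  assumes M: "left_module R M" and N: "submodule N R M"
  shows "left_module R (quot_module M N)"
proof -
  interpret left_module R M by (rule M)
  interpret N: submodule N R M by (rule N)
  interpret abelian_subgroup N M
    by (intro abelian_subgroupI3 additive_subgroup.intro N.subgroup_axioms M.abelian_group_axioms)
  let ?Q = "quot_module M N"
  have Q: "carrier ?Q = a_rcosets\<^bsub>M\<^esub> N" "add ?Q = set_add M" "zero ?Q = N"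
    by (simp_all add: quot_module_def)
  have carr: "carrier ?Q = (\<lambda>x. N +>\<^bsub>M\<^esub> x) ` carrier M"
    by (auto simp: quot_module_def A_RCOSETS_def RCOSETS_def a_r_coset_def)
  have sm: "r \<odot>\<^bsub>?Q\<^esub> (N +>\<^bsub>M\<^esub> x) = N +>\<^bsub>M\<^esub> (r \<odot>\<^bsub>M\<^esub> x)"
    if r: "r \<in> carrier R" and x: "x \<in> carrier M" for r x
  proof -
    have "N +>\<^bsub>M\<^esub> (r \<odot>\<^bsub>M\<^esub> x') = N +>\<^bsub>M\<^esub> (r \<odot>\<^bsub>M\<^esub> x)" if x': "x' \<in> N +>\<^bsub>M\<^esub> x" for x'
    proof -
      obtain h where h: "h \<in> N" "x' = h \<oplus>\<^bsub>M\<^esub> x" using x' unfolding a_r_coset_def' by blast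
      have "h \<in> carrier M" using h N.subset by auto
      then have "r \<odot>\<^bsub>M\<^esub> x' = r \<odot>\<^bsub>M\<^esub> h \<oplus>\<^bsub>M\<^esub> r \<odot>\<^bsub>M\<^esub> x" using h r x by (simp add: smult_r_distr)
      moreover have "r \<odot>\<^bsub>M\<^esub> h \<in> N" using h r by simp
      ultimately have "r \<odot>\<^bsub>M\<^esub> x' \<in> N +>\<^bsub>M\<^esub> (r \<odot>\<^bsub>M\<^esub> x)" unfolding a_r_coset_def' by blast
      then show ?thesis by (rule a_repr_independence'[OF _ smult_closed[OF r x], symmetric])
    qed
    moreover have "x \<in> N +>\<^bsub>M\<^esub> x" using x by (rule a_rcos_self)
    ultimately have "(\<Union>x'\<in>N +>\<^bsub>M\<^esub> x. N +>\<^bsub>M\<^esub> (r \<odot>\<^bsub>M\<^esub> x')) = N +>\<^bsub>M\<^esub> (r \<odot>\<^bsub>M\<^esub> x)"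
      by (intro SUP_eq_const) blast+
    then show ?thesis by (simp add: quot_module_def)
  qed
  have "abelian_group ?Q"
  proof (rule abelian_groupI, goal_cases)
    case (1 C D)
    then show ?case unfolding Q by (rule a_setmult_closed)
  next
    case 2
    then show ?case unfolding Q by (rule a_subgroup_in_rcosets)
  next
    case (3 C D E)
    then show ?case unfolding Q by (rule a_rcosets_assoc)
  next
    case (4 C D)
    then obtain x y where "x \<in> carrier M" "C = N +>\<^bsub>M\<^esub> x" "y \<in> carrier M" "D = N +>\<^bsub>M\<^esub> y"
      unfolding carr by blast
    then show ?case by (simp add: Q a_rcos_sum M.add.m_comm)
  next
    case (5 C)
    then show ?case unfolding Q by (rule rcosets_add_eq)
  next
    case (6 C)
    then show ?case unfolding Q using a_setinv_closed a_rcosets_inv_mult_group_eq by blast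
  qed
  then show ?thesis
  proof (intro left_module.intro left_module_axioms.intro R.ring_axioms, goal_cases)
    case (2 r C)
    then show ?case by (auto simp: carr sm smult_closed)
  next
    case (3 r r' C)
    then show ?case by (auto simp: carr sm Q(2) a_rcos_sum smult_closed smult_l_distr)
  next
    case (4 r C D)
    then show ?case by (auto simp: carr sm Q(2) a_rcos_sum smult_closed smult_r_distr)
  next
    case (5 r r' C)
    then show ?case by (auto simp: carr sm smult_closed smult_assoc)
  next
    case (6 C)
    then show ?case by (auto simp: carr sm smult_one)
  qed
qed

lemma regular_left_module:
  assumes "ring R" shows "left_module R (regular_module R)"
proof -
  interpret ring R by (rule assms)
  have "abelian_group (regular_module R)"
    by (rule abelian_groupI) (auto simp: regular_module_def a_ac intro: l_neg)
  then show ?thesis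
    by (intro left_module.intro left_module_axioms.intro assms)
      (auto simp: regular_module_def l_distr r_distr m_assoc)
qed

lemma span_submodule:
  assumes "left_module R M" "S \<subseteq> carrier M"
  shows "submodule (span_submodule R M S) R M"
proof -
  interpret left_module R M by (rule assms)
  have top: "submodule (carrier M) R M"
    by (intro submodule.intro submodule_axioms.intro M.add.subgroup_self smult_closed)
  have "subgroup (\<Inter>{N. submodule N R M \<and> S \<subseteq> N}) (add_monoid M)"
    by (rule M.add.subgroups_Inter) (use top assms(2) in \<open>auto simp: submodule_def\<close>)
  then show ?thesis unfolding span_submodule_def
    by (intro submodule.intro submodule_axioms.intro) (auto intro: submodule.smult_closed)
qed

lemma cyclic_left_module:
  assumes "ring R" "S \<subseteq> carrier R" shows "left_module R (cyclic_module R S)"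
  unfolding cyclic_module_def using assms
  by (intro quot_module_left_module span_submodule regular_left_module) (auto simp: regular_module_def)

lemma ygen_closed: "k \<in> {1..n} \<Longrightarrow> ygen k \<in> carrier (klr_free_algebra n)"
  and psigen_closed: "k \<in> {1..<n} \<Longrightarrow> psigen k \<in> carrier (klr_free_algebra n)"
  and egen_closed: "i \<in> res_seqs n \<Longrightarrow> egen i \<in> carrier (klr_free_algebra n)"
  by (rule gen_closed, simp add: klr_gens_def)+

lemma klr_rel_closed:
  fixes l r :: "'f::field klr_free"
  assumes "klr_rel n l r" "n > 0"
  shows "l \<in> carrier (klr_free_algebra n) \<and> r \<in> carrier (klr_free_algebra n)"
proof -
  let ?A = "klr_free_algebra n :: 'f klr_free ring"
  have add: "add ?A = (+)" and mult: "mult ?A = (*)" and zero: "zero ?A = 0" and one: "one ?A = 1"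
    by (simp_all add: free_algebra_def)
  note a = free_algebra_add_closed and m = free_algebra_mult_closed
  interpret ring ?A by (rule ring_free_algebra)
  have z: "0 \<in> carrier ?A" and o: "1 \<in> carrier ?A"
    using zero_closed one_closed by (simp_all add: zero one)
  have u: "- x \<in> carrier ?A" if "x \<in> carrier ?A" for x
    using that by (simp add: free_algebra_def)
  note d = free_algebra_diff_closed
  have two: "2 \<in> carrier ?A" using a[OF o o] by simp
  have s: "sum f I \<in> carrier ?A" if "\<And>i. i \<in> I \<Longrightarrow> f i \<in> carrier ?A" for f :: "nat list \<Rightarrow> 'f klr_free" and I
    using that by (induction I rule: infinite_finite_induct) (auto simp: z a)
  note y = ygen_closed and p = psigen_closed and e = egen_closed
  have sw: "swap r i \<in> res_seqs n" if "i \<in> res_seqs n" "r \<in> {1..<n}" for i r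
  proof -
    have "i ! (r-1) \<in> set i" "i ! r \<in> set i" using that by (auto simp: res_seqs_def)
    moreover have "set (swap r i) \<subseteq> {entry i r, entry i (r+1)} \<union> set i"
      unfolding swap_def by (intro subsetI) (auto dest!: subsetD[OF set_update_subset_insert])
    ultimately show ?thesis using that by (auto simp: res_seqs_def swap_def)
  qed
  have i: "(if P then x else x') \<in> carrier ?A" if "x \<in> carrier ?A" "x' \<in> carrier ?A" for P x x'
    using that by simp
  show ?thesis using assms(1)
    by induction
      (unfold power2_eq_square, insert assms(2), (intro conjI a m z o u d two s y p e sw i; simp)+)
qed

lemma ring_hecke:
  assumes "n > 0"
  shows "ring (hecke n :: ('f::field klr_free set) ring)"
proof -
  have "{l - r | l r. klr_rel n l r} \<subseteq> carrier (klr_free_algebra n :: 'f klr_free ring)"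
  proof clarify
    fix l r :: "'f klr_free" assume "klr_rel n l r"
    from klr_rel_closed[OF this assms] show "l - r \<in> carrier (klr_free_algebra n)"
      by (elim conjE) (rule free_algebra_diff_closed)
  qed
  then show ?thesis
    unfolding hecke_def klr_ideal_def
    by (rule ideal.quotient_is_ring[OF ring.genideal_ideal[OF ring_free_algebra]])
qed

lemma left_module_specht:
  assumes "a > 0"
  shows "left_module (hecke (a + b)) (specht a b :: ('f::field klr_free set, 'f klr_free set set) module)"
proof -
  let ?n = "a + b"
  let ?A = "klr_free_algebra ?n :: 'f klr_free ring"
  interpret ring ?A by (rule ring_free_algebra)
  have one: "1 \<in> carrier ?A" and zero: "0 \<in> carrier ?A"
    using one_closed zero_closed by (simp_all add: free_algebra_def)
  have p: "prod_list xs \<in> carrier ?A" if "set xs \<subseteq> carrier ?A" for xs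
    using that by (induction xs) (simp_all add: one free_algebra_mult_closed)
  have "x \<in> carrier ?A" if "x \<in> specht_rels a b" for x
    using that
  proof induction
    case (y k)
    then show ?case by (rule ygen_closed)
  next
    case (e i)
    have "(if i = hook_seq a b then 1 else 0) \<in> carrier ?A" using one zero by simp
    with egen_closed[OF e] show ?case by (rule free_algebra_diff_closed)
  next
    case (psi j)
    then show ?case by (intro psigen_closed)
  next
    case psi_prod
    have "psigen j \<in> carrier ?A" if "j \<in> set [1..<b + 2]" for j
      using assms psi_prod that by (intro psigen_closed) auto
    then show ?case by (intro p) (simp add: image_subset_iff)
  qed
  then have "to_hecke ?n ` specht_rels a b \<subseteq> carrier (hecke ?n :: ('f klr_free set) ring)"
    unfolding to_hecke_def hecke_def FactRing_def A_RCOSETS_def RCOSETS_def a_r_coset_def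
    by simp blast
  then show ?thesis
    unfolding specht_def by (intro cyclic_left_module ring_hecke) (use assms in simp_all)
qed

end

theory Submission
  imports Defs "HOL-Library.Function_Algebras"
begin

text \<open>
  The standard tableaux of shape \<open>(a, 1\<^sup>b)\<close> are given by the set \<open>J \<subseteq> {2..n}\<close> of size \<open>b\<close> of the entries of
  the first column below the corner. The KLR algebra acts on the functions of such sets by operators that
  move single elements: \<open>y\<^sub>r\<close> moves an element inside a pair \<open>{2k, 2k + 1}\<close>, and \<open>\<psi>\<^sub>r\<close> moves it inside such
  a pair or between neighbouring pairs. This module satisfies the defining relations of the Specht module,
  is generated by the initial tableau and has dimension \<open>n - 1\<close> choose \<open>b\<close>. A Pascal-type recursion
  bounds the dimension of the Specht module by the same number, so both agree.

  The components of the generator in a direct sum decomposition are Specht vectors, that is, they are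
  killed by everything that kills the generator. For even \<open>n\<close> the weights force every Specht
  vector to be a multiple of the generator, whence indecomposability. For \<open>n = 2m + 1\<close> adding and removing
  a pair \<open>{2k, 2k + 1}\<close>, summed over \<open>k\<close>, give operators \<open>up\<close> and \<open>down\<close> that commute with the KLR
  algebra and generate \<open>sl\<^sub>2\<close>, as on the exterior algebra of a symplectic space. The endomorphism \<open>T = up \<circ> down\<close> is annihilated by an explicit
  product of linear factors, and its Fitting decomposition is non-trivial as soon as \<open>T\<close> has a non-zero
  eigenvalue. The remaining cases are \<open>b \<in> {2, 3}\<close> with \<open>m - b + 2 = 0\<close> in the field. There \<open>T\<^sup>2 = 0\<close>
  and the Specht vectors are spanned by the generator \<open>z\<close> and \<open>T z\<close>, so each of them that is
  not a multiple of \<open>T z\<close> generates the module.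
\<close>

section \<open>The KLR algebra acting on functions of sets\<close>

text \<open>The pairs come from the residues: \<open>2k\<close> and \<open>2k + 1\<close> have equal
  residues exactly when one of them lies in the leg and the other does not, while
  \<open>2k + 1\<close> and \<open>2k + 2\<close> never do. So each residue condition in the
  defining relations becomes a condition on how \<open>J\<close> meets one pair. The module of
  functions bounds the Specht module only from below. The recursion closes the gap; it argues with
  congruences in the free algebra and passes to fewer strands, where a quotient contains a Specht
  vector with a shorter leg. On degree \<open>b\<close> the linear factors of \<open>T\<close> have
  the roots \<open>i (m - b + i + 1)\<close> with \<open>i \<le> b div 2\<close>. The root for
  \<open>i = 1\<close> is \<open>m - b + 2\<close>; if it vanishes, the root for
  \<open>i = 2\<close> is \<open>2\<close>, which is non-zero since the characteristic is not 2.
  This is why \<open>T\<close> can be nilpotent only for \<open>b = 2\<close> and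
  \<open>b = 3\<close>, and for these \<open>m - b + 2\<close> is the ceiling of
  \<open>a / 2\<close>. The hypothesis \<open>b < n / 2\<close> means \<open>b \<le> m\<close>, so
  that \<open>{2, 4, .., 2b}\<close> fits into \<open>{2..n}\<close>; its basis vector lies in the
  kernel of \<open>T\<close>, so the nilpotent part is never zero.\<close>

definition put :: "nat \<Rightarrow> bool \<Rightarrow> nat set \<Rightarrow> nat set" where
  "put p x J = (if x then insert p J else J - {p})"

lemma mem_put [simp]: "q \<in> put p x J \<longleftrightarrow> (if q = p then x else q \<in> J)"
  by (auto simp: put_def)

lemma put_put [simp]: "put p x (put p y J) = put p x J"
  by (auto simp: put_def)

lemma put_idem: "(p \<in> J) = x \<Longrightarrow> put p x J = J"
  by (auto simp: put_def)

text \<open>As a permutative rewrite rule this sorts nested updates. With \<open>put_put\<close> and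
  \<open>put_idem\<close> it gives sets a normal form, which settles the case analyses on membership
  below.\<close>

lemma put_twist: "p \<noteq> q \<Longrightarrow> put p x (put q y J) = put q y (put p x J)"
  by (auto simp: put_def)

text \<open>Functions are pulled back, so the move runs from \<open>p\<close> to \<open>q\<close> on
  basis vectors: see \<open>hop_delta\<close>.\<close>

definition hop :: "nat \<Rightarrow> nat \<Rightarrow> (nat set \<Rightarrow> 'f::field) \<Rightarrow> nat set \<Rightarrow> 'f" where
  "hop p q v J = (if q \<in> J \<and> p \<notin> J then v (put p True (put q False J)) else 0)"

text \<open>Both indices of a pair give the same move, from its larger to its smaller element, with
  opposite signs.\<close>

definition act_y :: "nat \<Rightarrow> (nat set \<Rightarrow> 'f::field) \<Rightarrow> nat set \<Rightarrow> 'f" where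
  "act_y r v J = (if even r then hop (r + 1) r v J else if r = 1 then 0 else - hop r (r - 1) v J)"

text \<open>For odd \<open>r\<close> the two hops link the pairs \<open>{r - 1, r}\<close> and
  \<open>{r + 1, r + 2}\<close>. With this sign the sum of the basis vectors of the two full pairs
  is sent to zero, which is behind \<open>pair_act_psi_near\<close>. For \<open>r = 1\<close> the
  value 0 is forced, because \<open>psi_1\<close> vanishes in the algebra
  (\<open>psi_one_in_ideal\<close>).\<close>

definition act_psi :: "nat \<Rightarrow> (nat set \<Rightarrow> 'f::field) \<Rightarrow> nat set \<Rightarrow> 'f" where
  "act_psi r v J = (if even r then - hop r (r + 1) v J else if r = 1 then 0
     else hop r (r + 1) v J
       + (if (r \<in> J) = (r + 1 \<in> J) then 1 else - 1) * hop (r + 2) (r - 1) v J)"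

text \<open>The residue of \<open>r\<close> in the tableau with leg \<open>J\<close>.\<close>

definition wt :: "nat set \<Rightarrow> nat \<Rightarrow> nat" where
  "wt J r = (if odd r then card (J \<inter> {2..r}) mod 2 else (1 + card (J \<inter> {2..<r})) mod 2)"

definition seq :: "nat \<Rightarrow> nat set \<Rightarrow> nat list" where
  "seq n J = map (wt J) [1..<n + 1]"

definition act_e :: "nat \<Rightarrow> nat list \<Rightarrow> (nat set \<Rightarrow> 'f::field) \<Rightarrow> nat set \<Rightarrow> 'f" where
  "act_e n i v J = (if seq n J = i then v J else 0)"

lemma length_seq [simp]: "length (seq n J) = n"
  by (simp add: seq_def)

lemma nth_seq: "r < n \<Longrightarrow> seq n J ! r = wt J (Suc r)"
  by (simp add: seq_def del: upt_Suc)

lemma entry_seq: "1 \<le> r \<Longrightarrow> r \<le> n \<Longrightarrow> entry (seq n J) r = wt J r"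
  by (cases r) (simp_all add: nth_seq)

lemma wt_lt_2: "wt J r < 2"
  by (simp add: wt_def)

lemma seq_in_res_seqs: "seq n J \<in> res_seqs n"
proof -
  have "wt J r \<in> {0, 1}" for r
    using wt_lt_2[of J r] less_2_cases by auto
  then have "set (seq n J) \<subseteq> {0, 1}"
    unfolding seq_def set_map by (intro image_subsetI)
  then show ?thesis
    by (simp add: res_seqs_def)
qed

section \<open>Residue sequences under moves of one element\<close>

lemma card_move:
  assumes "finite X" "p \<notin> J" "q \<in> J"
  shows "card (put p True (put q False J) \<inter> X) + of_bool (q \<in> X)
       = card (J \<inter> X) + of_bool (p \<in> X)"
proof -
  have "put p True (put q False J) \<inter> X = (if p \<in> X then insert p (J \<inter> X - {q}) else J \<inter> X - {q})"
    using assms by (auto simp: put_def)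
  moreover have "card (J \<inter> X - {q}) + of_bool (q \<in> X) = card (J \<inter> X)"
    using assms card_Suc_Diff1[of "J \<inter> X" q] by auto
  ultimately show ?thesis
    using assms by auto
qed

text \<open>The segments that enter \<open>wt\<close> end at an odd number, whatever the parity of
  \<open>k\<close>, so they are unions of whole pairs.\<close>

lemma wt_move_pair:
  assumes "p \<notin> J" "q \<in> J" "even r" "{p, q} = {r, r + 1}"
  shows "wt (put p True (put q False J)) k = wt J k"
proof -
  let ?J = "put p True (put q False J)"
  have "(q \<in> {2..k}) = (p \<in> {2..k})" if "odd k"
    using assms that by (auto simp: doubleton_eq_iff elim!: oddE evenE)
  then have "card (?J \<inter> {2..k}) = card (J \<inter> {2..k})" if "odd k"
    using card_move[of "{2..k}" p J q] assms that by simp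
  moreover have "(q \<in> {2..<k}) = (p \<in> {2..<k})" if "even k"
    using assms that by (auto simp: doubleton_eq_iff elim!: oddE evenE)
  then have "card (?J \<inter> {2..<k}) = card (J \<inter> {2..<k})" if "even k"
    using card_move[of "{2..<k}" p J q] assms that by simp
  ultimately show ?thesis by (simp add: wt_def)
qed

lemma mod_2_Suc_cong: "a + of_bool P = b + of_bool Q \<Longrightarrow> P \<noteq> Q \<Longrightarrow> (a::nat) mod 2 = Suc b mod 2"
  by (cases P; cases Q; simp) presburger+

text \<open>Both moves carry one element across the cut between \<open>r\<close> and
  \<open>r + 1\<close>, so among the relevant counts only the one on \<open>{2..r}\<close> changes,
  by one. It governs the residues at \<open>r\<close> and \<open>r + 1\<close>, which always differ;
  flipping both is the same as exchanging them.\<close>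

lemma wt_move_psi:
  assumes J: "p \<notin> J" "q \<in> J" and r: "odd r" "r > 1" and pq: "(p, q) \<in> {(r, r + 1), (r + 2, r - 1)}"
  shows "wt (put p True (put q False J)) k = wt J (if k = r then r + 1 else if k = r + 1 then r else k)"
proof -
  let ?J = "put p True (put q False J)"
  have card: "card (?J \<inter> {2..k}) + of_bool (q \<in> {2..k}) = card (J \<inter> {2..k}) + of_bool (p \<in> {2..k})" for k
    by (rule card_move) (use J in auto)
  have lt: "{2..<k} = {2..k - 1}" if "k > 0" for k :: nat
    using that by auto
  have same: "card (?J \<inter> {2..k}) = card (J \<inter> {2..k})" if "odd k" "k \<noteq> r" for k
  proof -
    have "k \<noteq> r + 1" using that r by auto
    then have "(q \<in> {2..k}) = (p \<in> {2..k})"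
      using pq r that by (auto elim!: oddE)
    then show ?thesis using card[of k] by simp
  qed
  have diff: "card (?J \<inter> {2..r}) mod 2 = Suc (card (J \<inter> {2..r})) mod 2"
    by (rule mod_2_Suc_cong[OF card]) (use pq r in \<open>auto elim!: oddE\<close>)
  consider "k = r" | "k = r + 1" | "k \<noteq> r" "k \<noteq> r + 1" by blast
  then show ?thesis
  proof cases
    case 1
    then show ?thesis using r diff by (simp add: wt_def atLeastLessThanSuc_atLeastAtMost)
  next
    case 2
    have "Suc (card (?J \<inter> {2..r})) mod 2 = card (J \<inter> {2..r}) mod 2"
      using diff by presburger
    with 2 show ?thesis using r by (simp add: wt_def atLeastLessThanSuc_atLeastAtMost)
  next
    case 3
    then show ?thesis
    proof (cases "odd k \<or> k = 0")
      case True
      then show ?thesis using 3 same by (auto simp: wt_def)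
    next
      case False
      then have "odd (k - 1)" "k - 1 \<noteq> r" using 3 by auto
      then show ?thesis using 3 False same[of "k - 1"] by (simp add: wt_def lt)
    qed
  qed
qed

lemma seq_move_pair:
  assumes "p \<notin> J" "q \<in> J" "even r" "{p, q} = {r, r + 1}"
  shows "seq n (put p True (put q False J)) = seq n J"
  using wt_move_pair[OF assms] by (simp add: seq_def)

section \<open>The defining relations for the operators\<close>

lemma linear_ops:
  "hop p q (u + v) = hop p q u + hop p q v"
  "act_y r (u + v) = act_y r u + act_y r v"
  "act_psi r (u + v) = act_psi r u + act_psi r v"
  "act_e n i (u + v) = act_e n i u + act_e n i v"
  by (auto simp: hop_def act_y_def act_psi_def act_e_def fun_eq_iff)

lemma scale_ops:
  "hop p q (\<lambda>J. c * v J) = (\<lambda>J. c * hop p q v J)"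
  "act_y r (\<lambda>J. c * v J) = (\<lambda>J. c * act_y r v J)"
  "act_psi r (\<lambda>J. c * v J) = (\<lambda>J. c * act_psi r v J)"
  "act_e n i (\<lambda>J. c * v J) = (\<lambda>J. c * act_e n i v J)"
  by (auto simp: hop_def act_y_def act_psi_def act_e_def fun_eq_iff algebra_simps)

lemma hop_hop_commute:
  assumes "p \<noteq> p'" "p \<noteq> q'" "q \<noteq> p'" "q \<noteq> q'"
  shows "hop p q (hop p' q' v) = hop p' q' (hop p q v)"
proof
  fix J
  have "put p' True (put q' False (put p True (put q False J)))
      = put p True (put q False (put p' True (put q' False J)))"
    using assms by (auto simp: put_def)
  then show "hop p q (hop p' q' v) J = hop p' q' (hop p q v) J"
    using assms by (simp add: hop_def)
qed

lemma hop_signed: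
  assumes "r \<notin> {p, q}" "s \<notin> {p, q}"
  shows "hop p q (\<lambda>J. u J + (if (r \<in> J) = (s \<in> J) then 1 else - 1) * w J) J
    = hop p q u J + (if (r \<in> J) = (s \<in> J) then 1 else - 1) * hop p q w J"
  using assms by (simp add: hop_def)

lemma hop_act_psi_commute:
  assumes "{p, q} \<inter> {r - 1..r + 2} = {}"
  shows "hop p q (act_psi r v) = act_psi r (hop p q v)"
proof
  fix J
  have ne: "x \<noteq> k" if "x \<in> {p, q}" "k \<in> {r - 1, r, r + 1, r + 2}" for x k
    using assms that by fastforce
  from ne have 1: "hop p q (hop r (r + 1) v) = hop r (r + 1) (hop p q v)"
      "hop p q (hop (r + 2) (r - 1) v) = hop (r + 2) (r - 1) (hop p q v)"
    by (intro hop_hop_commute; blast)+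
  have 2: "r \<notin> {p, q}" "r + 1 \<notin> {p, q}"
    using ne by blast+
  have 3: "hop p q (\<lambda>J. - w J) J = - hop p q w J" for w :: "nat set \<Rightarrow> 'a"
    by (simp add: hop_def)
  have 4: "hop p q (\<lambda>J. 0) J = (0::'a)"
    by (simp add: hop_def)
  show "hop p q (act_psi r v) J = act_psi r (hop p q v) J"
    unfolding act_psi_def 1[symmetric] hop_signed[OF 2, symmetric] 3[symmetric]
    by (cases "even r"; cases "r = 1") (simp_all add: 4)
qed

lemma act_psi_sq_even:
  assumes "even r"
  shows "act_psi r (act_psi r v) J = 0"
  using assms by (simp add: act_psi_def hop_def)

lemma act_psi_sq_odd:
  assumes "odd r"
  shows "act_psi r (act_psi r v) J = - (act_y r (act_y r v) J - act_y r (act_y (r+1) v) J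
      - act_y (r+1) (act_y r v) J + act_y (r+1) (act_y (r+1) v) J)"
proof (cases "r = 1")
  case True
  then show ?thesis by (simp add: act_psi_def hop_def act_y_def)
next
  case False
  with assms obtain a where r: "r = Suc a" "a \<noteq> 0" by (cases r) auto
  show ?thesis using assms
    \<comment> \<open>The operators involved read and change only the four points from
      \<open>r - 1\<close> to \<open>r + 2\<close>, so sixteen membership patterns decide both
      sides.\<close>
    by (cases "a \<in> J"; cases "Suc a \<in> J"; cases "Suc (Suc a) \<in> J"; cases "Suc (Suc (Suc a)) \<in> J";
      simp add: r act_psi_def act_y_def hop_def put_twist put_idem)
qed

lemma act_y_psi_odd:
  assumes "odd r"
  shows "act_y r (act_psi r v) J = act_psi r (act_y (r + 1) v) J"
    "act_y (r + 1) (act_psi r v) J = act_psi r (act_y r v) J"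
proof -
  obtain a where r: "r = Suc a" using assms by (cases r) auto
  show "act_y r (act_psi r v) J = act_psi r (act_y (r + 1) v) J" using assms
    by (cases "a \<in> J"; cases "Suc a \<in> J"; cases "Suc (Suc a) \<in> J"; cases "Suc (Suc (Suc a)) \<in> J";
      simp add: r act_psi_def act_y_def hop_def put_twist put_idem)
  show "act_y (r + 1) (act_psi r v) J = act_psi r (act_y r v) J" using assms
    by (cases "a \<in> J"; cases "Suc a \<in> J"; cases "Suc (Suc a) \<in> J"; cases "Suc (Suc (Suc a)) \<in> J";
      simp add: r act_psi_def act_y_def hop_def put_twist put_idem)
qed

text \<open>By \<open>wt_split_pair\<close> the condition in the correction term says that the
  residues at \<open>r\<close> and \<open>r + 1\<close> agree.\<close>

lemma act_y_psi_even:
  assumes "even r" "r > 0"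
  shows "act_y r (act_psi r v) J = act_psi r (act_y (r + 1) v) J - of_bool ((r \<in> J) \<noteq> (r + 1 \<in> J)) * v J"
    "act_y (r + 1) (act_psi r v) J = act_psi r (act_y r v) J + of_bool ((r \<in> J) \<noteq> (r + 1 \<in> J)) * v J"
  using assms
  by (cases "r \<in> J"; cases "Suc r \<in> J"; simp add: act_psi_def act_y_def hop_def put_twist put_idem)+

lemma act_y_psi_near:
  assumes "odd r" "r > 1" "s = r - 1 \<or> s = r + 2"
  shows "act_y s (act_psi r v) J = act_psi r (act_y s v) J"
proof -
  obtain a where r: "r = Suc a" "a \<noteq> 0" "even a" using assms by (cases r) auto
  show ?thesis using assms(3)
  proof
    assume "s = r - 1"
    then show ?thesis
    by (cases "a \<in> J"; cases "Suc a \<in> J"; cases "Suc (Suc a) \<in> J"; cases "Suc (Suc (Suc a)) \<in> J";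
      simp add: r act_psi_def act_y_def hop_def put_twist put_idem)
  next
    assume "s = r + 2"
    then show ?thesis
    by (cases "a \<in> J"; cases "Suc a \<in> J"; cases "Suc (Suc a) \<in> J"; cases "Suc (Suc (Suc a)) \<in> J";
      simp add: r act_psi_def act_y_def hop_def put_twist put_idem)
  qed
qed

text \<open>For even \<open>r\<close> the residues at \<open>r + 1\<close> and \<open>r + 2\<close>
  always differ, so the case distinction of the braid relations only asks whether the pair
  \<open>{r, r + 1}\<close> is split. The support of \<open>v\<close> is restricted accordingly: to
  split pairs here, to unsplit ones in \<open>braid_even_D\<close>. For odd \<open>r\<close> the
  pair \<open>{r + 1, r + 2}\<close> takes this part.\<close>

lemma braid_even_S:
  assumes "even r" "r > 0" "\<And>J. (r \<in> J) = (r + 1 \<in> J) \<Longrightarrow> v J = 0"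
  shows "act_psi r (act_psi (r+1) (act_psi r v)) J = act_psi (r+1) (act_psi r (act_psi (r+1) v)) J"
  using assms
    by (cases "r \<in> J"; cases "Suc r \<in> J"; cases "Suc (Suc r) \<in> J"; cases "Suc (Suc (Suc r)) \<in> J";
      simp add: act_psi_def hop_def put_twist put_idem)

lemma braid_even_D:
  assumes "even r" "r > 0" "\<And>J. (r \<in> J) \<noteq> (r + 1 \<in> J) \<Longrightarrow> v J = 0"
  shows "act_psi r (act_psi (r+1) (act_psi r v)) J = act_psi (r+1) (act_psi r (act_psi (r+1) v)) J
     + act_y r v J - 2 * act_y (r + 1) v J + act_y (r + 2) v J"
  using assms
    by (cases "r \<in> J"; cases "Suc r \<in> J"; cases "Suc (Suc r) \<in> J"; cases "Suc (Suc (Suc r)) \<in> J";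
      simp add: act_psi_def act_y_def hop_def put_twist put_idem)

lemma braid_odd_S:
  assumes "odd r" "r > 0" "\<And>J. (r + 1 \<in> J) = (r + 2 \<in> J) \<Longrightarrow> v J = 0"
  shows "act_psi r (act_psi (r+1) (act_psi r v)) J = act_psi (r+1) (act_psi r (act_psi (r+1) v)) J"
proof (cases "r = 1")
  case True
  then show ?thesis by (simp add: act_psi_def hop_def)
next
  case False
  with assms obtain a where r: "r = Suc a" "a \<noteq> 0" "even a" by (cases r) auto
  show ?thesis using assms(3)
    by (cases "a \<in> J"; cases "Suc a \<in> J"; cases "Suc (Suc a) \<in> J"; cases "Suc (Suc (Suc a)) \<in> J";
      simp add: r act_psi_def hop_def put_twist put_idem)
qed

lemma braid_odd_D:
  assumes "odd r" "r > 0" "\<And>J. (r + 1 \<in> J) \<noteq> (r + 2 \<in> J) \<Longrightarrow> v J = 0"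
  shows "act_psi r (act_psi (r+1) (act_psi r v)) J = act_psi (r+1) (act_psi r (act_psi (r+1) v)) J
     + act_y r v J - 2 * act_y (r + 1) v J + act_y (r + 2) v J"
proof (cases "r = 1")
  case True
  then show ?thesis using assms(3) by (simp add: act_psi_def act_y_def hop_def)
next
  case False
  with assms obtain a where r: "r = Suc a" "a \<noteq> 0" "even a" by (cases r) auto
  show ?thesis using assms(3)
    by (cases "a \<in> J"; cases "Suc a \<in> J"; cases "Suc (Suc a) \<in> J"; cases "Suc (Suc (Suc a)) \<in> J";
      simp add: r act_psi_def act_y_def hop_def put_twist put_idem)
qed

lemma act_y_hop: "\<exists>c. \<forall>v. act_y r v = (\<lambda>J. c * hop (2 * (r div 2) + 1) (2 * (r div 2)) v J)"
proof (cases "even r")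
  case True
  then show ?thesis by (intro exI[of _ 1]) (auto simp: act_y_def)
next
  case False
  then show ?thesis
    by (intro exI[of _ "if r = 1 then 0 else - 1"])
      (auto simp: fun_eq_iff act_y_def elim!: oddE)
qed

text \<open>Both are multiples of moves in pairs that coincide or are disjoint.\<close>

lemma act_y_commute: "act_y s (act_y r v) = act_y r (act_y s v)"
proof -
  define p q where "p = 2 * (r div 2)" and "q = 2 * (s div 2)"
  obtain c where c: "\<And>v :: nat set \<Rightarrow> 'a. act_y r v = (\<lambda>J. c * hop (p + 1) p v J)"
    using act_y_hop[of r] unfolding p_def by blast
  obtain d where d: "\<And>v :: nat set \<Rightarrow> 'a. act_y s v = (\<lambda>J. d * hop (q + 1) q v J)"
    using act_y_hop[of s] unfolding q_def by blast
  have "hop (p + 1) p (hop (q + 1) q v) = hop (q + 1) q (hop (p + 1) p v)" if "p \<noteq> q"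
    using that unfolding p_def q_def by (intro hop_hop_commute) presburger+
  then show ?thesis
    by (cases "p = q") (simp_all add: c d scale_ops mult.left_commute)
qed

lemma act_y_psi_commute:
  assumes "r \<ge> 1" "s \<noteq> r" "s \<noteq> r + 1"
  shows "act_y s (act_psi r v) = act_psi r (act_y s v)"
proof -
  define q where "q = 2 * (s div 2)"
  obtain d where d: "\<And>v :: nat set \<Rightarrow> 'a. act_y s v = (\<lambda>J. d * hop (q + 1) q v J)"
    using act_y_hop[of s] unfolding q_def by blast
  have "r = 1 \<or> r > 1" using assms(1) by auto
  then consider "even r" | "r = 1" | "odd r" "r > 1" "s = r - 1 \<or> s = r + 2"
    | "odd r" "s \<noteq> r - 1 \<and> s \<noteq> r + 2"
    by blast
  then show ?thesis
  proof cases
    case 1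
    then have "hop (q + 1) q (hop r (r + 1) v) = hop r (r + 1) (hop (q + 1) q v)"
      using assms unfolding q_def by (intro hop_hop_commute) presburger+
    moreover have "act_psi r v = (\<lambda>J. (- 1) * hop r (r + 1) v J)" for v :: "nat set \<Rightarrow> 'a"
      using 1 by (simp add: fun_eq_iff act_psi_def)
    ultimately show ?thesis
      by (simp only: d scale_ops mult.left_commute)
  next
    case 2
    have "act_psi 1 v = (\<lambda>J. 0 * v J)" for v :: "nat set \<Rightarrow> 'a"
      by (simp add: fun_eq_iff act_psi_def)
    then show ?thesis
      unfolding 2 by (simp only: scale_ops)
  next
    case 3
    then show ?thesis using act_y_psi_near by (intro ext) blast
  next
    case 4
    have "q + 1 < r - 1 \<or> q > r + 2"
      using 4 assms unfolding q_def by presburger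
    then have "hop (q + 1) q (act_psi r v) = act_psi r (hop (q + 1) q v)"
      by (intro hop_act_psi_commute) auto
    then show ?thesis by (simp only: d scale_ops)
  qed
qed

text \<open>This is the one case of distant commutation with overlapping supports: both operators
  touch the pair \<open>{r + 1, r + 2}\<close>, and a move by one changes the sign used by the
  other.\<close>

lemma act_psi_psi_near:
  assumes "odd r"
  shows "act_psi r (act_psi (r + 2) v) J = act_psi (r + 2) (act_psi r v) J"
proof (cases "r = 1")
  case True
  then show ?thesis by (simp add: act_psi_def hop_def)
next
  case False
  with assms obtain a where r: "r = Suc a" "a \<noteq> 0" "even a" by (cases r) auto
  show ?thesis
    by (cases "a \<in> J"; cases "Suc a \<in> J"; cases "Suc (Suc a) \<in> J"; cases "Suc (Suc (Suc a)) \<in> J";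
      cases "Suc (Suc (Suc (Suc a))) \<in> J"; cases "Suc (Suc (Suc (Suc (Suc a)))) \<in> J";
      simp add: r act_psi_def hop_def put_twist put_idem)
qed

lemma act_psi_psi_far:
  assumes "even r" "s \<ge> 1" "s \<noteq> r + 1" "r \<noteq> s + 1"
  shows "act_psi s (act_psi r v) = act_psi r (act_psi s v)"
proof -
  have psi: "act_psi r v = (\<lambda>J. (- 1) * hop r (r + 1) v J)" for v :: "nat set \<Rightarrow> 'a"
    using assms by (simp add: fun_eq_iff act_psi_def)
  have "hop r (r + 1) (act_psi s v) = act_psi s (hop r (r + 1) v)"
  proof (cases "even s")
    case True
    then have psi': "act_psi s v = (\<lambda>J. (- 1) * hop s (s + 1) v J)" for v :: "nat set \<Rightarrow> 'a"
      using assms by (simp add: fun_eq_iff act_psi_def)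
    have "hop r (r + 1) (hop s (s + 1) v) = hop s (s + 1) (hop r (r + 1) v)"
    proof (cases "r = s")
      case False
      then show ?thesis using assms True by (intro hop_hop_commute) presburger+
    qed simp
    then show ?thesis by (simp only: psi' scale_ops)
  next
    case False
    have "r + 1 < s - 1 \<or> r > s + 2"
      using assms False by presburger
    then show ?thesis by (intro hop_act_psi_commute) auto
  qed
  then show ?thesis by (simp only: psi scale_ops)
qed

lemma act_psi_psi_odd:
  assumes "odd r" "odd s" "r < s"
  shows "act_psi s (act_psi r v) = act_psi r (act_psi s v)"
proof (cases "s = r + 2")
  case True
  show ?thesis unfolding True by (intro ext act_psi_psi_near[OF assms(1), symmetric])
next
  case False
  then have s: "s > r + 3" using assms by presburger
  have 1: "hop r (r + 1) (act_psi s v) = act_psi s (hop r (r + 1) v)"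
    by (rule hop_act_psi_commute) (use s in auto)
  have 2: "hop (r + 2) (r - 1) (act_psi s v) = act_psi s (hop (r + 2) (r - 1) v)"
    by (rule hop_act_psi_commute) (use s in auto)
  have 3: "act_psi s (\<lambda>J. u J + (if (r \<in> J) = (r + 1 \<in> J) then 1 else - 1) * w J)
    = (\<lambda>J. act_psi s u J + (if (r \<in> J) = (r + 1 \<in> J) then 1 else - 1) * act_psi s w J)"
    for u w :: "nat set \<Rightarrow> 'a"
  proof -
    have ne: "r \<notin> {p, q}" "r + 1 \<notin> {p, q}" if "{p, q} \<subseteq> {s - 1..s + 2}" for p q
      using s that by auto
    have "{s, s + 1} \<subseteq> {s - 1..s + 2}" "{s + 2, s - 1} \<subseteq> {s - 1..s + 2}"
      by auto
    note e = hop_signed[OF ne[OF this(1)]] hop_signed[OF ne[OF this(2)]]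
    show ?thesis
      by (rule ext, simp only: act_psi_def[of s] e) (use s assms in \<open>simp add: algebra_simps\<close>)
  qed
  show ?thesis
  proof (cases "r = 1")
    case True
    then show ?thesis by (simp add: fun_eq_iff act_psi_def hop_def)
  next
    case False
    then have "act_psi r v = (\<lambda>J. hop r (r + 1) v J
        + (if (r \<in> J) = (r + 1 \<in> J) then 1 else - 1) * hop (r + 2) (r - 1) v J)" for v :: "nat set \<Rightarrow> 'a"
      using assms(1) by (simp add: fun_eq_iff act_psi_def)
    then show ?thesis by (simp only: 1 2 3)
  qed
qed

lemma act_psi_psi_commute:
  assumes "r \<ge> 1" "s \<ge> 1" "s \<noteq> r + 1" "r \<noteq> s + 1"
  shows "act_psi s (act_psi r v) = act_psi r (act_psi s v)"
proof -
  consider "even r" | "even s" | "r = s" | "odd r" "odd s" "r < s" | "odd r" "odd s" "s < r"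
    by linarith
  then show ?thesis
  proof cases
    case 1
    from act_psi_psi_far[OF this assms(2-4)] show ?thesis .
  next
    case 2
    from act_psi_psi_far[OF this assms(1,4,3)] show ?thesis by (rule sym)
  next
    case 4
    from act_psi_psi_odd[OF this] show ?thesis .
  next
    case 5
    from act_psi_psi_odd[OF this(2,1,3)] show ?thesis by (rule sym)
  qed simp
qed

lemma swap_swap: "1 \<le> r \<Longrightarrow> r < length i \<Longrightarrow> swap r (swap r i) = i"
  by (auto simp: swap_def list_eq_iff_nth_eq nth_list_update)

lemma seq_eqI:
  assumes "1 \<le> r" "r < n"
    and "\<And>k. wt J' k = wt J (if k = r then r + 1 else if k = r + 1 then r else k)"
  shows "seq n J' = swap r (seq n J)"
  using assms(1,2) by (auto simp: list_eq_iff_nth_eq swap_def nth_list_update nth_seq assms(3))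

text \<open>The counts behind the two residues differ exactly by the number of elements in the pair,
  and the even position adds a one. So the residues agree iff that number is odd.\<close>

lemma wt_split_pair: "even r \<Longrightarrow> r > 0 \<Longrightarrow> (wt J r = wt J (r + 1)) = ((r \<in> J) \<noteq> (r + 1 \<in> J))"
proof -
  assume r: "even r" "r > 0"
  then have "J \<inter> {2..r + 1} = J \<inter> {2..<r} \<union> (J \<inter> {r, r + 1})"
    by (auto elim!: evenE)
  moreover have "card (J \<inter> {2..<r} \<union> (J \<inter> {r, r + 1})) = card (J \<inter> {2..<r}) + card (J \<inter> {r, r + 1})"
    by (rule card_Un_disjoint) auto
  moreover have "card (J \<inter> {r, r + 1}) = of_bool (r \<in> J) + of_bool (r + 1 \<in> J)"
    by (auto simp: Int_insert_right)
  ultimately have "card (J \<inter> {2..r + 1}) = card (J \<inter> {2..<r}) + of_bool (r \<in> J) + of_bool (r + 1 \<in> J)"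
    by simp
  with r show ?thesis
    by (cases "r \<in> J"; cases "r + 1 \<in> J"; simp add: wt_def) presburger+
qed

lemma wt_odd_neq: "odd r \<Longrightarrow> wt J r \<noteq> wt J (r + 1)"
  by (simp add: wt_def atLeastLessThanSuc_atLeastAtMost) presburger

lemma act_psi_e:
  assumes "i \<in> res_seqs n" "r \<in> {1..<n}"
  shows "act_psi r (act_e n i v) = act_e n (swap r i) (act_psi r v)"
proof
  fix J
  have len: "length i = n" using assms by (simp add: res_seqs_def)
  have iff: "seq n J' = i \<longleftrightarrow> seq n J = swap r i" if "seq n J' = swap r (seq n J)" for J'
    using that swap_swap[of r i] swap_swap[of r "seq n J"] assms len
    by (metis atLeastLessThan_iff length_seq)
  have *: "hop p q (act_e n i v) J = (if seq n J = swap r i then hop p q v J else 0)"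
    if move: "\<And>k. p \<notin> J \<Longrightarrow> q \<in> J \<Longrightarrow> wt (put p True (put q False J)) k = wt J (if k = r then r + 1 else if k = r + 1 then r else k)" for p q
  proof -
    have "seq n (put p True (put q False J)) = swap r (seq n J)" if "p \<notin> J" "q \<in> J"
      using assms(2) that move by (intro seq_eqI) auto
    then show ?thesis using iff by (auto simp: hop_def act_e_def)
  qed
  show "act_psi r (act_e n i v) J = act_e n (swap r i) (act_psi r v) J"
  proof (cases "even r")
    case True
    \<comment> \<open>For even \<open>r\<close> a move takes place only if the pair is split. Then
      the two residues agree, so the required exchange is invisible.\<close>
    have "wt (put r True (put (r + 1) False J)) k = wt J (if k = r then r + 1 else if k = r + 1 then r else k)"
      if "r \<notin> J" "r + 1 \<in> J" for k
      using wt_move_pair[OF that True] wt_split_pair[of r J] True that assms(2) by auto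
    from *[OF this] show ?thesis using True by (simp add: act_psi_def act_e_def)
  next
    case False
    have "wt (put p True (put q False J)) k = wt J (if k = r then r + 1 else if k = r + 1 then r else k)"
      if "p \<notin> J" "q \<in> J" "r > 1" "(p, q) \<in> {(r, r + 1), (r + 2, r - 1)}" for k p q
      using wt_move_psi that False by blast
    then have "hop p q (act_e n i v) J = (if seq n J = swap r i then hop p q v J else 0)"
      if "r > 1" "(p, q) \<in> {(r, r + 1), (r + 2, r - 1)}" for p q
      using that by (intro *) blast
    then show ?thesis using False assms(2)
      by (cases "r = 1") (simp_all add: act_psi_def act_e_def)
  qed
qed

lemma act_y_e: "act_y r (act_e n i v) = act_e n i (act_y r v)"
proof -
  define q where "q = 2 * (r div 2)"
  obtain d where d: "\<And>v :: nat set \<Rightarrow> 'a. act_y r v = (\<lambda>J. d * hop (q + 1) q v J)"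
    using act_y_hop[of r] unfolding q_def by blast
  have "hop (q + 1) q (act_e n i v) = act_e n i (hop (q + 1) q v)"
  proof
    fix J
    have "seq n (put (q + 1) True (put q False J)) = seq n J" if "q + 1 \<notin> J" "q \<in> J"
      using that by (rule seq_move_pair[of _ _ _ q]) (auto simp: q_def)
    then show "hop (q + 1) q (act_e n i v) J = act_e n i (hop (q + 1) q v) J"
      by (simp add: hop_def act_e_def)
  qed
  then show ?thesis by (simp only: d scale_ops)
qed

lemma finite_res_seqs: "finite (res_seqs n)"
  using finite_lists_length_eq[of "{0, 1 :: nat}" n] by (simp add: res_seqs_def conj_commute)

lemma sum_act_e: "(\<Sum>i\<in>res_seqs n. act_e n i v J) = v J"
  by (simp add: act_e_def sum.delta' finite_res_seqs seq_in_res_seqs)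

section \<open>The representation of the free algebra\<close>

fun act :: "nat \<Rightarrow> klr_gen \<Rightarrow> (nat set \<Rightarrow> 'f::field) \<Rightarrow> nat set \<Rightarrow> 'f" where
  "act n (Y r) = act_y r"
| "act n (Psi r) = act_psi r"
| "act n (E i) = act_e n i"

definition rep :: "nat \<Rightarrow> 'f::field klr_free \<Rightarrow> (nat set \<Rightarrow> 'f) \<Rightarrow> nat set \<Rightarrow> 'f" where
  "rep n p v J = (\<Sum>w\<in>Poly_Mapping.keys p. Poly_Mapping.lookup p w * foldr (act n) (letters w) v J)"

lemma act_add: "act n g (u + v) = act n g u + act n g v"
  by (cases g) (simp_all add: linear_ops)

lemma act_scale: "act n g (\<lambda>J. c * v J) = (\<lambda>J. c * act n g v J)"
  by (cases g) (simp_all add: scale_ops)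

lemma act_zero [simp]: "act n g 0 = 0"
  using act_add[of n g 0 0] by simp

lemma act_y_zero: "act_y r 0 = 0"
  using act_zero[of 0 "Y r"] by simp

lemma act_psi_zero: "act_psi r 0 = 0"
  using act_zero[of 0 "Psi r"] by simp

lemma sum_fun_apply: "(\<Sum>i\<in>I. f i) J = (\<Sum>i\<in>I. f i J :: 'a::comm_monoid_add)"
  by (induction I rule: infinite_finite_induct) simp_all

lemma foldr_act_add: "foldr (act n) xs (u + v) = foldr (act n) xs u + foldr (act n) xs v"
  by (induction xs) (simp_all only: foldr.simps o_apply id_apply act_add)

lemma foldr_act_scale: "foldr (act n) xs (\<lambda>J. c * v J) = (\<lambda>J. c * foldr (act n) xs v J)"
  by (induction xs) (simp_all add: act_scale)

lemma rep_superset: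
  assumes "finite S" "Poly_Mapping.keys p \<subseteq> S"
  shows "rep n p v J = (\<Sum>w\<in>S. Poly_Mapping.lookup p w * foldr (act n) (letters w) v J)"
  unfolding rep_def
  by (rule sum.mono_neutral_left) (use assms in \<open>auto simp: in_keys_iff\<close>)

lemma rep_add: "rep n (p + q) v = rep n p v + rep n q v"
proof
  fix J
  let ?S = "Poly_Mapping.keys p \<union> Poly_Mapping.keys q"
  have "rep n x v J = (\<Sum>w\<in>?S. Poly_Mapping.lookup x w * foldr (act n) (letters w) v J)"
    if "x \<in> {p, q, p + q}" for x
    by (rule rep_superset) (use that Poly_Mapping.keys_add[of p q] in auto)
  then show "rep n (p + q) v J = (rep n p v + rep n q v) J"
    by (simp add: lookup_add distrib_right sum.distrib)
qed

lemma rep_zero [simp]: "rep n 0 v = 0"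
  by (simp add: fun_eq_iff rep_def)

lemma rep_uminus: "rep n (- p) v = - rep n p v"
  using rep_add[of n p "- p" v] by (simp add: eq_neg_iff_add_eq_0 add.commute)

lemma rep_diff: "rep n (p - q) v = rep n p v - rep n q v"
  using rep_add[of n p "- q" v] by (simp add: rep_uminus)

lemma rep_sum: "rep n (\<Sum>i\<in>I. f i) v = (\<Sum>i\<in>I. rep n (f i) v)"
  by (induction I rule: infinite_finite_induct) (simp_all add: rep_add)

lemma rep_single: "rep n (Poly_Mapping.single w c) v = (\<lambda>J. c * foldr (act n) (letters w) v J)"
  by (auto simp: fun_eq_iff rep_def)

lemma rep_gen [simp]: "rep n (gen g) v = act n g v"
  by (simp add: gen_def rep_single)

lemma rep_scalar: "rep n (Poly_Mapping.single 0 c) v = (\<lambda>J. c * v J)"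
  by (simp add: rep_single zero_free_monoid_def)

lemma rep_one [simp]: "rep n 1 v = v"
  using rep_scalar[of n 1 v] by simp

lemma rep_vec_add: "rep n p (u + v) = rep n p u + rep n p v"
  by (simp add: fun_eq_iff rep_def foldr_act_add distrib_left sum.distrib)

lemma rep_vec_scale: "rep n p (\<lambda>J. c * v J) = (\<lambda>J. c * rep n p v J)"
  by (simp add: fun_eq_iff rep_def foldr_act_scale sum_distrib_left mult.left_commute)

lemma rep_vec_zero [simp]: "rep n p 0 = 0"
  using rep_vec_add[of n p 0 0] by simp

lemma free_algebra_induct [case_names zero add]:
  fixes P :: "('x free_monoid \<Rightarrow>\<^sub>0 'f::field) \<Rightarrow> bool"
  assumes "P 0" "\<And>p w c. w \<notin> Poly_Mapping.keys p \<Longrightarrow> c \<noteq> 0 \<Longrightarrow> P p \<Longrightarrow> P (Poly_Mapping.single w c + p)"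
  shows "P p"
proof (induction p rule: update_induct)
  case const
  then show ?case by (rule assms(1))
next
  case (update p w c)
  have "Poly_Mapping.update w c p = Poly_Mapping.single w c + p"
    using update(1) by (intro poly_mapping_eqI) (auto simp: lookup_update lookup_add lookup_single in_keys_iff)
  then show ?case using assms(2) update by simp
qed

lemma rep_mult: "rep n (p * q) v = rep n p (rep n q v)"
proof (induction p rule: free_algebra_induct)
  case zero
  then show ?case by simp
next
  case (add p w c)
  have "rep n (Poly_Mapping.single w c * q) v = rep n (Poly_Mapping.single w c) (rep n q v)"
  proof (induction q rule: free_algebra_induct)
    case zero
    then show ?case by (simp only: mult_zero_right rep_zero rep_vec_zero)
  next
    case (add q u d)
    have "rep n (Poly_Mapping.single w c * Poly_Mapping.single u d) v
        = rep n (Poly_Mapping.single w c) (rep n (Poly_Mapping.single u d) v)"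
      by (simp add: mult_single rep_single plus_free_monoid_def foldr_act_scale mult.assoc)
    with add show ?case by (simp only: distrib_left rep_add rep_vec_add)
  qed
  with add show ?case by (simp only: distrib_right rep_add)
qed

lemma entry_in_seq:
  assumes "act_e n i v J \<noteq> 0" "1 \<le> r" "r \<le> n"
  shows "entry i r = wt J r"
  using assms entry_seq[of r n J] by (auto simp: act_e_def split: if_splits)

text \<open>Every conditional relation ends in an idempotent, so it is tested on a function
  \<open>act_e n i v\<close>. Where this is non-zero at \<open>J\<close>, the entries of
  \<open>i\<close> are the residues of \<open>J\<close> (\<open>entry_in_seq\<close>), and the
  condition on \<open>i\<close> turns into one on a pair.\<close>

lemma rep_klr_rel:
  fixes v :: "nat set \<Rightarrow> 'f::field"
  assumes "klr_rel n l r" "n > 0"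
  shows "rep n l v = rep n r v"
  using assms(1)
proof cases
  case y_one
  then show ?thesis by (simp add: fun_eq_iff act_y_def)
next
  case (e_first i)
  have "act_e n i v J = 0" for J
  proof (rule ccontr)
    assume *: "act_e n i v J \<noteq> 0"
    then show False
      using assms(2) entry_in_seq[OF *, of 1] e_first by (simp add: wt_def)
  qed
  then show ?thesis using e_first by (simp add: fun_eq_iff)
next
  case (e_e i j)
  then show ?thesis by (auto simp: rep_mult fun_eq_iff act_e_def)
next
  case e_sum
  then show ?thesis by (simp add: rep_sum fun_eq_iff) (simp add: sum_act_e sum_fun_apply)
next
  case (y_e i k)
  then show ?thesis by (simp add: rep_mult act_y_e)
next
  case (psi_e i k)
  then show ?thesis by (simp add: rep_mult act_psi_e)
next
  case (y_y k s)
  then show ?thesis by (simp add: rep_mult act_y_commute[of s])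
next
  case (y_psi k s)
  then show ?thesis by (simp add: rep_mult act_y_psi_commute)
next
  case (y_psi_e i k)
  let ?u = "act_e n i v"
  have "act_y k (act_psi k ?u) J = act_psi k (act_y (k + 1) ?u) J - (if entry i k = entry i (k + 1) then 1 else 0) * ?u J" for J
  proof (cases "?u J = 0")
    case True
    then show ?thesis
      using act_y_psi_even(1)[of k ?u J] act_y_psi_odd(1)[of k ?u J] y_psi_e by (cases "even k") auto
  next
    case False
    then have "(entry i k = entry i (k + 1)) = (wt J k = wt J (k + 1))"
      using entry_in_seq[OF False, of k] entry_in_seq[OF False, of "k + 1"] y_psi_e by auto
    then show ?thesis
      using act_y_psi_even(1)[of k ?u J] act_y_psi_odd(1)[of k ?u J] y_psi_e
        wt_split_pair[of k J] wt_odd_neq[of k J] by (cases "even k") auto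
  qed
  with y_psi_e show ?thesis
    by (auto simp: rep_mult rep_diff fun_eq_iff)
next
  case (y_Suc_psi_e i k)
  let ?u = "act_e n i v"
  have "act_y (k + 1) (act_psi k ?u) J = act_psi k (act_y k ?u) J + (if entry i k = entry i (k + 1) then 1 else 0) * ?u J" for J
  proof (cases "?u J = 0")
    case True
    then show ?thesis
      using act_y_psi_even(2)[of k ?u J] act_y_psi_odd(2)[of k ?u J] y_Suc_psi_e by (cases "even k") auto
  next
    case False
    then have "(entry i k = entry i (k + 1)) = (wt J k = wt J (k + 1))"
      using entry_in_seq[OF False, of k] entry_in_seq[OF False, of "k + 1"] y_Suc_psi_e by auto
    then show ?thesis
      using act_y_psi_even(2)[of k ?u J] act_y_psi_odd(2)[of k ?u J] y_Suc_psi_e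
        wt_split_pair[of k J] wt_odd_neq[of k J] by (cases "even k") auto
  qed
  with y_Suc_psi_e show ?thesis
    by (auto simp: rep_mult rep_add fun_eq_iff)
next
  case (psi_psi k s)
  then show ?thesis using act_psi_psi_commute[of k s v] by (simp add: rep_mult)
next
  case (psi_sq_eq i k)
  let ?u = "act_e n i v"
  have "act_psi k (act_psi k ?u) J = 0" for J
  proof (cases "even k")
    case False
    have "?u J = 0" for J
      using entry_in_seq[of n i v J k] entry_in_seq[of n i v J "k + 1"] wt_odd_neq[OF False, of J] psi_sq_eq by force
    then have "?u = 0" by (simp add: fun_eq_iff)
    then show ?thesis by (simp only: act_psi_zero zero_fun_apply)
  qed (simp add: act_psi_sq_even)
  with psi_sq_eq show ?thesis
    by (simp add: rep_mult power2_eq_square fun_eq_iff)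
next
  case (psi_sq_neq i k)
  let ?u = "act_e n i v"
  have "act_psi k (act_psi k ?u) J = - (act_y k (act_y k ?u) J - act_y k (act_y (k+1) ?u) J
      - act_y (k+1) (act_y k ?u) J + act_y (k+1) (act_y (k+1) ?u) J)" for J
  proof (cases "even k")
    case True
    \<comment> \<open>Unequal residues mean that the pair is unsplit throughout the support, so both
      \<open>y\<close> kill this weight space and the two sides vanish.\<close>
    have split: "?u J = 0" if "(k \<in> J) \<noteq> (k + 1 \<in> J)" for J
      using entry_in_seq[of n i v J k] entry_in_seq[of n i v J "k + 1"] wt_split_pair[OF True, of J] psi_sq_neq that by force
    have "act_y s ?u = 0" if "s \<in> {k, k + 1}" for s
      using True psi_sq_neq that by (auto simp: fun_eq_iff act_y_def hop_def intro!: split)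
    then have "act_y k ?u = 0" "act_y (k + 1) ?u = 0" by blast+
    then show ?thesis using True by (simp only: act_psi_sq_even act_y_zero zero_fun_apply) simp
  qed (rule act_psi_sq_odd)
  then show ?thesis
    unfolding psi_sq_neq(1,2)
    by (simp add: rep_mult power2_eq_square fun_eq_iff rep_uminus rep_diff algebra_simps rep_add)
next
  case (braid i k)
  let ?u = "act_e n i v"
  have "act_psi k (act_psi (k+1) (act_psi k ?u)) J = act_psi (k+1) (act_psi k (act_psi (k+1) ?u)) J" for J
  proof (cases "even k")
    case True
    have "?u J = 0" if "(k \<in> J) = (k + 1 \<in> J)" for J
      using entry_in_seq[of n i v J k] entry_in_seq[of n i v J "k + 1"] entry_in_seq[of n i v J "k + 2"]
        wt_split_pair[OF True, of J] wt_odd_neq[of "k + 1" J] True braid that by force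
    then show ?thesis using True braid by (intro braid_even_S) auto
  next
    case False
    have "?u J = 0" if "(k + 1 \<in> J) = (k + 2 \<in> J)" for J
      using entry_in_seq[of n i v J k] entry_in_seq[of n i v J "k + 1"] entry_in_seq[of n i v J "k + 2"]
        wt_split_pair[of "k + 1" J] wt_odd_neq[OF False, of J] False braid that by force
    then show ?thesis using False braid by (intro braid_odd_S) auto
  qed
  with braid show ?thesis by (simp add: rep_mult fun_eq_iff)
next
  case (braid_neq i k)
  let ?u = "act_e n i v"
  have "act_psi k (act_psi (k+1) (act_psi k ?u)) J = act_psi (k+1) (act_psi k (act_psi (k+1) ?u)) J
    + act_y k ?u J - 2 * act_y (k + 1) ?u J + act_y (k + 2) ?u J" for J
  proof (cases "even k")
    case True
    have "?u J = 0" if "(k \<in> J) \<noteq> (k + 1 \<in> J)" for J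
      using entry_in_seq[of n i v J k] entry_in_seq[of n i v J "k + 1"] entry_in_seq[of n i v J "k + 2"]
        wt_split_pair[OF True, of J] wt_odd_neq[of "k + 1" J] True braid_neq that by force
    then show ?thesis using True braid_neq by (intro braid_even_D) auto
  next
    case False
    have "?u J = 0" if "(k + 1 \<in> J) \<noteq> (k + 2 \<in> J)" for J
      using entry_in_seq[of n i v J k] entry_in_seq[of n i v J "k + 1"] entry_in_seq[of n i v J "k + 2"]
        wt_split_pair[of "k + 1" J] wt_odd_neq[OF False, of J] False braid_neq that by force
    then show ?thesis using False braid_neq by (intro braid_odd_D) auto
  qed
  moreover have "rep n 2 w = (\<lambda>J. 2 * w J)" for w :: "nat set \<Rightarrow> 'f"
    using rep_scalar[of n 2 w] by simp
  ultimately show ?thesis using braid_neq by (simp add: rep_mult fun_eq_iff rep_add rep_diff)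
qed

section \<open>An upper bound for the dimension of Specht modules\<close>

lemma scalar_central:
  "p * Poly_Mapping.single 0 c = Poly_Mapping.single 0 c * (p :: 'x free_monoid \<Rightarrow>\<^sub>0 'f::field)"
  by (induction p rule: free_algebra_induct) (simp_all add: distrib_left distrib_right mult_single mult.commute)

text \<open>Scalars are constants of the free algebra itself, so left ideals are subspaces at
  once.\<close>

interpretation fa: vector_space "\<lambda>c p. Poly_Mapping.single 0 c * (p :: 'x free_monoid \<Rightarrow>\<^sub>0 'f::field)"
  by standard (simp_all add: distrib_left distrib_right single_add mult_single mult.assoc[symmetric])

abbreviation klr_carrier :: "nat \<Rightarrow> 'f::field klr_free set" where
  "klr_carrier n \<equiv> carrier (klr_free_algebra n)"

lemma free_algebra_simps:
  "add (free_algebra A) = (+)" "mult (free_algebra A) = (*)"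
  "zero (free_algebra A) = 0" "one (free_algebra A) = 1"
  by (simp_all add: free_algebra_def)

lemma scalar_closed: "Poly_Mapping.single 0 c \<in> carrier (free_algebra A)"
  by (simp add: free_algebra_def zero_free_monoid_def)

lemma subspace_free_algebra: "fa.subspace (carrier (free_algebra A))"
  by (rule fa.subspaceI)
    (auto intro!: free_algebra_add_closed free_algebra_mult_closed scalar_closed, simp add: free_algebra_def)

lemma one_in_free_algebra: "1 \<in> carrier (free_algebra A)"
  by (simp add: free_algebra_def zero_free_monoid_def)

context
  fixes n :: nat
  assumes n: "n > 0"
begin

lemma ideal_klr_ideal: "ideal (klr_ideal n) (klr_free_algebra n :: 'f::field klr_free ring)"
proof -
  have "{l - r | l r. klr_rel n l r} \<subseteq> klr_carrier n"
    using klr_rel_closed n free_algebra_diff_closed by blast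
  then show ?thesis
    unfolding klr_ideal_def by (rule ring.genideal_ideal[OF ring_free_algebra])
qed

lemma klr_rel_in_ideal: "klr_rel n l r \<Longrightarrow> l - r \<in> klr_ideal n"
proof -
  assume "klr_rel n l r"
  moreover have "{l - r | l r. klr_rel n l r} \<subseteq> klr_carrier n"
    using klr_rel_closed n free_algebra_diff_closed by blast
  ultimately show ?thesis
    unfolding klr_ideal_def using ring.genideal_self[OF ring_free_algebra] by blast
qed

lemma klr_ideal_mult:
  assumes "x \<in> klr_ideal n" "p \<in> klr_carrier n"
  shows "p * x \<in> klr_ideal n" "x * p \<in> klr_ideal n"
  using ideal.I_l_closed[OF ideal_klr_ideal assms] ideal.I_r_closed[OF ideal_klr_ideal assms]
  by (simp_all add: free_algebra_simps)

lemma subspace_klr_ideal: "fa.subspace (klr_ideal n)"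
proof (rule fa.subspaceI)
  note sub = ideal.axioms(1)[OF ideal_klr_ideal]
  show "0 \<in> klr_ideal n"
    using additive_subgroup.zero_closed[OF sub] by (simp add: free_algebra_simps)
  show "x + y \<in> klr_ideal n" if "x \<in> klr_ideal n" "y \<in> klr_ideal n" for x y :: "'a klr_free"
    using that additive_subgroup.a_closed[OF sub, of x y] by (simp add: free_algebra_simps)
  show "Poly_Mapping.single 0 c * x \<in> klr_ideal n" if "x \<in> klr_ideal n" for c and x :: "'a klr_free"
    using klr_ideal_mult(1)[OF that scalar_closed] .
qed

lemma klr_ideal_subset: "klr_ideal n \<subseteq> klr_carrier n"
  using ideal.Icarr[OF ideal_klr_ideal] by blast

lemma klr_rel_mult:
  assumes "klr_rel n l r" "x \<in> klr_carrier n"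
  shows "l * x - r * x \<in> klr_ideal n"
  using klr_ideal_mult(2)[OF klr_rel_in_ideal[OF assms(1)] assms(2)] by (simp add: left_diff_distrib)

end

section \<open>Submodules over fewer strands\<close>

definition level_gens :: "nat \<Rightarrow> nat \<Rightarrow> klr_gen set" where
  "level_gens n k = Y ` {1..k} \<union> Psi ` {1..<k} \<union> E ` res_seqs n"

text \<open>These are the preimages in the free algebra of submodules over the part of the algebra
  on the first \<open>k\<close> strands; the idempotents keep full length \<open>n\<close> at every
  level. A quotient by a submodule is expressed by congruences modulo \<open>K\<close>, so all
  levels share one carrier.\<close>

definition stable :: "nat \<Rightarrow> nat \<Rightarrow> 'f::field klr_free set \<Rightarrow> bool" where
  "stable n k K \<longleftrightarrow> fa.subspace K \<and> klr_ideal n \<subseteq> K \<and> K \<subseteq> klr_carrier n \<and>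
     (\<forall>g\<in>level_gens n k. \<forall>x\<in>K. gen g * x \<in> K)"

definition orbit :: "nat \<Rightarrow> nat \<Rightarrow> 'f::field klr_free set \<Rightarrow> 'f klr_free set" where
  "orbit n k X = \<Inter>{K. stable n k K \<and> X \<subseteq> K}"

lemma level_gens_mono: "k \<le> l \<Longrightarrow> level_gens n k \<subseteq> level_gens n l"
  by (auto simp: level_gens_def)

lemma level_gens_closed: "k \<le> n \<Longrightarrow> g \<in> level_gens n k \<Longrightarrow> gen g \<in> klr_carrier n"
  by (rule gen_closed) (auto simp: level_gens_def klr_gens_def)

lemma stable_mono: "k \<le> l \<Longrightarrow> stable n l K \<Longrightarrow> stable n k K"
  using level_gens_mono[of k l n] by (auto simp: stable_def)

lemma stable_carrier: "n > 0 \<Longrightarrow> k \<le> n \<Longrightarrow> stable n k (klr_carrier n)"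
  unfolding stable_def
  using subspace_free_algebra klr_ideal_subset level_gens_closed free_algebra_mult_closed by blast

lemma orbit_subset: "stable n k K \<Longrightarrow> X \<subseteq> K \<Longrightarrow> orbit n k X \<subseteq> K"
  by (auto simp: orbit_def)

lemma subset_orbit: "X \<subseteq> orbit n k X"
  by (auto simp: orbit_def)

lemma stable_orbit:
  assumes "n > 0" "k \<le> n" "X \<subseteq> klr_carrier n"
  shows "stable n k (orbit n k X)"
proof -
  have "klr_carrier n \<in> {K. stable n k K \<and> X \<subseteq> K}"
    using assms stable_carrier by blast
  moreover have "fa.subspace (orbit n k X)"
    unfolding orbit_def by (rule fa.subspace_Inter) (auto simp: stable_def)
  ultimately show ?thesis
    unfolding stable_def orbit_def by (intro conjI; (blast | (auto simp: stable_def)))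
qed

lemma orbit_mono: "X \<subseteq> X' \<Longrightarrow> orbit n k X \<subseteq> orbit n k X'"
  by (auto simp: orbit_def)

lemma orbit_orbit:
  assumes "n > 0" "k \<le> n" "X' \<subseteq> klr_carrier n" "X \<subseteq> orbit n k X'"
  shows "orbit n k X \<subseteq> orbit n k X'"
  using assms by (intro orbit_subset stable_orbit)

text \<open>The elements that \<open>T\<close> carries into \<open>K\<close> form a stable subspace.
  The generator \<open>g'\<close> may differ from \<open>g\<close> because a crossing turns
  \<open>e(i)\<close> into \<open>e(swap r i)\<close>.\<close>

lemma orbit_operator:
  assumes n: "n > 0" "k \<le> n" and K: "stable n k K" and T: "T \<in> klr_carrier n"
    and comm: "\<And>g. g \<in> level_gens n k \<Longrightarrow> \<exists>g'\<in>level_gens n k. \<forall>x\<in>klr_carrier n.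
      T * (gen g * x) - gen g' * (T * x) \<in> klr_ideal n"
    and X: "X \<subseteq> klr_carrier n" "\<And>x. x \<in> X \<Longrightarrow> T * x \<in> K"
    and x: "x \<in> orbit n k X"
  shows "T * x \<in> K"
proof -
  have sub: "fa.subspace K" and I: "klr_ideal n \<subseteq> K" and cl: "\<And>g x. g \<in> level_gens n k \<Longrightarrow> x \<in> K \<Longrightarrow> gen g * x \<in> K"
    using K by (auto simp: stable_def)
  define Q where "Q = {x \<in> klr_carrier n. T * x \<in> K}"
  have "stable n k Q"
    unfolding stable_def
  proof (intro conjI ballI)
    show "fa.subspace Q"
    proof (rule fa.subspaceI)
      show "0 \<in> Q"
        using fa.subspace_0[OF sub] fa.subspace_0[OF subspace_free_algebra] by (simp add: Q_def)
      show "x + y \<in> Q" if "x \<in> Q" "y \<in> Q" for x y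
        using that fa.subspace_add[OF sub] free_algebra_add_closed by (auto simp: Q_def distrib_left)
      show "Poly_Mapping.single 0 c * x \<in> Q" if "x \<in> Q" for c x
      proof -
        have "T * (Poly_Mapping.single 0 c * x) = Poly_Mapping.single 0 c * (T * x)"
          by (simp add: mult.assoc[symmetric] scalar_central)
        then show ?thesis
          using that fa.subspace_scale[OF sub] free_algebra_mult_closed[OF scalar_closed] by (auto simp: Q_def)
      qed
    qed
    show "klr_ideal n \<subseteq> Q"
      using I klr_ideal_subset[OF n(1)] klr_ideal_mult(1)[OF n(1) _ T] by (auto simp: Q_def)
    show "Q \<subseteq> klr_carrier n" by (auto simp: Q_def)
    fix g x assume g: "g \<in> level_gens n k" and x: "x \<in> Q"
    obtain g' where g': "g' \<in> level_gens n k" "T * (gen g * x) - gen g' * (T * x) \<in> klr_ideal n"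
      using comm[OF g] x by (auto simp: Q_def)
    have "T * x \<in> K" using x by (simp add: Q_def)
    from fa.subspace_add[OF sub _ cl[OF g'(1) this]] g'(2) I
    have "T * (gen g * x) \<in> K" by fastforce
    then show "gen g * x \<in> Q"
      using x level_gens_closed[OF n(2) g] free_algebra_mult_closed by (auto simp: Q_def)
  qed
  moreover have "X \<subseteq> Q" using X by (auto simp: Q_def)
  ultimately have "orbit n k X \<subseteq> Q" by (rule orbit_subset)
  with x show ?thesis by (auto simp: Q_def)
qed

lemma swap_in_res_seqs:
  assumes "i \<in> res_seqs n" "r \<in> {1..<n}"
  shows "swap r i \<in> res_seqs n"
proof -
  have len: "length i = n" and i: "set i \<subseteq> {0, 1}" using assms(1) by (auto simp: res_seqs_def)
  have "entry i (r + 1) \<in> set i" "entry i r \<in> set i"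
    using len assms(2) by (auto intro!: nth_mem)
  then have "set (swap r i) \<subseteq> {0, 1}"
    unfolding swap_def by (intro set_update_subsetI i) (use i in blast)+
  then show ?thesis
    using len by (simp add: res_seqs_def swap_def)
qed

lemma subspace_mult_sum:
  fixes p :: "'x free_monoid \<Rightarrow>\<^sub>0 'f::field"
  assumes "fa.subspace S" "\<And>i. i \<in> A \<Longrightarrow> p * f i \<in> S"
  shows "p * sum f A \<in> S"
  using assms(2)
  by (induction A rule: infinite_finite_induct)
    (simp_all add: fa.subspace_0[OF assms(1)] fa.subspace_add[OF assms(1)] distrib_left)

text \<open>Modulo \<open>I\<close>, \<open>psi e = psi psi y e = psi psi e y = 0\<close>, by the
  third, second and first congruence in turn.\<close>

lemma psi_sq_y_e_in_ideal:
  fixes psi y e :: "'x free_monoid \<Rightarrow>\<^sub>0 'f::field"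
  assumes sub: "fa.subspace I" and 1: "psi * psi * e * y \<in> I"
    and 2: "psi * psi * (y * e - e * y) \<in> I" and 3: "psi * (psi * y * e - e) \<in> I"
  shows "psi * e \<in> I"
proof -
  have "psi * psi * e * y + psi * psi * (y * e - e * y) - psi * (psi * y * e - e) = psi * e"
    by (simp add: right_diff_distrib mult.assoc)
  then show ?thesis
    using fa.subspace_diff[OF sub fa.subspace_add[OF sub 1 2] 3] by simp
qed

text \<open>Since \<open>\<psi>\<^sub>1\<close> vanishes in the quotient, the last relation of the Specht module is automatic.\<close>

lemma psi_one_in_ideal:
  assumes n: "n > 1"
  shows "psigen 1 \<in> (klr_ideal n :: 'f::field klr_free set)"
proof -
  let ?I = "klr_ideal n :: 'f klr_free set"
  have n0: "n > 0" using n by simp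
  note sub = subspace_klr_ideal[OF n0, where ?'a = 'f]
  note rel = klr_rel_in_ideal[OF n0, where ?'a = 'f]
  note Im = klr_ideal_mult[OF n0, where ?'a = 'f]
  have psi: "psigen 1 \<in> (klr_carrier n :: 'f klr_free set)" and y: "ygen 2 \<in> (klr_carrier n :: 'f klr_free set)"
    using n by (simp_all add: psigen_closed ygen_closed)
  have e: "egen i \<in> (klr_carrier n :: 'f klr_free set)" if "i \<in> res_seqs n" for i
    using that by (rule egen_closed)
  note m = free_algebra_mult_closed
  have y1: "ygen 1 \<in> ?I" using rel[OF klr_rel.y_one] by simp
  have "psigen 1 * egen i \<in> ?I" if i: "i \<in> res_seqs n" for i
  proof -
    have len: "length i = n" "set i \<subseteq> {0, 1}" using i by (auto simp: res_seqs_def)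
    have "i ! 0 \<in> set i" "i ! 1 \<in> set i" using len(1) n by auto
    then have i01: "i ! 0 \<in> {0, 1}" "i ! 1 \<in> {0, 1}" using len(2) by blast+
    consider "i ! 0 = 1" | "i ! 0 = 0" "i ! 1 = 1" | "i ! 0 = 0" "i ! 1 = 0" using i01 by auto
    then show ?thesis
    proof cases
      case 1
      then have "egen i \<in> ?I" using rel[OF klr_rel.e_first[OF i]] by simp
      then show ?thesis by (rule Im(1)[OF _ psi])
    next
      case 2
      have sw: "swap 1 i \<in> res_seqs n"
        by (rule swap_in_res_seqs[OF i]) (use n in simp)
      \<comment> \<open>Moving \<open>psi_1\<close> past the idempotent produces a sequence that
        starts with 1, whose idempotent vanishes.\<close>
      have "swap 1 i ! 0 = 1" using len n 2 by (simp add: swap_def)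
      then have "egen (swap 1 i) \<in> ?I" using rel[OF klr_rel.e_first[OF sw]] by simp
      then have "egen (swap 1 i) * psigen 1 \<in> ?I" by (rule Im(2)[OF _ psi])
      moreover have "psigen 1 * egen i - egen (swap 1 i) * psigen 1 \<in> ?I"
        using n by (intro rel klr_rel.psi_e i) simp
      ultimately have "psigen 1 * egen i - egen (swap 1 i) * psigen 1 + egen (swap 1 i) * psigen 1 \<in> ?I"
        by (rule fa.subspace_add[OF sub, rotated])
      then show ?thesis by (simp only: diff_add_cancel)
    next
      case 3
      note pc = psi
      \<comment> \<open>As \<open>y_1\<close> vanishes, the relation for
        \<open>y_1 psi_1 e(i)\<close> with equal residues reads
        \<open>psi_1 y_2 e(i) = e(i)\<close>.\<close>
      have ye: "psigen 1 * ygen 2 * egen i - egen i \<in> ?I"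
      proof -
        have "ygen 1 * psigen 1 * egen i - (psigen 1 * ygen 2 - 1) * egen i \<in> ?I"
          using rel[OF klr_rel.y_psi_e[OF i, of 1]] 3 n by (simp add: numeral_2_eq_2)
        moreover have "ygen 1 * psigen 1 * egen i \<in> ?I"
          using Im(2)[OF Im(2)[OF y1 pc] e[OF i]] .
        ultimately have "ygen 1 * psigen 1 * egen i
            - (ygen 1 * psigen 1 * egen i - (psigen 1 * ygen 2 - 1) * egen i) \<in> ?I"
          by (rule fa.subspace_diff[OF sub, rotated])
        then have "(psigen 1 * ygen 2 - 1) * egen i \<in> ?I"
          by (simp only: diff_diff_eq2 add_diff_cancel_left')
        then show ?thesis by (simp only: left_diff_distrib mult_1_left)
      qed
      have "psigen 1 * psigen 1 * egen i \<in> ?I"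
        using rel[OF klr_rel.psi_sq_eq[OF i, of 1]] 3 n by (simp add: power2_eq_square)
      then have "psigen 1 * psigen 1 * egen i * ygen 2 \<in> ?I"
        by (rule Im(2)[OF _ y])
      moreover have "psigen 1 * psigen 1 * (ygen 2 * egen i - egen i * ygen 2) \<in> ?I"
        by (rule Im(1)[OF rel[OF klr_rel.y_e[OF i]] m[OF pc pc]]) (use n in simp)
      ultimately show ?thesis
        using Im(1)[OF ye pc] by (rule psi_sq_y_e_in_ideal[OF sub])
    qed
  qed
  then have "psigen 1 * sum egen (res_seqs n) \<in> ?I"
    by (rule subspace_mult_sum[OF sub])
  moreover have "psigen 1 * (sum egen (res_seqs n) - 1) \<in> ?I"
    by (rule Im(1)[OF rel[OF klr_rel.e_sum] psi])
  ultimately have "psigen 1 * sum egen (res_seqs n) - psigen 1 * (sum egen (res_seqs n) - 1) \<in> ?I"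
    by (rule fa.subspace_diff[OF sub])
  then show ?thesis
    by (simp only: right_diff_distrib mult_1_right diff_diff_eq2 add_diff_cancel_left')
qed

section \<open>Relations applied to weight vectors\<close>

locale klr_level =
  fixes n k :: nat and K :: "'f::field klr_free set"
  assumes n: "n > 0" and k_le: "k \<le> n" and stab: "stable n k K"
begin

lemma sub: "fa.subspace K" and ideal_K: "klr_ideal n \<subseteq> K" and K_carrier: "K \<subseteq> klr_carrier n"
  using stab by (simp_all add: stable_def)

lemma add_K: "x \<in> K \<Longrightarrow> y \<in> K \<Longrightarrow> x + y \<in> K"
  and diff_K: "x \<in> K \<Longrightarrow> y \<in> K \<Longrightarrow> x - y \<in> K"
  and uminus_K: "x \<in> K \<Longrightarrow> - x \<in> K"
  and zero_K: "0 \<in> K"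
  using fa.subspace_add[OF sub] fa.subspace_diff[OF sub] fa.subspace_neg[OF sub] fa.subspace_0[OF sub] by auto

lemma diff_diff_K:
  assumes "u - v - w \<in> K" "u \<in> K" "w \<in> K"
  shows "v \<in> K"
  using diff_K[OF diff_K[OF assms(2,3)] assms(1)] by simp

lemma cong_K: "x - y \<in> K \<Longrightarrow> x \<in> K \<longleftrightarrow> y \<in> K"
  using add_K[of "x - y" y] diff_K[of x "x - y"] by auto

lemma cong_ideal: "x - y \<in> klr_ideal n \<Longrightarrow> x \<in> K \<longleftrightarrow> y \<in> K"
  using cong_K ideal_K by blast

lemma gen_K: "g \<in> level_gens n k \<Longrightarrow> x \<in> K \<Longrightarrow> gen g * x \<in> K"
  using stab by (simp add: stable_def)

lemma psi_K: "1 \<le> j \<Longrightarrow> j < k \<Longrightarrow> x \<in> K \<Longrightarrow> psigen j * x \<in> K"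
  and y_K: "1 \<le> j \<Longrightarrow> j \<le> k \<Longrightarrow> x \<in> K \<Longrightarrow> ygen j * x \<in> K"
  and e_K: "i \<in> res_seqs n \<Longrightarrow> x \<in> K \<Longrightarrow> egen i * x \<in> K"
  by (rule gen_K; simp add: level_gens_def)+

lemma psi_psi_iff:
  assumes "x \<in> klr_carrier n" "r \<in> {1..<n}" "s \<in> {1..<n}" "s \<noteq> r + 1" "r \<noteq> s + 1"
  shows "psigen s * (psigen r * x) \<in> K \<longleftrightarrow> psigen r * (psigen s * x) \<in> K"
  using klr_rel_mult[OF n klr_rel.psi_psi[OF assms(2-5)] assms(1)]
  by (intro cong_ideal) (simp add: mult.assoc)

lemma y_psi_iff:
  assumes "x \<in> klr_carrier n" "r \<in> {1..<n}" "s \<in> {1..n}" "s \<noteq> r" "s \<noteq> r + 1"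
  shows "ygen s * (psigen r * x) \<in> K \<longleftrightarrow> psigen r * (ygen s * x) \<in> K"
  using klr_rel_mult[OF n klr_rel.y_psi[OF assms(2-5)] assms(1)]
  by (intro cong_ideal) (simp add: mult.assoc)

text \<open>Weight vectors modulo \<open>K\<close>. The relations carry an idempotent on the right,
  and \<open>weighted_rel\<close> strips it off when they are applied to such an element.\<close>

definition weighted :: "'f klr_free \<Rightarrow> bool" where
  "weighted x \<longleftrightarrow> x \<in> klr_carrier n \<and> (\<exists>i\<in>res_seqs n. egen i * x - x \<in> K)"

lemma weighted_carrier: "weighted x \<Longrightarrow> x \<in> klr_carrier n"
  by (simp add: weighted_def)

lemma weighted_rel:
  assumes rel: "klr_rel n (l * egen i) (r * egen i)" and x: "x \<in> klr_carrier n" "egen i * x - x \<in> K"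
    and l: "\<And>u. u \<in> K \<Longrightarrow> l * u \<in> K" and r: "\<And>u. u \<in> K \<Longrightarrow> r * u \<in> K"
  shows "l * x - r * x \<in> K"
proof -
  have "l * egen i * x - r * egen i * x \<in> K"
    using klr_rel_mult[OF n rel x(1)] ideal_K by blast
  from add_K[OF diff_K[OF this l[OF x(2)]] r[OF x(2)]] show ?thesis
    by (simp add: right_diff_distrib mult.assoc)
qed

lemma weighted_psi:
  assumes "weighted x" "1 \<le> r" "r < k"
  shows "weighted (psigen r * x)"
proof -
  obtain i where i: "i \<in> res_seqs n" "egen i * x - x \<in> K" and x: "x \<in> klr_carrier n"
    using assms(1) by (auto simp: weighted_def)
  have r: "r \<in> {1..<n}" using assms k_le by simp
  have "psigen r * egen i * x - egen (swap r i) * psigen r * x \<in> K"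
    using klr_rel_mult[OF n klr_rel.psi_e[OF i(1) r] x] ideal_K by blast
  from diff_K[OF psi_K[OF assms(2,3) i(2)] this]
  have "egen (swap r i) * (psigen r * x) - psigen r * x \<in> K"
    by (simp add: right_diff_distrib mult.assoc)
  then show ?thesis
    using swap_in_res_seqs[OF i(1) r] free_algebra_mult_closed[OF psigen_closed[OF r] x]
    by (auto simp: weighted_def)
qed

text \<open>Only the range of the correction coefficient \<open>c\<close> is recorded. The recursion
  treats both values alike, so it is independent of the residues; the same holds for the next three
  lemmas.\<close>

lemma y_psi_weighted:
  assumes "weighted x" "1 \<le> r" "r < k"
  obtains c where "c = 0 \<or> c = 1" "ygen r * (psigen r * x) - psigen r * (ygen (r + 1) * x) + c * x \<in> K"
proof -
  obtain i where i: "i \<in> res_seqs n" "egen i * x - x \<in> K" and x: "x \<in> klr_carrier n"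
    using assms(1) by (auto simp: weighted_def)
  have r: "r \<in> {1..<n}" using assms k_le by simp
  define c :: "'f klr_free" where "c = (if entry i r = entry i (r + 1) then 1 else 0)"
  have c: "c = 0 \<or> c = 1" by (simp add: c_def)
  have cK: "c * u \<in> K" if "u \<in> K" for u
    using c that zero_K by auto
  have "ygen r * psigen r * x - (psigen r * ygen (r + 1) - c) * x \<in> K"
  proof (rule weighted_rel[OF _ x i(2)])
    show "klr_rel n (ygen r * psigen r * egen i) ((psigen r * ygen (r + 1) - c) * egen i)"
      unfolding c_def by (rule klr_rel.y_psi_e[OF i(1) r])
    show "ygen r * psigen r * u \<in> K" if "u \<in> K" for u
      using that assms by (simp add: mult.assoc y_K psi_K)
    show "(psigen r * ygen (r + 1) - c) * u \<in> K" if "u \<in> K" for u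
      using that assms cK by (simp add: left_diff_distrib mult.assoc diff_K y_K psi_K)
  qed
  then have "ygen r * (psigen r * x) - psigen r * (ygen (r + 1) * x) + c * x \<in> K"
    by (simp only: left_diff_distrib mult.assoc diff_diff_eq2) (simp only: algebra_simps)
  with c that show thesis by blast
qed

lemma y_Suc_psi_weighted:
  assumes "weighted x" "1 \<le> r" "r < k"
  obtains c where "c = 0 \<or> c = 1" "ygen (r + 1) * (psigen r * x) - psigen r * (ygen r * x) - c * x \<in> K"
proof -
  obtain i where i: "i \<in> res_seqs n" "egen i * x - x \<in> K" and x: "x \<in> klr_carrier n"
    using assms(1) by (auto simp: weighted_def)
  have r: "r \<in> {1..<n}" using assms k_le by simp
  define c :: "'f klr_free" where "c = (if entry i r = entry i (r + 1) then 1 else 0)"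
  have c: "c = 0 \<or> c = 1" by (simp add: c_def)
  have cK: "c * u \<in> K" if "u \<in> K" for u
    using c that zero_K by auto
  have "ygen (r + 1) * psigen r * x - (psigen r * ygen r + c) * x \<in> K"
  proof (rule weighted_rel[OF _ x i(2)])
    show "klr_rel n (ygen (r + 1) * psigen r * egen i) ((psigen r * ygen r + c) * egen i)"
      unfolding c_def by (rule klr_rel.y_Suc_psi_e[OF i(1) r])
    show "ygen (r + 1) * psigen r * u \<in> K" if "u \<in> K" for u
      using that assms by (simp add: mult.assoc y_K psi_K)
    show "(psigen r * ygen r + c) * u \<in> K" if "u \<in> K" for u
      using that assms cK by (simp add: distrib_right mult.assoc add_K y_K psi_K)
  qed
  then have "ygen (r + 1) * (psigen r * x) - psigen r * (ygen r * x) - c * x \<in> K"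
    by (simp only: distrib_right mult.assoc diff_diff_eq)
  with c that show thesis by blast
qed

lemma psi_sq_weighted:
  assumes "weighted x" "1 \<le> r" "r < k"
  obtains c where "c = 0 \<or> c = 1" "psigen r * (psigen r * x)
    + c * (ygen r * (ygen r * x - ygen (r + 1) * x) - ygen (r + 1) * (ygen r * x - ygen (r + 1) * x)) \<in> K"
proof -
  obtain i where i: "i \<in> res_seqs n" "egen i * x - x \<in> K" and x: "x \<in> klr_carrier n"
    using assms(1) by (auto simp: weighted_def)
  have r: "r \<in> {1..<n}" using assms k_le by simp
  have pp: "psigen r ^ 2 * u \<in> K" if "u \<in> K" for u
    using that assms by (simp add: power2_eq_square mult.assoc psi_K)
  show thesis
  proof (cases "entry i r = entry i (r + 1)")
    case True
    have "psigen r ^ 2 * x - 0 * x \<in> K"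
      by (rule weighted_rel[OF _ x i(2)]) (use klr_rel.psi_sq_eq[OF i(1) r True] pp zero_K in auto)
    then show thesis using that[of 0] by (simp add: power2_eq_square mult.assoc)
  next
    case False
    have "psigen r ^ 2 * x - (- ((ygen r - ygen (r + 1)) ^ 2)) * x \<in> K"
    proof (rule weighted_rel[OF _ x i(2) pp])
      show "klr_rel n (psigen r ^ 2 * egen i) (- ((ygen r - ygen (r + 1)) ^ 2) * egen i)"
        by (rule klr_rel.psi_sq_neq[OF i(1) r False])
      fix u assume u: "u \<in> K"
      have "(ygen r - ygen (r + 1)) * v \<in> K" if "v \<in> K" for v
        using that assms by (simp add: left_diff_distrib diff_K y_K)
      then have "(ygen r - ygen (r + 1)) * ((ygen r - ygen (r + 1)) * u) \<in> K"
        using u by blast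
      then show "- ((ygen r - ygen (r + 1)) ^ 2) * u \<in> K"
        using uminus_K by (simp add: power2_eq_square mult.assoc)
    qed
    then have "psigen r * (psigen r * x) + 1 * ((ygen r - ygen (r + 1)) * ((ygen r - ygen (r + 1)) * x)) \<in> K"
      by (simp add: power2_eq_square mult.assoc)
    then show thesis using that[of 1] by (simp only: left_diff_distrib) simp
  qed
qed

lemma braid_weighted:
  assumes "weighted x" "1 \<le> r" "r + 1 < k"
  obtains c where "c = 0 \<or> c = 1" "psigen r * (psigen (r + 1) * (psigen r * x))
    - psigen (r + 1) * (psigen r * (psigen (r + 1) * x))
    - c * (ygen r * x - ygen (r + 1) * x - ygen (r + 1) * x + ygen (r + 2) * x) \<in> K"
proof -
  obtain i where i: "i \<in> res_seqs n" "egen i * x - x \<in> K" and x: "x \<in> klr_carrier n"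
    using assms(1) by (auto simp: weighted_def)
  have r: "r + 1 < n" using assms k_le by simp
  have p: "psigen r * psigen (r + 1) * psigen r * u \<in> K" "psigen (r + 1) * psigen r * psigen (r + 1) * u \<in> K" if "u \<in> K" for u
    using that assms by (simp_all add: mult.assoc psi_K)
  show thesis
  proof (cases "entry i r = entry i (r + 1) \<or> entry i (r + 1) = entry i (r + 2)")
    case True
    have "psigen r * psigen (r + 1) * psigen r * x - psigen (r + 1) * psigen r * psigen (r + 1) * x \<in> K"
      by (rule weighted_rel[OF klr_rel.braid[OF i(1) assms(2) r True] x i(2) p])
    then show thesis using that[of 0] by (simp add: mult.assoc)
  next
    case False
    have "psigen r * psigen (r + 1) * psigen r * x - (psigen (r + 1) * psigen r * psigen (r + 1)
        + ygen r - 2 * ygen (r + 1) + ygen (r + 2)) * x \<in> K"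
    proof (rule weighted_rel[OF _ x i(2) p(1)])
      show "klr_rel n (psigen r * psigen (r + 1) * psigen r * egen i)
        ((psigen (r + 1) * psigen r * psigen (r + 1) + ygen r - 2 * ygen (r + 1) + ygen (r + 2)) * egen i)"
        using False by (intro klr_rel.braid_neq[OF i(1) assms(2) r]) auto
      fix u assume u: "u \<in> K"
      have "psigen (r + 1) * psigen r * psigen (r + 1) * u + ygen r * u - ygen (r + 1) * u - ygen (r + 1) * u + ygen (r + 2) * u \<in> K"
        using u assms by (intro add_K diff_K p y_K) auto
      then show "(psigen (r + 1) * psigen r * psigen (r + 1) + ygen r - 2 * ygen (r + 1) + ygen (r + 2)) * u \<in> K"
        by (simp add: distrib_right left_diff_distrib mult_2 diff_diff_eq)
    qed
    then show thesis using that[of 1]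
      by (simp add: distrib_right left_diff_distrib mult_2 mult.assoc diff_diff_eq) (simp add: algebra_simps)
  qed
qed

end

section \<open>Strings of crossings on a Specht vector\<close>

primrec slide :: "nat \<Rightarrow> 'f::field klr_free \<Rightarrow> nat \<Rightarrow> 'f klr_free" where
  "slide b z 0 = z"
| "slide b z (Suc m) = psigen (b + 1 + m) * slide b z m"

lemma slide_stable:
  assumes "stable n l M" "w \<in> M" "b + m < l"
  shows "slide b w m \<in> M"
  using assms(3)
proof (induction m)
  case 0
  then show ?case using assms by simp
next
  case (Suc m)
  then have "Psi (b + 1 + m) \<in> level_gens n l" by (simp add: level_gens_def)
  then show ?case using Suc assms(1) by (auto simp: stable_def)
qed

lemma (in klr_level) weighted_slide: "weighted w \<Longrightarrow> b + m < k \<Longrightarrow> weighted (slide b w m)"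
  by (induction m) (auto intro: weighted_psi)

text \<open>The relations of the generator of a hook Specht module with leg length \<open>b\<close>,
  for the first \<open>k\<close> strands and modulo \<open>K\<close>. The recursion lets
  \<open>k\<close>, \<open>K\<close> and \<open>b\<close> vary.\<close>

locale specht_vector = klr_level +
  fixes b :: nat and z :: "'a klr_free"
  assumes z_weighted: "weighted z"
    and z_y: "\<And>j. 1 \<le> j \<Longrightarrow> j \<le> k \<Longrightarrow> ygen j * z \<in> K"
    and z_psi: "\<And>j. 1 \<le> j \<Longrightarrow> j < k \<Longrightarrow> j \<noteq> b + 1 \<Longrightarrow> psigen j * z \<in> K"
begin

lemma z_carrier: "z \<in> klr_carrier n"
  using z_weighted by (rule weighted_carrier)

lemma slide_weighted: "b + m < k \<Longrightarrow> weighted (slide b z m)"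
  by (rule weighted_slide[OF z_weighted])

lemma slide_carrier: "b + m < k \<Longrightarrow> slide b z m \<in> klr_carrier n"
  by (intro weighted_carrier slide_weighted)

lemma psi_slide_above: "b + m < k \<Longrightarrow> b + 1 + m < l \<Longrightarrow> l < k \<Longrightarrow> psigen l * slide b z m \<in> K"
proof (induction m)
  case 0
  then show ?case by (simp add: z_psi)
next
  case (Suc m)
  have "psigen (b + 1 + m) * (psigen l * slide b z m) \<in> K"
    by (rule psi_K) (use Suc in auto)
  then show ?case
    using psi_psi_iff[of "slide b z m" "b + 1 + m" l] Suc.prems k_le slide_carrier[of m] by auto
qed

lemma y_slide_above: "b + m < k \<Longrightarrow> b + 1 + m < l \<Longrightarrow> l \<le> k \<Longrightarrow> ygen l * slide b z m \<in> K"
proof (induction m)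
  case 0
  then show ?case by (simp add: z_y)
next
  case (Suc m)
  have "psigen (b + 1 + m) * (ygen l * slide b z m) \<in> K"
    using Suc by (intro psi_K) auto
  then show ?case
    using y_psi_iff[of "slide b z m" "b + 1 + m" l] Suc.prems k_le slide_carrier[of m] by auto
qed

lemma y_slide_Suc:
  assumes "b + 1 + m < k"
  obtains c where "c = 0 \<or> c = 1" "ygen (b + 1 + m) * slide b z (Suc m) + c * slide b z m \<in> K"
proof -
  have w: "weighted (slide b z m)" by (rule slide_weighted) (use assms in simp)
  obtain c where c: "c = 0 \<or> c = 1" "ygen (b + 1 + m) * (psigen (b + 1 + m) * slide b z m)
      - psigen (b + 1 + m) * (ygen (b + 1 + m + 1) * slide b z m) + c * slide b z m \<in> K"
    by (rule y_psi_weighted[OF w, of "b + 1 + m"]) (use assms in auto)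
  have "psigen (b + 1 + m) * (ygen (b + 1 + m + 1) * slide b z m) \<in> K"
    using assms by (intro psi_K y_slide_above) auto
  from add_K[OF c(2) this] that[OF c(1)] show thesis by (simp add: algebra_simps)
qed

text \<open>The new crossing commutes with \<open>ygen j\<close>. In the borderline case
  \<open>j = b + m\<close> the relation \<open>y_slide_Suc\<close> leaves a multiple of a shorter
  string, and the new crossing is far enough above that string to kill it.\<close>

lemma y_slide_below: "b + m < k \<Longrightarrow> 1 \<le> j \<Longrightarrow> j < b + m \<Longrightarrow> ygen j * slide b z m \<in> K"
proof (induction m)
  case 0
  then show ?case by (simp add: z_y)
next
  case (Suc m)
  have "psigen (b + 1 + m) * (ygen j * slide b z m) \<in> K"
  proof (cases "j < b + m \<or> m = 0")
    case True
    then show ?thesis using Suc by (intro psi_K) (auto simp: z_y)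
  next
    case False
    then obtain m' where m': "m = Suc m'" "j = b + 1 + m'"
      using Suc.prems by (cases m) auto
    obtain c where c: "c = 0 \<or> c = 1" "ygen (b + 1 + m') * slide b z (Suc m') + c * slide b z m' \<in> K"
      by (rule y_slide_Suc[of m']) (use Suc.prems m' in auto)
    have "psigen (b + 1 + m) * (ygen j * slide b z m + c * slide b z m') \<in> K"
      using c(2) Suc.prems m' by (intro psi_K) auto
    moreover have "psigen (b + 1 + m) * (c * slide b z m') \<in> K"
      using c(1) psi_slide_above[of m' "b + 1 + m"] Suc.prems m' zero_K by auto
    ultimately show ?thesis
      using diff_K by (fastforce simp: distrib_left)
  qed
  then show ?case
    using y_psi_iff[of "slide b z m" "b + 1 + m" j] Suc.prems k_le slide_carrier[of m] by auto
qed

text \<open>A braid relation applied to \<open>slide b z m\<close>. The crossing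
  \<open>psigen (b + 2 + m)\<close> kills this string, and so do all \<open>y\<close> with index
  above \<open>b + 1 + m\<close>; only the first term of the correction survives.\<close>

lemma psi_slide_Suc_Suc:
  assumes "b + 2 + m < k"
  obtains c where "c = 0 \<or> c = 1" "psigen (b + 1 + m) * slide b z (Suc (Suc m)) - c * (ygen (b + 1 + m) * slide b z m) \<in> K"
proof -
  let ?x = "slide b z m" and ?r = "b + 1 + m"
  have w: "weighted ?x" by (rule slide_weighted) (use assms in simp)
  obtain c where c: "c = 0 \<or> c = 1" "psigen ?r * (psigen (?r + 1) * (psigen ?r * ?x))
    - psigen (?r + 1) * (psigen ?r * (psigen (?r + 1) * ?x))
    - c * (ygen ?r * ?x - ygen (?r + 1) * ?x - ygen (?r + 1) * ?x + ygen (?r + 2) * ?x) \<in> K"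
    by (rule braid_weighted[OF w, of ?r]) (use assms in auto)
  have 1: "psigen (?r + 1) * (psigen ?r * (psigen (?r + 1) * ?x)) \<in> K"
    using assms by (intro psi_K psi_slide_above) auto
  have "- ygen (?r + 1) * ?x - ygen (?r + 1) * ?x + ygen (?r + 2) * ?x \<in> K"
    unfolding mult_minus_left using assms by (intro add_K diff_K uminus_K y_slide_above) auto
  then have 2: "c * (- ygen (?r + 1) * ?x - ygen (?r + 1) * ?x + ygen (?r + 2) * ?x) \<in> K"
    using c(1) zero_K by auto
  from add_K[OF add_K[OF c(2) 1] 2]
  have "psigen ?r * (psigen (?r + 1) * (psigen ?r * ?x)) - c * (ygen ?r * ?x) \<in> K"
    using c(1) by (auto simp: algebra_simps)
  with c(1) that show thesis by simp
qed

text \<open>As for \<open>y_slide_below\<close>: in the borderline case the braid relation leaves a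
  multiple of \<open>y\<close> times a string shorter by two, which the next crossing kills. The
  value \<open>j = b\<close> has to be exempted, and this becomes the free crossing of the Specht
  vector with leg length \<open>b - 1\<close>.\<close>

lemma psi_slide_below:
  "b + m < k \<Longrightarrow> 1 \<le> j \<Longrightarrow> j \<noteq> b \<Longrightarrow> j + 1 < b + m \<Longrightarrow> psigen j * slide b z m \<in> K"
proof (induction m)
  case 0
  then show ?case by (simp add: z_psi)
next
  case (Suc m)
  have "psigen (b + 1 + m) * (psigen j * slide b z m) \<in> K"
  proof (cases "j + 1 < b + m \<or> m = 0")
    case True
    then show ?thesis by (intro psi_K[of "b + 1 + m"]) (use Suc in \<open>auto simp: z_psi\<close>)
  next
    case False
    then have "m \<ge> 2" "j = b + m - 1" using Suc.prems by auto
    then obtain m' where m': "m = Suc (Suc m')" "j = b + 1 + m'"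
      using that[of "m - 2"] by auto
    obtain c where c: "c = 0 \<or> c = 1" "psigen (b + 1 + m') * slide b z (Suc (Suc m')) - c * (ygen (b + 1 + m') * slide b z m') \<in> K"
      by (rule psi_slide_Suc_Suc[of m']) (use Suc.prems m' in auto)
    have "psigen (b + 1 + m) * (psigen j * slide b z m - c * (ygen j * slide b z m')) \<in> K"
      using c(2) Suc.prems m' by (intro psi_K) auto
    moreover have "psigen (b + 1 + m) * (ygen j * slide b z m') \<in> K"
    proof -
      have "ygen j * (psigen (b + 1 + m) * slide b z m') \<in> K"
        using Suc.prems m' by (intro y_K psi_slide_above) auto
      then show ?thesis
        using y_psi_iff[of "slide b z m'" "b + 1 + m" j] Suc.prems m' k_le slide_carrier[of m'] by auto
    qed
    ultimately show ?thesis
      using c(1) add_K by (fastforce simp: right_diff_distrib)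
  qed
  then show ?case
    using psi_psi_iff[of "slide b z m" "b + 1 + m" j] Suc.prems k_le slide_carrier[of m] by auto
qed

lemma line_stable:
  assumes "b = 0 \<or> k = b + 1" "n > 1"
  defines "L \<equiv> {x. \<exists>c. x - Poly_Mapping.single 0 c * z \<in> K}"
  shows "stable n k L"
  unfolding stable_def
proof (intro conjI ballI)
  note S = fa.subspace_scale[OF sub]
  show "fa.subspace L"
  proof (rule fa.subspaceI)
    have "0 - Poly_Mapping.single 0 0 * z \<in> K" using zero_K by simp
    then show "0 \<in> L" unfolding L_def by blast
    show "x + y \<in> L" if xy: "x \<in> L" "y \<in> L" for x y
    proof -
      obtain c d where "x - Poly_Mapping.single 0 c * z \<in> K" "y - Poly_Mapping.single 0 d * z \<in> K"
        using xy by (auto simp: L_def)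
      from add_K[OF this] have "x + y - Poly_Mapping.single 0 (c + d) * z \<in> K"
        by (simp add: single_add distrib_right algebra_simps)
      then show ?thesis by (auto simp: L_def)
    qed
    show "Poly_Mapping.single 0 c * x \<in> L" if x: "x \<in> L" for c x
    proof -
      obtain d where "x - Poly_Mapping.single 0 d * z \<in> K" using x by (auto simp: L_def)
      from S[OF this, of c] have "Poly_Mapping.single 0 c * x - Poly_Mapping.single 0 (c * d) * z \<in> K"
        by (simp add: right_diff_distrib mult.assoc[symmetric] mult_single)
      then show ?thesis by (auto simp: L_def)
    qed
  qed
  have K_L: "x \<in> L" if "x \<in> K" for x
    using that by (auto simp: L_def intro!: exI[of _ 0])
  then show "klr_ideal n \<subseteq> L" using ideal_K by blast
  show "L \<subseteq> klr_carrier n"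
  proof
    fix x assume "x \<in> L"
    then obtain c where c: "x - Poly_Mapping.single 0 c * z \<in> K" by (auto simp: L_def)
    have "x - Poly_Mapping.single 0 c * z + Poly_Mapping.single 0 c * z \<in> klr_carrier n"
      using c K_carrier z_carrier
      by (intro free_algebra_add_closed free_algebra_mult_closed scalar_closed) auto
    then show "x \<in> klr_carrier n" by simp
  qed
  fix g x assume g: "g \<in> level_gens n k" and "x \<in> L"
  then obtain c where c: "x - Poly_Mapping.single 0 c * z \<in> K" by (auto simp: L_def)
  have gz: "\<exists>d. gen g * z - Poly_Mapping.single 0 d * z \<in> K"
  proof -
    have psi: "psigen j * z \<in> K" if "1 \<le> j" "j < k" for j
    proof (cases "j = b + 1")
      case True
      then have "j = 1" using assms(1) that by auto
      then show ?thesis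
        using klr_ideal_mult(2)[OF n psi_one_in_ideal[OF \<open>n > 1\<close>] z_carrier] ideal_K by auto
    qed (use z_psi that in blast)
    consider j where "g = Y j" "1 \<le> j" "j \<le> k" | j where "g = Psi j" "1 \<le> j" "j < k"
      | i where "g = E i" "i \<in> res_seqs n"
      using g by (auto simp: level_gens_def)
    then show ?thesis
    proof cases
      case 1
      then show ?thesis using z_y by (intro exI[of _ 0]) simp
    next
      case 2
      then show ?thesis using psi by (intro exI[of _ 0]) simp
    next
      case (3 i)
      obtain i' where i': "i' \<in> res_seqs n" "egen i' * z - z \<in> K"
        using z_weighted by (auto simp: weighted_def)
      have "egen i * egen i' * z - (if i = i' then egen i else 0) * z \<in> K"
        using klr_rel_mult[OF n klr_rel.e_e[OF 3(2) i'(1)] z_carrier] ideal_K by blast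
      from diff_K[OF this e_K[OF 3(2) i'(2)]]
      have *: "egen i * z - (if i = i' then egen i else 0) * z \<in> K"
        by (simp add: right_diff_distrib mult.assoc)
      show ?thesis
      proof (cases "i = i'")
        case True
        then show ?thesis using i' 3 by (intro exI[of _ 1]) simp
      next
        case False
        then show ?thesis using * 3 by (intro exI[of _ 0]) simp
      qed
    qed
  qed
  then obtain d where d: "gen g * z - Poly_Mapping.single 0 d * z \<in> K" by blast
  have "gen g * (x - Poly_Mapping.single 0 c * z) + Poly_Mapping.single 0 c * (gen g * z - Poly_Mapping.single 0 d * z) \<in> K"
    by (intro add_K gen_K g c S d)
  moreover have "gen g * (Poly_Mapping.single 0 c * z) = Poly_Mapping.single 0 c * (gen g * z)"
    by (simp add: mult.assoc[symmetric] scalar_central)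
  ultimately have "gen g * x - Poly_Mapping.single 0 (c * d) * z \<in> K"
    by (simp add: right_diff_distrib mult.assoc[symmetric] mult_single)
  then show "gen g * x \<in> L" by (auto simp: L_def)
qed

lemma orbit_line:
  assumes "b = 0 \<or> k = b + 1" "n > 1" "x \<in> orbit n k (insert z K)"
  obtains c where "x - Poly_Mapping.single 0 c * z \<in> K"
proof -
  have "orbit n k (insert z K) \<subseteq> {x. \<exists>c. x - Poly_Mapping.single 0 c * z \<in> K}"
    using zero_K
    by (intro orbit_subset line_stable assms insert_subsetI subsetI)
      (auto intro: exI[of _ 1] exI[of _ 0])
  then show thesis using assms(3) that by blast
qed

text \<open>The full string satisfies most relations already modulo \<open>K\<close>. The exceptions
  are \<open>y\<close> with index \<open>k - 1\<close> and, if it differs from the exempted index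
  \<open>b\<close>, the crossing with index \<open>k - 2\<close>: they yield shorter strings,
  possibly multiplied by a \<open>y\<close>, and these lie in \<open>K1\<close>.\<close>

lemma specht_vector_orbit:
  assumes "b \<ge> 1" "b + 2 \<le> k"
  defines "K1 \<equiv> orbit n (k - 1) (insert z K)" and "\<zeta> \<equiv> slide b z (k - b - 1)"
  shows "specht_vector n (k - 1) K1 (b - 1) \<zeta>"
proof -
  obtain m where k: "k = b + 2 + m" using assms(2) le_Suc_ex by blast
  have \<zeta>: "\<zeta> = slide b z (Suc m)" by (simp add: \<zeta>_def k)
  have X: "insert z K \<subseteq> klr_carrier n" using z_carrier K_carrier by blast
  have K1: "stable n (k - 1) K1"
    unfolding K1_def by (rule stable_orbit[OF n _ X]) (use k_le in simp)
  have K_K1: "K \<subseteq> K1" and z_K1: "z \<in> K1" unfolding K1_def using subset_orbit[of "insert z K"] by auto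
  have slide_K1: "slide b z m' \<in> K1" if "m' \<le> m" for m'
    by (rule slide_stable[OF K1 z_K1]) (use that k in simp)
  interpret K1: klr_level n "k - 1" K1
    by unfold_locales (use n k_le K1 in auto)
  show ?thesis
  proof unfold_locales
    have "weighted \<zeta>" unfolding \<zeta> by (rule slide_weighted) (use k in simp)
    then show "K1.weighted \<zeta>"
      using K_K1 by (auto simp: weighted_def K1.weighted_def)
    fix j assume j: "1 \<le> j" "j \<le> k - 1"
    show "ygen j * \<zeta> \<in> K1"
    proof (cases "j = k - 1")
      case True
      obtain c where c: "c = 0 \<or> c = 1" "ygen (b + 1 + m) * slide b z (Suc m) + c * slide b z m \<in> K"
        by (rule y_slide_Suc[of m]) (use k in auto)
      have "ygen j * \<zeta> + c * slide b z m \<in> K1"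
        using c(2) True k K_K1 by (auto simp: \<zeta>)
      moreover have "c * slide b z m \<in> K1"
        using c(1) slide_K1[of m] K1.zero_K by auto
      ultimately show ?thesis
        using K1.diff_K by fastforce
    next
      case False
      then show ?thesis
        unfolding \<zeta> using j k K_K1 y_slide_below[of "Suc m" j] by auto
    qed
  next
    fix j assume j: "1 \<le> j" "j < k - 1" "j \<noteq> b - 1 + 1"
    show "psigen j * \<zeta> \<in> K1"
    proof (cases "j = k - 2")
      case True
      then obtain m' where m: "m = Suc m'" using j k assms(1) by (cases m) auto
      obtain c where c: "c = 0 \<or> c = 1" "psigen (b + 1 + m') * slide b z (Suc (Suc m')) - c * (ygen (b + 1 + m') * slide b z m') \<in> K"
        by (rule psi_slide_Suc_Suc[of m']) (use k m in auto)
      have "psigen j * \<zeta> - c * (ygen j * slide b z m') \<in> K1"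
        using c(2) True k m K_K1 by (auto simp: \<zeta>)
      moreover have "ygen j * slide b z m' \<in> K1"
        using j k m by (intro K1.y_K slide_K1) auto
      ultimately show ?thesis
        using c(1) K1.cong_K K1.zero_K by auto
    next
      case False
      then show ?thesis
        unfolding \<zeta> using j k assms(1) K_K1 psi_slide_below[of "Suc m" j] by auto
    qed
  qed
qed

end

section \<open>The recursion for the dimension\<close>

lemma psi_comm_level:
  assumes "n > 0" "r < n" "k < r" "k \<ge> 1" "g \<in> level_gens n k"
  shows "\<exists>g'\<in>level_gens n k. \<forall>x\<in>klr_carrier n. psigen r * (gen g * x) - gen g' * (psigen r * x) \<in> klr_ideal n"
proof -
  consider j where "g = Y j" "1 \<le> j" "j \<le> k" | j where "g = Psi j" "1 \<le> j" "j < k"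
    | i where "g = E i" "i \<in> res_seqs n"
    using assms(5) by (auto simp: level_gens_def)
  then show ?thesis
  proof cases
    case (1 j)
    have "psigen r * (gen g * x) - gen g * (psigen r * x) \<in> klr_ideal n" if x: "x \<in> klr_carrier n" for x
    proof -
      have "klr_rel n (ygen j * psigen r) (psigen r * ygen j)"
        by (rule klr_rel.y_psi) (use 1 assms in auto)
      from fa.subspace_neg[OF subspace_klr_ideal[OF assms(1)] klr_rel_mult[OF assms(1) this x]]
      show ?thesis by (simp add: 1 mult.assoc)
    qed
    then show ?thesis using assms(5) by blast
  next
    case (2 j)
    have "psigen r * (gen g * x) - gen g * (psigen r * x) \<in> klr_ideal n" if x: "x \<in> klr_carrier n" for x
    proof -
      have "klr_rel n (psigen r * psigen j) (psigen j * psigen r)"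
        by (rule klr_rel.psi_psi) (use 2 assms in auto)
      from klr_rel_mult[OF assms(1) this x]
      show ?thesis by (simp add: 2 mult.assoc)
    qed
    then show ?thesis using assms(5) by blast
  next
    case (3 i)
    have r: "r \<in> {1..<n}" using assms by auto
    have "psigen r * (gen g * x) - egen (swap r i) * (psigen r * x) \<in> klr_ideal n" if x: "x \<in> klr_carrier n" for x
      using klr_rel_mult[OF assms(1) klr_rel.psi_e[OF 3(2) r] x] by (simp add: 3 mult.assoc)
    moreover have "E (swap r i) \<in> level_gens n k"
      using swap_in_res_seqs[OF 3(2) r] by (simp add: level_gens_def)
    ultimately show ?thesis by blast
  qed
qed

lemma y_comm_level:
  assumes "n > 0" "r \<le> n" "k < r" "g \<in> level_gens n k"
  shows "\<exists>g'\<in>level_gens n k. \<forall>x\<in>klr_carrier n. ygen r * (gen g * x) - gen g' * (ygen r * x) \<in> klr_ideal n"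
proof -
  consider j where "g = Y j" "1 \<le> j" "j \<le> k" | j where "g = Psi j" "1 \<le> j" "j < k"
    | i where "g = E i" "i \<in> res_seqs n"
    using assms(4) by (auto simp: level_gens_def)
  then have "klr_rel n (ygen r * gen g) (gen g * ygen r)"
  proof cases
    case 1
    then show ?thesis using assms by (auto intro!: klr_rel.y_y)
  next
    case 2
    then show ?thesis using assms by (auto intro!: klr_rel.y_psi)
  next
    case 3
    then show ?thesis using assms by (auto intro!: klr_rel.y_e)
  qed
  from klr_rel_mult[OF assms(1) this] assms(4) show ?thesis
    by (auto simp: mult.assoc)
qed

lemma slide_psi:
  assumes "n > 0" "k < n" "x \<in> klr_carrier n" "b + m + 1 < k"
  shows "slide b (psigen k * x) m - psigen k * slide b x m \<in> klr_ideal n"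
  using assms(4)
proof (induction m)
  case 0
  then show ?case using fa.subspace_0[OF subspace_klr_ideal[OF assms(1)]] by simp
next
  case (Suc m)
  note sub = subspace_klr_ideal[OF assms(1)]
  have j: "b + 1 + m \<in> {1..<n}" using Suc.prems assms(2) by simp
  have "slide b x m \<in> klr_carrier n"
    by (rule slide_stable[OF stable_carrier[of n n]]) (use assms Suc.prems in auto)
  moreover have "klr_rel n (psigen (b + 1 + m) * psigen k) (psigen k * psigen (b + 1 + m))"
    by (rule klr_rel.psi_psi) (use assms Suc.prems in auto)
  ultimately have 1: "psigen (b + 1 + m) * psigen k * slide b x m - psigen k * psigen (b + 1 + m) * slide b x m \<in> klr_ideal n"
    using klr_rel_mult[OF assms(1)] by blast
  have 2: "psigen (b + 1 + m) * (slide b (psigen k * x) m - psigen k * slide b x m) \<in> klr_ideal n"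
    by (rule klr_ideal_mult(1)[OF assms(1) Suc.IH psigen_closed[OF j]]) (use Suc.prems in simp)
  from fa.subspace_add[OF sub 2 1] show ?case
    by (simp add: right_diff_distrib mult.assoc)
qed

text \<open>Pascal's rule: let \<open>K1\<close> be generated by \<open>z\<close> over the algebra on \<open>k - 1\<close> strands and \<open>\<zeta> = \<psi>\<^bsub>k - 1\<^esub> \<dots> \<psi>\<^bsub>b + 1\<^esub> z\<close>.
  Modulo \<open>K1\<close> the vector \<open>\<zeta>\<close> is again a Specht vector, with \<open>b - 1\<close> in place of \<open>b\<close>, and \<open>K1\<close> and \<open>\<zeta>\<close> together
  generate everything. The first conjunct is what makes the induction work: in the next
  step, stability under \<open>\<psi>\<^sub>k\<close> only has to be tested on the generators on the right.\<close>

lemma specht_vector_bound: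
  fixes K :: "'f::field klr_free set"
  assumes "n > 1" "specht_vector n k K b z" "b + 1 \<le> k"
  shows "(b + 2 \<le> k \<longrightarrow> orbit n k (insert z K) \<subseteq> orbit n (k - 1) (insert z (insert (slide b z (k - b - 1)) K))) \<and>
    (\<exists>B. finite B \<and> B \<subseteq> klr_carrier n \<and> card B \<le> (k - 1) choose b \<and>
      (\<forall>x\<in>orbit n k (insert z K). \<exists>u\<in>K. x - u \<in> fa.span B))"
  using assms(2,3)
proof (induction k arbitrary: K b z)
  case 0
  then show ?case by simp
next
  case (Suc k)
  interpret S: specht_vector n "Suc k" K b z by (rule Suc.prems(1))
  have X: "insert z K \<subseteq> klr_carrier n" using S.z_carrier S.K_carrier by blast
  show ?case
  proof (cases "b = 0 \<or> Suc k = b + 1")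
    case True
    note line = S.orbit_line[OF True assms(1)]
    show ?thesis
    proof (intro conjI impI)
      assume k: "b + 2 \<le> Suc k"
      let ?X = "insert z (insert (slide b z (Suc k - b - 1)) K)"
      have "slide b z (Suc k - b - 1) \<in> klr_carrier n"
        by (rule S.slide_carrier) (use k in simp)
      then have O: "stable n (Suc k - 1) (orbit n (Suc k - 1) ?X)"
        by (intro stable_orbit) (use S.n S.k_le X in auto)
      show "orbit n (Suc k) (insert z K) \<subseteq> orbit n (Suc k - 1) ?X"
      proof
        fix x assume "x \<in> orbit n (Suc k) (insert z K)"
        then obtain c where c: "x - Poly_Mapping.single 0 c * z \<in> K" by (rule line)
        have sub: "fa.subspace (orbit n (Suc k - 1) ?X)" using O by (simp add: stable_def)
        have "x - Poly_Mapping.single 0 c * z + Poly_Mapping.single 0 c * z \<in> orbit n (Suc k - 1) ?X"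
          using subset_orbit[of ?X] c by (intro fa.subspace_add[OF sub] fa.subspace_scale[OF sub]) auto
        then show "x \<in> orbit n (Suc k - 1) ?X" by simp
      qed
    next
      have "card {z} \<le> (Suc k - 1) choose b"
        using Suc.prems(2) by (simp add: Suc_leI)
      moreover have "\<exists>u\<in>K. x - u \<in> fa.span {z}" if x: "x \<in> orbit n (Suc k) (insert z K)" for x
      proof -
        obtain c where c: "x - Poly_Mapping.single 0 c * z \<in> K" using x by (rule line)
        have "x - (x - Poly_Mapping.single 0 c * z) \<in> fa.span {z}"
          by (simp add: fa.span_scale fa.span_base)
        with c show ?thesis by blast
      qed
      ultimately show "\<exists>B. finite B \<and> B \<subseteq> klr_carrier n \<and> card B \<le> (Suc k - 1) choose b \<and>
          (\<forall>x\<in>orbit n (Suc k) (insert z K). \<exists>u\<in>K. x - u \<in> fa.span B)"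
        using S.z_carrier by (intro exI[of _ "{z}"]) auto
    qed
  next
    case False
    then have b: "b \<ge> 1" "b + 2 \<le> Suc k" using Suc.prems(2) by auto
    then obtain m where k: "k = b + 1 + m" using le_Suc_ex[of "b + 1" k] by auto
    define K1 where "K1 = orbit n k (insert z K)"
    define x0 where "x0 = slide b z m"
    define \<zeta> where "\<zeta> = psigen k * x0"
    have \<zeta>: "\<zeta> = slide b z (Suc k - b - 1)" by (simp add: \<zeta>_def x0_def k)
    define K2 where "K2 = orbit n k (insert \<zeta> K1)"
    have kn: "k < n" "k \<ge> 1" using S.k_le b by auto
    have S1: "specht_vector n k K b z"
      by (intro specht_vector.intro klr_level.intro specht_vector_axioms.intro
        S.z_weighted S.z_y S.z_psi stable_mono[OF _ S.stab]) (use S.n kn in auto)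
    have S2: "specht_vector n k K1 (b - 1) \<zeta>"
      using S.specht_vector_orbit[OF b] by (simp add: K1_def \<zeta>)
    interpret S1: specht_vector n k K b z by (rule S1)
    interpret S2: specht_vector n k K1 "b - 1" \<zeta> by (rule S2)
    from Suc.IH[OF S1] k obtain B1 where
      A1: "b + 2 \<le> k \<Longrightarrow> K1 \<subseteq> orbit n (k - 1) (insert z (insert (slide b z (k - b - 1)) K))"
      and B1: "finite B1" "B1 \<subseteq> klr_carrier n" "card B1 \<le> (k - 1) choose b" "\<And>x. x \<in> K1 \<Longrightarrow> \<exists>u\<in>K. x - u \<in> fa.span B1"
      unfolding K1_def by auto
    have "b - 1 + 2 \<le> k" "b - 1 + 1 \<le> k" using b by auto
    with Suc.IH[OF S2] obtain B2 where
      A2: "K2 \<subseteq> orbit n (k - 1) (insert \<zeta> (insert (slide (b - 1) \<zeta> (k - (b - 1) - 1)) K1))"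
      and B2: "finite B2" "B2 \<subseteq> klr_carrier n" "card B2 \<le> (k - 1) choose (b - 1)" "\<And>x. x \<in> K2 \<Longrightarrow> \<exists>u\<in>K1. x - u \<in> fa.span B2"
      unfolding K2_def by auto
    have X2: "insert \<zeta> K1 \<subseteq> klr_carrier n" using S2.z_carrier S2.K_carrier by blast
    have stK2: "stable n k K2" unfolding K2_def by (rule stable_orbit[OF S.n _ X2]) (use kn in simp)
    interpret K2: klr_level n k K2
      by unfold_locales (use S.n kn stK2 in auto)
    have K_K1: "K \<subseteq> K1" "z \<in> K1" unfolding K1_def using subset_orbit[of "insert z K"] by auto
    have K1_K2: "K1 \<subseteq> K2" "\<zeta> \<in> K2" unfolding K2_def using subset_orbit[of "insert \<zeta> K1"] by auto
    have x0: "x0 \<in> K1" unfolding x0_def by (rule slide_stable[OF S2.stab K_K1(2)]) (use k in simp)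
    have w0: "S.weighted x0" unfolding x0_def by (rule S.slide_weighted) (use k in simp)
    have psi: "psigen k \<in> klr_carrier n" and y: "ygen (Suc k) \<in> klr_carrier n"
      using kn by (auto intro!: psigen_closed ygen_closed)
    \<comment> \<open>\<open>K1\<close> is defined over \<open>k\<close> strands, where the
      neighbour \<open>psigen (k - 1)\<close> obstructs commutation. The first conjunct of the
      induction hypothesis provides the generators \<open>z\<close>, \<open>x0\<close> and
      \<open>K\<close> over \<open>k - 1\<close> strands, and \<open>psigen k\<close> passes that
      algebra. For \<open>m = 0\<close>, \<open>K1\<close> is just \<open>K\<close> plus the line of
      \<open>z\<close>.\<close>
    have psi_K1: "psigen k * x \<in> K2" if x: "x \<in> K1" for x
    proof (cases m)
      case 0
      obtain c where c: "x - Poly_Mapping.single 0 c * z \<in> K"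
        by (rule S1.orbit_line[OF _ assms(1)]) (use x k 0 in \<open>auto simp: K1_def\<close>)
      have "psigen k * (x - Poly_Mapping.single 0 c * z) + Poly_Mapping.single 0 c * (psigen k * z) \<in> K2"
      proof (rule K2.add_K)
        show "psigen k * (x - Poly_Mapping.single 0 c * z) \<in> K2"
          using S.psi_K[of k] c kn K_K1 K1_K2 by auto
        show "Poly_Mapping.single 0 c * (psigen k * z) \<in> K2"
          using fa.subspace_scale[OF K2.sub K1_K2(2), of c] 0 by (simp add: \<zeta>_def x0_def)
      qed
      moreover have "psigen k * (Poly_Mapping.single 0 c * z) = Poly_Mapping.single 0 c * (psigen k * z)"
        by (simp add: mult.assoc[symmetric] scalar_central)
      ultimately show ?thesis by (simp add: right_diff_distrib)
    next
      case (Suc m')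
      show ?thesis
      proof (rule orbit_operator)
        show "x \<in> orbit n (k - 1) (insert z (insert x0 K))"
          using A1 x k Suc by (auto simp: x0_def)
        show "stable n (k - 1) K2" using stK2 by (rule stable_mono[rotated]) simp
        show "insert z (insert x0 K) \<subseteq> klr_carrier n"
          using X x0 S2.K_carrier by blast
        show "psigen k * v \<in> K2" if "v \<in> insert z (insert x0 K)" for v
        proof -
          have "psigen k * v \<in> K" if "v \<in> insert z K"
            using that S.psi_K[of k] S.z_psi[of k] kn k Suc by auto
          moreover have "psigen k * x0 \<in> K2" using K1_K2(2) by (simp add: \<zeta>_def)
          ultimately show ?thesis using \<open>v \<in> _\<close> K_K1 K1_K2 by auto
        qed
      qed (use S.n kn psi k Suc in \<open>auto intro!: psi_comm_level\<close>)
    qed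
    have y_op: "ygen (Suc k) * x \<in> K2" if "x \<in> orbit n k V" "V \<subseteq> klr_carrier n" "\<And>v. v \<in> V \<Longrightarrow> ygen (Suc k) * v \<in> K2" for x V
      by (rule orbit_operator[OF S.n _ stK2 y _ that(2,3,1)]) (use S.n kn in \<open>auto intro!: y_comm_level\<close>)
    have y_K1: "ygen (Suc k) * x \<in> K2" if "x \<in> K1" for x
    proof (rule y_op[OF _ X])
      show "x \<in> orbit n k (insert z K)" using that by (simp add: K1_def)
      show "ygen (Suc k) * v \<in> K2" if "v \<in> insert z K" for v
        using that S.z_y[of "Suc k"] S.y_K[of "Suc k" v] K_K1 K1_K2 by auto
    qed
    \<comment> \<open>Moving \<open>y\<close> past the last crossing of \<open>\<zeta>\<close>
      leaves \<open>psigen k * (ygen k * x0)\<close> and a multiple of \<open>x0\<close>, both known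
      to lie in \<open>K2\<close>.\<close>
    have y_K2: "ygen (Suc k) * x \<in> K2" if "x \<in> K2" for x
    proof (rule y_op[OF _ X2])
      show "x \<in> orbit n k (insert \<zeta> K1)" using that by (simp add: K2_def)
      obtain c where c: "c = 0 \<or> c = 1" "ygen (k + 1) * (psigen k * x0) - psigen k * (ygen k * x0) - c * x0 \<in> K"
        by (rule S.y_Suc_psi_weighted[OF w0, of k]) (use kn in auto)
      have 1: "psigen k * (ygen k * x0) \<in> K2" using S2.y_K[of k] x0 kn by (intro psi_K1) auto
      have 2: "c * x0 \<in> K2" using c(1) x0 K1_K2 K2.zero_K by auto
      have "ygen (k + 1) * (psigen k * x0) - psigen k * (ygen k * x0) - c * x0 \<in> K2"
        using c(2) K_K1 K1_K2 by blast
      from K2.add_K[OF K2.add_K[OF this 2] 1] have "ygen (Suc k) * \<zeta> \<in> K2"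
        by (simp add: \<zeta>_def)
      then show "ygen (Suc k) * v \<in> K2" if "v \<in> insert \<zeta> K1" for v
        using that y_K1 by auto
    qed
    \<comment> \<open>Here the first conjunct for \<open>\<zeta>\<close> supplies generators over
      \<open>k - 1\<close> strands. On \<open>\<zeta>\<close> the square of the crossing is a
      polynomial in the \<open>y\<close>; on the long string a braid relation applies.\<close>
    have psi_K2: "psigen k * x \<in> K2" if x: "x \<in> K2" for x
    proof (rule orbit_operator)
      define w where "w = slide (b - 1) \<zeta> m"
      \<comment> \<open>\<open>\<zeta>\<close> is \<open>psigen k * x0\<close>, and
        \<open>psigen k\<close> commutes with the crossings in \<open>w\<close>. So \<open>w\<close>
        is \<open>psigen k * \<eta>\<close> modulo the ideal, which brings the product into braid
        form.\<close>
      define \<eta> where "\<eta> = slide (b - 1) x0 m"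
      have \<xi>: "slide (b - 1) \<zeta> (k - (b - 1) - 1) = psigen (k - 1) * w"
        using b k by (simp add: w_def)
      show "x \<in> orbit n (k - 1) (insert \<zeta> (insert (psigen (k - 1) * w) K1))"
        using A2 x \<xi> by auto
      show "stable n (k - 1) K2" using stK2 by (rule stable_mono[rotated]) simp
      have wK2: "w \<in> K2" unfolding w_def by (rule slide_stable[OF stK2 K1_K2(2)]) (use b k in simp)
      then have "psigen (k - 1) * w \<in> K2" using b k by (intro K2.psi_K) auto
      then show "insert \<zeta> (insert (psigen (k - 1) * w) K1) \<subseteq> klr_carrier n"
        using X2 K2.K_carrier by auto
      have "psigen k * \<zeta> \<in> K2"
      proof -
        obtain c where c: "c = 0 \<or> c = 1" "psigen k * (psigen k * x0)
          + c * (ygen k * (ygen k * x0 - ygen (k + 1) * x0) - ygen (k + 1) * (ygen k * x0 - ygen (k + 1) * x0)) \<in> K"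
          by (rule S.psi_sq_weighted[OF w0, of k]) (use kn in auto)
        have "ygen k * x0 - ygen (k + 1) * x0 \<in> K2"
          using S2.y_K[of k x0] x0 kn K1_K2 y_K1[OF x0] by (intro K2.diff_K) auto
        then have "ygen k * (ygen k * x0 - ygen (k + 1) * x0) - ygen (k + 1) * (ygen k * x0 - ygen (k + 1) * x0) \<in> K2"
          using y_K2 K2.y_K[of k] kn by (intro K2.diff_K) auto
        then have "c * (ygen k * (ygen k * x0 - ygen (k + 1) * x0) - ygen (k + 1) * (ygen k * x0 - ygen (k + 1) * x0)) \<in> K2"
          using c(1) K2.zero_K by auto
        from K2.diff_K[OF subsetD[OF subset_trans[OF K_K1(1) K1_K2(1)] c(2)] this]
        have "psigen k * (psigen k * x0) \<in> K2"
          by (simp only: add_diff_cancel_right')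
        then show ?thesis by (simp add: \<zeta>_def)
      qed
      moreover have "psigen k * (psigen (k - 1) * w) \<in> K2"
      proof -
        have \<eta>: "\<eta> \<in> K1" unfolding \<eta>_def by (rule slide_stable[OF S2.stab x0]) (use b k in simp)
        have w\<eta>: "S.weighted \<eta>" unfolding \<eta>_def by (rule S.weighted_slide[OF w0]) (use b k in simp)
        obtain c where c: "c = 0 \<or> c = 1" "psigen (k - 1) * (psigen (k - 1 + 1) * (psigen (k - 1) * \<eta>))
          - psigen (k - 1 + 1) * (psigen (k - 1) * (psigen (k - 1 + 1) * \<eta>))
          - c * (ygen (k - 1) * \<eta> - ygen (k - 1 + 1) * \<eta> - ygen (k - 1 + 1) * \<eta> + ygen (k - 1 + 2) * \<eta>) \<in> K"
          by (rule S.braid_weighted[OF w\<eta>, of "k - 1"]) (use b k in auto)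
        have k1: "k - 1 + 1 = k" "k - 1 + 2 = Suc k" using kn by auto
        have "psigen k * (psigen (k - 1) * \<eta>) \<in> K2"
          by (intro psi_K1 S2.psi_K \<eta>) (use b k in auto)
        then have 1: "psigen (k - 1) * (psigen k * (psigen (k - 1) * \<eta>)) \<in> K2"
          by (rule K2.psi_K[rotated 2]) (use b k in auto)
        have "ygen (k - 1) * \<eta> \<in> K2" "ygen k * \<eta> \<in> K2"
          using S2.y_K[OF _ _ \<eta>] K1_K2 b k by auto
        then have "ygen (k - 1) * \<eta> - ygen k * \<eta> - ygen k * \<eta> + ygen (Suc k) * \<eta> \<in> K2"
          using y_K1[OF \<eta>] by (intro K2.add_K K2.diff_K)
        then have 2: "c * (ygen (k - 1) * \<eta> - ygen k * \<eta> - ygen k * \<eta> + ygen (Suc k) * \<eta>) \<in> K2"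
          using c(1) K2.zero_K by auto
        have "psigen (k - 1) * (psigen k * (psigen (k - 1) * \<eta>)) - psigen k * (psigen (k - 1) * (psigen k * \<eta>))
          - c * (ygen (k - 1) * \<eta> - ygen k * \<eta> - ygen k * \<eta> + ygen (Suc k) * \<eta>) \<in> K2"
          using c(2) K_K1 K1_K2 unfolding k1 by blast
        then have 1: "psigen k * (psigen (k - 1) * (psigen k * \<eta>)) \<in> K2"
          using 1 2 by (rule K2.diff_diff_K)
        have "w - psigen k * \<eta> \<in> klr_ideal n"
          unfolding w_def \<eta>_def \<zeta>_def using S1.K_carrier S2.K_carrier x0 S.n kn b k
          by (intro slide_psi) auto
        moreover have "psigen (k - 1) \<in> klr_carrier n" using kn b k by (intro psigen_closed) auto
        ultimately have "psigen k * (psigen (k - 1) * (w - psigen k * \<eta>)) \<in> klr_ideal n"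
          using psi by (intro klr_ideal_mult(1)[OF S.n])
        then have "psigen k * (psigen (k - 1) * w) - psigen k * (psigen (k - 1) * (psigen k * \<eta>)) \<in> klr_ideal n"
          by (simp only: right_diff_distrib)
        with 1 show ?thesis using K2.cong_ideal by blast
      qed
      ultimately show "psigen k * v \<in> K2" if "v \<in> insert \<zeta> (insert (psigen (k - 1) * w) K1)" for v
        using that psi_K1 by auto
    qed (use S.n kn psi b k in \<open>auto intro!: psi_comm_level\<close>)
    have stab: "stable n (Suc k) K2"
    proof -
      have "gen g * x \<in> K2" if g: "g \<in> level_gens n (Suc k)" and x: "x \<in> K2" for g x
      proof -
        have "g \<in> level_gens n k \<or> g = Psi k \<or> g = Y (Suc k)"
          using g by (auto simp: level_gens_def less_Suc_eq le_Suc_eq)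
        then show ?thesis using x K2.gen_K psi_K2 y_K2 by auto
      qed
      then show ?thesis using stK2 by (simp add: stable_def)
    qed
    have orbit_K2: "orbit n (Suc k) (insert z K) \<subseteq> K2"
      using K_K1 K1_K2 by (intro orbit_subset stab) auto
    have K2_orbit: "K2 \<subseteq> orbit n k (insert z (insert \<zeta> K))"
    proof -
      have Z: "insert z (insert \<zeta> K) \<subseteq> klr_carrier n" using X X2 by blast
      have "K1 \<subseteq> orbit n k (insert z (insert \<zeta> K))"
        unfolding K1_def by (rule orbit_mono) blast
      then show ?thesis
        unfolding K2_def using subset_orbit[of "insert z (insert \<zeta> K)"] kn S.n Z
        by (intro orbit_orbit) auto
    qed
    have "\<exists>u\<in>K. x - u \<in> fa.span (B1 \<union> B2)" if x: "x \<in> orbit n (Suc k) (insert z K)" for x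
    proof -
      obtain u1 where u1: "u1 \<in> K1" "x - u1 \<in> fa.span B2" using x orbit_K2 B2(4) by blast
      obtain u where u: "u \<in> K" "u1 - u \<in> fa.span B1" using B1(4)[OF u1(1)] by blast
      have "x - u1 + (u1 - u) \<in> fa.span (B1 \<union> B2)"
        using u(2) u1(2) fa.span_mono[of B1 "B1 \<union> B2"] fa.span_mono[of B2 "B1 \<union> B2"]
        by (intro fa.span_add) auto
      with u(1) show ?thesis by auto
    qed
    moreover have "card (B1 \<union> B2) \<le> (Suc k - 1) choose b"
    proof -
      obtain k' where "k = Suc k'" using kn by (cases k) auto
      moreover obtain b' where "b = Suc b'" using b by (cases b) auto
      ultimately show ?thesis using card_Un_le[of B1 B2] B1(3) B2(3) by simp
    qed
    ultimately have "\<exists>B. finite B \<and> B \<subseteq> klr_carrier n \<and> card B \<le> (Suc k - 1) choose b \<and>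
          (\<forall>x\<in>orbit n (Suc k) (insert z K). \<exists>u\<in>K. x - u \<in> fa.span B)"
      using B1 B2 by (intro exI[of _ "B1 \<union> B2"]) auto
    moreover have "orbit n (Suc k) (insert z K) \<subseteq> orbit n (Suc k - 1) (insert z (insert (slide b z (Suc k - b - 1)) K))"
      using orbit_K2 K2_orbit unfolding \<zeta>[symmetric] by simp
    ultimately show ?thesis by blast
  qed
qed

section \<open>The Specht module as a space of functions\<close>

lemma regular_module_simps:
  "carrier (regular_module R) = carrier R" "add (regular_module R) = add R"
  "zero (regular_module R) = zero R" "smult (regular_module R) = mult R"
  by (simp_all add: regular_module_def)

locale cyclic_presentation =
  fixes R :: "('a, 'm) ring_scheme" and S :: "'a set"
  assumes R: "ring R" and S: "S \<subseteq> carrier R"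
begin

definition N :: "'a set" where
  "N = span_submodule R (regular_module R) S"

definition cl :: "'a \<Rightarrow> 'a set" where
  "cl x = N +>\<^bsub>regular_module R\<^esub> x"

sublocale Reg: left_module R "regular_module R"
  using R by (rule regular_left_module)

lemma submodule_N: "submodule N R (regular_module R)"
  unfolding N_def using S by (intro span_submodule Reg.left_module_axioms) (simp add: regular_module_simps)

lemma S_N: "S \<subseteq> N"
  by (auto simp: N_def span_submodule_def)

lemma N_minimal: "submodule N' R (regular_module R) \<Longrightarrow> S \<subseteq> N' \<Longrightarrow> N \<subseteq> N'"
  by (auto simp: N_def span_submodule_def)

sublocale sub: submodule N R "regular_module R"
  by (rule submodule_N)

sublocale asub: abelian_subgroup N "regular_module R"
  by (intro abelian_subgroupI3 additive_subgroup.intro sub.subgroup_axioms Reg.abelian_group_axioms)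

lemma carrier_cyclic: "carrier (cyclic_module R S) = cl ` carrier R"
  by (auto simp: cyclic_module_def quot_module_def N_def[symmetric] cl_def A_RCOSETS_def RCOSETS_def
    a_r_coset_def regular_module_simps)

lemma zero_cyclic: "zero (cyclic_module R S) = N"
  by (simp add: cyclic_module_def quot_module_def N_def)

lemma cl_add: "x \<in> carrier R \<Longrightarrow> y \<in> carrier R \<Longrightarrow> cl x \<oplus>\<^bsub>cyclic_module R S\<^esub> cl y = cl (x \<oplus>\<^bsub>R\<^esub> y)"
  using asub.a_rcos_sum[of x y]
  by (simp add: cyclic_module_def quot_module_def N_def[symmetric] cl_def regular_module_simps)

lemma cl_eq_iff: "x \<in> carrier R \<Longrightarrow> cl x = N \<longleftrightarrow> x \<in> N"
  using abelian_group.a_coset_join1[OF Reg.abelian_group_axioms, of N x]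
    abelian_group.a_coset_join2[OF Reg.abelian_group_axioms, of x N] sub.subgroup_axioms
  unfolding cl_def regular_module_simps by blast

lemma cl_smult:
  assumes "r \<in> carrier R" "x \<in> carrier R"
  shows "r \<odot>\<^bsub>cyclic_module R S\<^esub> cl x = cl (r \<otimes>\<^bsub>R\<^esub> x)"
proof -
  have "N +>\<^bsub>regular_module R\<^esub> (r \<otimes>\<^bsub>R\<^esub> x') = cl (r \<otimes>\<^bsub>R\<^esub> x)" if x': "x' \<in> cl x" for x'
  proof -
    obtain h where h: "h \<in> N" "x' = h \<oplus>\<^bsub>R\<^esub> x"
      using x' unfolding cl_def a_r_coset_def' by (auto simp: regular_module_simps)
    have "h \<in> carrier R" using h sub.subset by (auto simp: regular_module_simps)
    then have "r \<otimes>\<^bsub>R\<^esub> x' = r \<otimes>\<^bsub>R\<^esub> h \<oplus>\<^bsub>R\<^esub> r \<otimes>\<^bsub>R\<^esub> x"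
      using h assms by (simp add: Reg.R.r_distr)
    moreover have "r \<otimes>\<^bsub>R\<^esub> h \<in> N" using sub.smult_closed[OF assms(1) h(1)] by (simp add: regular_module_simps)
    ultimately have "r \<otimes>\<^bsub>R\<^esub> x' \<in> cl (r \<otimes>\<^bsub>R\<^esub> x)"
      unfolding cl_def a_r_coset_def' by (auto simp: regular_module_simps)
    then show ?thesis
      unfolding cl_def using assms
      by (intro asub.a_repr_independence'[symmetric]) (simp_all add: regular_module_simps)
  qed
  moreover have "x \<in> cl x"
    unfolding cl_def using asub.a_rcos_self[of x] assms by (simp add: regular_module_simps)
  ultimately have "(\<Union>x'\<in>cl x. N +>\<^bsub>regular_module R\<^esub> (r \<otimes>\<^bsub>R\<^esub> x')) = cl (r \<otimes>\<^bsub>R\<^esub> x)"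
    by (intro SUP_eq_const) blast+
  then show ?thesis
    by (simp add: cyclic_module_def quot_module_def N_def[symmetric] regular_module_simps)
qed

end

section \<open>Functions of fixed degree and their basis\<close>

definition fock :: "nat \<Rightarrow> nat \<Rightarrow> (nat set \<Rightarrow> 'f::field) set" where
  "fock n b = {v. \<forall>J. v J \<noteq> 0 \<longrightarrow> J \<subseteq> {2..n} \<and> card J = b}"

definition delta :: "nat set \<Rightarrow> nat set \<Rightarrow> 'f::field" where
  "delta J = (\<lambda>J'. if J' = J then 1 else 0)"

interpretation fv: vector_space "\<lambda>c (v :: nat set \<Rightarrow> 'f::field) J. c * v J"
  by standard (simp_all add: fun_eq_iff algebra_simps)

lemma subspace_fock: "fv.subspace (fock n b)"
proof (rule fv.subspaceI)
  show "x + y \<in> fock n b" if "x \<in> fock n b" "y \<in> fock n b" for x y :: "nat set \<Rightarrow> 'a"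
    unfolding fock_def
  proof (intro CollectI allI impI)
    fix J assume "(x + y) J \<noteq> 0"
    then have "x J \<noteq> 0 \<or> y J \<noteq> 0" by auto
    then show "J \<subseteq> {2..n} \<and> card J = b" using that by (auto simp: fock_def)
  qed
qed (auto simp: fock_def)

lemma delta_fock: "J \<subseteq> {2..n} \<Longrightarrow> card J = b \<Longrightarrow> delta J \<in> fock n b"
  by (simp add: fock_def delta_def)

lemma card_put_put:
  assumes "finite J" "p \<in> J" "q \<notin> J"
  shows "card (put q True (put p False J)) = card J"
proof -
  have "card (insert q (J - {p})) = Suc (card (J - {p}))" "card (insert p (J - {p})) = Suc (card (J - {p}))"
    by (rule card_insert_disjoint; use assms in blast)+
  then show ?thesis using assms(2) by (simp add: put_def insert_absorb)
qed

lemma hop_fock: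
  assumes "v \<in> fock n b" "q \<in> {2..n}"
  shows "hop p q v \<in> fock n b"
  unfolding fock_def
proof (intro CollectI allI impI)
  fix J assume "hop p q v J \<noteq> 0"
  then have J: "q \<in> J" "p \<notin> J" "v (put p True (put q False J)) \<noteq> 0"
    by (auto simp: hop_def split: if_splits)
  then have J': "put p True (put q False J) \<subseteq> {2..n}" "card (put p True (put q False J)) = b"
    using assms(1) by (auto simp: fock_def)
  have "finite (J - {q})" by (rule finite_subset[of _ "{2..n}"]) (use J' in \<open>auto simp: put_def\<close>)
  then have "card J = b" using J J' card_put_put[of J q p] by simp
  moreover have "J \<subseteq> {2..n}" using J' assms(2) by (auto simp: put_def)
  ultimately show "J \<subseteq> {2..n} \<and> card J = b" by blast
qed

lemma act_y_fock:
  assumes "v \<in> fock n b" "1 \<le> r" "r \<le> n"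
  shows "act_y r v \<in> fock n b"
proof -
  obtain c where c: "act_y r v = (\<lambda>J. c * hop (2 * (r div 2) + 1) (2 * (r div 2)) v J)"
    using act_y_hop by blast
  show ?thesis
  proof (cases "r = 1")
    case True
    then have "act_y r v = 0" by (simp add: fun_eq_iff act_y_def)
    then show ?thesis using fv.subspace_0[OF subspace_fock] by (simp only:)
  next
    case False
    then have "2 * (r div 2) \<in> {2..n}" using assms by auto
    then show ?thesis
      unfolding c by (intro fv.subspace_scale[OF subspace_fock] hop_fock assms(1))
  qed
qed

lemma act_psi_fock:
  assumes "v \<in> fock n b" "1 \<le> r" "r < n"
  shows "act_psi r v \<in> fock n b"
  unfolding fock_def
proof (intro CollectI allI impI)
  fix J assume "act_psi r v J \<noteq> 0"
  then have "hop r (r + 1) v J \<noteq> 0 \<or> r > 2 \<and> hop (r + 2) (r - 1) v J \<noteq> 0"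
    using assms(2) by (auto simp: act_psi_def split: if_splits elim: oddE)
  moreover have "hop r (r + 1) v \<in> fock n b" "r > 2 \<Longrightarrow> hop (r + 2) (r - 1) v \<in> fock n b"
    by (rule hop_fock[OF assms(1)]; use assms in \<open>simp, linarith?\<close>)+
  ultimately show "J \<subseteq> {2..n} \<and> card J = b" by (auto simp: fock_def)
qed

lemma act_fock: "v \<in> fock n b \<Longrightarrow> g \<in> klr_gens n \<Longrightarrow> act n g v \<in> fock n b"
  using act_y_fock[of v n b] act_psi_fock[of v n b]
  by (cases g) (auto simp: klr_gens_def, auto simp: fock_def act_e_def)

lemma rep_fock:
  assumes "p \<in> klr_carrier n" "v \<in> fock n b"
  shows "rep n p v \<in> fock n b"
proof -
  have f: "foldr (act n) xs v \<in> fock n b" if "set xs \<subseteq> klr_gens n" for xs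
    using that by (induction xs) (auto simp: assms(2) intro: act_fock)
  show ?thesis
    unfolding fock_def
  proof (intro CollectI allI impI)
    fix J assume "rep n p v J \<noteq> 0"
    then obtain w where "w \<in> Poly_Mapping.keys p" "foldr (act n) (letters w) v J \<noteq> 0"
      unfolding rep_def by (metis (no_types, lifting) mult_zero_right sum.neutral)
    then show "J \<subseteq> {2..n} \<and> card J = b"
      using f[of "letters w"] assms(1) by (auto simp: fock_def free_algebra_def)
  qed
qed

text \<open>The base case of \<open>delta_generated\<close>: only the initial tableau has no element
  that can move to a free place just below it.\<close>

lemma interval_if_closed:
  assumes "J \<subseteq> {2..n::nat}" "card J = b" "\<And>p. p \<in> J \<Longrightarrow> p \<ge> 3 \<Longrightarrow> p - 1 \<in> J"
  shows "J = {2..b + 1}"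
proof (cases "J = {}")
  case True
  then show ?thesis using assms(2) by auto
next
  case False
  have fin: "finite J" using assms(1) finite_subset by blast
  define M where "M = Max J"
  have M: "M \<in> J" "\<And>x. x \<in> J \<Longrightarrow> x \<le> M" using fin False by (auto simp: M_def)
  have down: "M - k \<in> J" if "M - k \<ge> 2" for k
    using that
  proof (induction k)
    case 0
    then show ?case using M by simp
  next
    case (Suc k)
    then have "M - k \<in> J" "M - k \<ge> 3" by auto
    from assms(3)[OF this] show ?case by simp
  qed
  have "x \<in> J" if "2 \<le> x" "x \<le> M" for x
    using down[of "M - x"] that by simp
  moreover have "2 \<le> x" "x \<le> M" if "x \<in> J" for x
    using that M(2) assms(1) by auto
  ultimately have "x \<in> J \<longleftrightarrow> x \<in> {2..M}" for x
    unfolding atLeastAtMost_iff by blast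
  then have J: "J = {2..M}" by blast
  then have "M = b + 1" using assms(2) M(1) by (simp add: J)
  with J show ?thesis by simp
qed

lemma hop_delta:
  assumes "p \<in> J" "q \<notin> J"
  shows "hop p q (delta J) = (delta (put q True (put p False J)) :: nat set \<Rightarrow> 'f::field)"
proof
  fix J'
  have "(q \<in> J' \<and> p \<notin> J' \<and> put p True (put q False J') = J) \<longleftrightarrow> J' = put q True (put p False J)"
    using assms by (auto simp: put_def)
  moreover have "hop p q (delta J) J'
      = (if q \<in> J' \<and> p \<notin> J' \<and> put p True (put q False J') = J then 1 else 0 :: 'f)"
    by (simp add: hop_def delta_def)
  ultimately show "hop p q (delta J) J' = (delta (put q True (put p False J)) J' :: 'f)"
    by (simp only: delta_def)
qed

lemma hop_delta_zero: "p \<notin> J \<or> q \<in> J \<Longrightarrow> p \<noteq> q \<Longrightarrow> hop p q (delta J) = 0"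
  by (auto simp: fun_eq_iff hop_def delta_def put_def)

text \<open>If \<open>r + 1 \<in> J\<close> and \<open>r \<notin> J\<close>, then \<open>\<psi>\<^sub>r\<close> produces \<open>delta J\<close>, up to sign and a term with a smaller sum of
  entries, from the set with \<open>r\<close> in place of \<open>r + 1\<close>.\<close>

lemma delta_generated:
  assumes M: "fv.subspace M" "\<And>r v. 2 \<le> r \<Longrightarrow> r < n \<Longrightarrow> v \<in> M \<Longrightarrow> act_psi r v \<in> M"
    and init: "delta {2..b + 1} \<in> M"
    and J: "J \<subseteq> {2..n}" "card J = b"
  shows "(delta J :: nat set \<Rightarrow> 'f::field) \<in> M"
  using J
proof (induction "\<Sum>J" arbitrary: J rule: less_induct)
  case less
  show ?case
  proof (cases "\<forall>p\<in>J. p \<ge> 3 \<longrightarrow> p - 1 \<in> J")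
    case True
    then show ?thesis using interval_if_closed[OF less.prems] init by auto
  next
    case False
    then obtain p where p: "p \<in> J" "p \<ge> 3" "p - 1 \<notin> J" by blast
    define r where "r = p - 1"
    have pr: "p = r + 1" "2 \<le> r" "r < n" "r \<notin> J" "r + 1 \<in> J"
      using p less.prems(1) by (auto simp: r_def)
    have fin: "finite J" using less.prems(1) finite_subset by blast
    \<comment> \<open>Every move to a smaller place lowers the sum of the elements, the measure of
      the induction. It is stated for arbitrary sets because the second hop acts on
      \<open>J1\<close>, not on \<open>J\<close>.\<close>
    have smaller: "(delta (put q True (put x False J')) :: nat set \<Rightarrow> 'f) \<in> M"
      if "finite J'" "J' \<subseteq> {2..n}" "card J' = b" "\<Sum>J' \<le> \<Sum>J" "q < x" "x \<in> J'" "q \<notin> J'" "2 \<le> q" for q x J'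
    proof (rule less.hyps)
      have "\<Sum>(put q True (put x False J')) + x = \<Sum>J' + q"
        using that by (simp add: put_def sum.remove[of J' x])
      then show "\<Sum>(put q True (put x False J')) < \<Sum>J" using that by linarith
      show "put q True (put x False J') \<subseteq> {2..n}" using that by (auto simp: put_def)
      show "card (put q True (put x False J')) = b" using that card_put_put[of J' x q] by simp
    qed
    define J1 where "J1 = put r True (put (r + 1) False J)"
    have J1: "delta J1 \<in> M"
      unfolding J1_def by (rule smaller) (use fin less.prems pr in auto)
    have J1_card: "card J1 = b"
      using card_put_put[of J "r + 1" r] fin pr less.prems(2) by (simp add: J1_def)
    have J1_J: "put (r + 1) True (put r False J1) = J"
      using pr by (auto simp: J1_def put_def)
    have h1: "hop r (r + 1) (delta J1) = (delta J :: nat set \<Rightarrow> 'f)"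
      using hop_delta[of r J1 "r + 1"] J1_J by (simp add: J1_def)
    have psi: "act_psi r (delta J1) \<in> M" by (rule M(2)[OF pr(2,3) J1])
    show ?thesis
    proof (cases "even r")
      case True
      then have "act_psi r (delta J1) = - (delta J :: nat set \<Rightarrow> 'f)"
        by (simp add: fun_eq_iff act_psi_def h1[simplified])
      with fv.subspace_neg[OF M(1) psi] show ?thesis by simp
    next
      case False
      define v :: "nat set \<Rightarrow> 'f" where "v = hop (r + 2) (r - 1) (delta J1)"
      have psi_eq: "act_psi r (delta J1) = delta J + (\<lambda>J'. (if (r \<in> J') = (r + 1 \<in> J') then 1 else - 1) * v J')"
        using False pr(2) by (auto simp: fun_eq_iff act_psi_def h1[simplified] v_def)
      have "(\<lambda>J'. (if (r \<in> J') = (r + 1 \<in> J') then 1 else - 1) * v J') \<in> M"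
      proof (cases "r + 2 \<in> J1 \<and> r - 1 \<notin> J1")
        case True
        define J2 where "J2 = put (r - 1) True (put (r + 2) False J1)"
        have v: "v = delta J2" unfolding v_def J2_def by (rule hop_delta) (use True in auto)
        have "\<Sum>J1 + (r + 1) = \<Sum>J + r"
          using pr fin by (simp add: J1_def put_def sum.remove[of J "r + 1"])
        then have sum1: "\<Sum>J1 \<le> \<Sum>J" by linarith
        have "finite J1" "J1 \<subseteq> {2..n}"
          using fin less.prems(1) pr by (auto simp: J1_def put_def)
        moreover have "2 \<le> r - 1" using False pr(2) by (auto elim!: oddE)
        ultimately have "(delta J2 :: nat set \<Rightarrow> 'f) \<in> M"
          unfolding J2_def using True sum1 J1_card by (intro smaller) auto
        then have "(\<lambda>J'. (if (r \<in> J2) = (r + 1 \<in> J2) then 1 else - 1) * delta J2 J' :: 'f) \<in> M"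
          by (rule fv.subspace_scale[OF M(1)])
        moreover have "(\<lambda>J'. (if (r \<in> J2) = (r + 1 \<in> J2) then 1 else - 1) * delta J2 J' :: 'f)
            = (\<lambda>J'. (if (r \<in> J') = (r + 1 \<in> J') then 1 else - 1) * v J')"
          by (auto simp: v delta_def)
        ultimately show ?thesis by simp
      next
        case False
        then have "v = 0" unfolding v_def by (intro hop_delta_zero) auto
        then show ?thesis using fv.subspace_0[OF M(1)] by (simp add: zero_fun_def)
      qed
      from fv.subspace_diff[OF M(1) psi this] show ?thesis by (simp add: psi_eq)
    qed
  qed
qed

definition occupied :: "nat \<Rightarrow> nat \<Rightarrow> nat set set" where
  "occupied n b = {J. J \<subseteq> {2..n} \<and> card J = b}"

lemma finite_occupied: "finite (occupied n b)"
  by (rule finite_subset[of _ "Pow {2..n}"]) (auto simp: occupied_def)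

lemma card_occupied: "card (occupied n b) = (n - 1) choose b"
  using n_subsets[of "{2..n}" b] by (simp add: occupied_def)

lemma fock_delta_sum:
  assumes "v \<in> fock n b"
  shows "v = (\<Sum>J\<in>occupied n b. (\<lambda>J'. v J * delta J J'))"
proof
  fix J'
  have "(\<Sum>J\<in>occupied n b. v J * delta J J') = (if J' \<in> occupied n b then v J' else 0)"
    by (simp add: delta_def finite_occupied if_distrib[of "(*) _"] cong: if_cong)
  then show "v J' = (\<Sum>J\<in>occupied n b. (\<lambda>J'. v J * delta J J')) J'"
    using assms by (auto simp: sum_fun_apply fock_def occupied_def)
qed

lemma inj_delta: "inj (delta :: nat set \<Rightarrow> nat set \<Rightarrow> 'f::field)"
proof (rule injI)
  fix J J' assume "delta J = (delta J' :: nat set \<Rightarrow> 'f)"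
  from fun_cong[OF this, of J] show "J = J'" by (simp add: delta_def split: if_splits)
qed

lemma independent_delta: "fv.independent (delta ` X :: (nat set \<Rightarrow> 'f::field) set)"
  unfolding fv.dependent_explicit
proof clarify
  fix t and u :: "(nat set \<Rightarrow> 'f) \<Rightarrow> 'f" and v
  assume t: "finite t" "t \<subseteq> delta ` X" "(\<Sum>v\<in>t. (\<lambda>J. u v * v J)) = 0" and v: "v \<in> t" and "u v \<noteq> 0"
  obtain J where J: "v = delta J" using t v by blast
  have "(\<Sum>w\<in>t. u w * w J) = (\<Sum>w\<in>t. if w = v then u v else 0)"
  proof (rule sum.cong[OF refl])
    fix w assume "w \<in> t"
    then obtain J' where "w = delta J'" using t by blast
    then show "u w * w J = (if w = v then u v else 0)"
      using injD[OF inj_delta, of J' J] by (auto simp: J delta_def)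
  qed
  moreover have "(\<Sum>w\<in>t. u w * w J) = 0"
    using fun_cong[OF t(3), of J] by (simp add: sum_fun_apply)
  ultimately show False using t(1) v \<open>u v \<noteq> 0\<close> by (simp add: sum.delta')
qed

lemma span_delta: "fv.span (delta ` occupied n b) = (fock n b :: (nat set \<Rightarrow> 'f::field) set)"
proof
  show "fv.span (delta ` occupied n b) \<subseteq> (fock n b :: (nat set \<Rightarrow> 'f) set)"
    by (rule fv.span_minimal[OF _ subspace_fock]) (auto simp: occupied_def delta_fock)
  show "fock n b \<subseteq> (fv.span (delta ` occupied n b) :: (nat set \<Rightarrow> 'f) set)"
  proof
    fix v :: "nat set \<Rightarrow> 'f" assume "v \<in> fock n b"
    have "(\<Sum>J\<in>occupied n b. (\<lambda>J'. v J * delta J J')) \<in> fv.span (delta ` occupied n b)"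
      by (intro fv.span_sum fv.span_scale fv.span_base imageI)
    then show "v \<in> fv.span (delta ` occupied n b)"
      by (simp only: fock_delta_sum[OF \<open>v \<in> fock n b\<close>, symmetric])
  qed
qed

lemma dim_fock: "fv.dim (fock n b :: (nat set \<Rightarrow> 'f::field) set) = (n - 1) choose b"
proof -
  have "fv.dim (fock n b :: (nat set \<Rightarrow> 'f) set) = card (delta ` occupied n b :: (nat set \<Rightarrow> 'f) set)"
    by (rule fv.dim_eq_card[OF _ independent_delta]) (simp only: span_delta[symmetric] fv.span_span)
  then show ?thesis
    using card_image[OF inj_on_subset[OF inj_delta], of "occupied n b"] by (simp add: card_occupied)
qed

lemma specht_rels_carrier:
  assumes "a \<ge> 1" shows "specht_rels a b \<subseteq> klr_carrier (a + b)"
proof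
  fix x :: "'f::field klr_free" assume "x \<in> specht_rels a b"
  then show "x \<in> klr_carrier (a + b)"
  proof induction
    case (y k)
    then show ?case by (rule ygen_closed)
  next
    case (e i)
    have "(if i = hook_seq a b then 1 else 0) \<in> (klr_carrier (a + b) :: 'f klr_free set)"
      by (simp add: one_in_free_algebra fa.subspace_0[OF subspace_free_algebra])
    with egen_closed[OF e] show ?case by (rule free_algebra_diff_closed)
  next
    case (psi j)
    then show ?case by (intro psigen_closed)
  next
    case psi_prod
    have "prod_list (map psigen xs) \<in> (klr_carrier (a + b) :: 'f klr_free set)" if "set xs \<subseteq> {1..<a + b}" for xs
      using that by (induction xs) (simp_all add: one_in_free_algebra free_algebra_mult_closed psigen_closed)
    then show ?case using assms psi_prod by (auto simp del: upt_Suc)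
  qed
qed

lemma seq_hook: "seq (a + b) {2..b + 1} = hook_seq a b"
proof -
  have "wt {2..b + 1} k = residue (hook_node b k)" if "1 \<le> k" for k
  proof (cases "k \<le> b + 1")
    case True
    then have "{2..b + 1} \<inter> {2..k} = {2..k}" "{2..b + 1} \<inter> {2..<k} = {2..<k}" by auto
    moreover have "(1 - int k) mod 2 = (if odd k then 0 else 1)"
      by presburger
    moreover have "odd k \<Longrightarrow> (k - 1) mod 2 = 0" "even k \<Longrightarrow> (1 + (k - 2)) mod 2 = 1"
      using that by presburger+
    ultimately show ?thesis
      using True that by (simp add: wt_def residue_def hook_node_def)
  next
    case False
    then obtain d where d: "k = b + 1 + d + 1" using less_iff_Suc_add[of "b + 1" k] by auto
    have "{2..b + 1} \<inter> {2..k} = {2..b + 1}" "{2..b + 1} \<inter> {2..<k} = {2..b + 1}" using False by auto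
    moreover have "(if odd k then b else 1 + b) mod 2 = (d + 1) mod 2"
      using d by presburger
    moreover have "nat ((int (k - b) - 1) mod 2) = (d + 1) mod 2"
    proof -
      have "int (k - b) - 1 = int (d + 1)" using d by simp
      then show ?thesis by (metis nat_int zmod_int of_nat_numeral)
    qed
    ultimately show ?thesis
      using False by (auto simp: wt_def residue_def hook_node_def split: if_splits)
  qed
  then show ?thesis
    by (simp add: seq_def hook_seq_def del: upt_Suc)
qed

lemma stable_one:
  fixes K :: "'f::field klr_free set"
  assumes "n > 0" "stable n n K" "1 \<in> K"
  shows "klr_carrier n \<subseteq> K"
proof
  have sub: "fa.subspace K" using assms(2) by (simp add: stable_def)
  have cl: "gen g * x \<in> K" if "g \<in> klr_gens n" "x \<in> K" for g x
  proof -
    have "level_gens n n = klr_gens n" by (simp add: level_gens_def klr_gens_def)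
    then show ?thesis using that assms(2) by (simp add: stable_def)
  qed
  have word: "Poly_Mapping.single (Word xs) 1 \<in> K" if "set xs \<subseteq> klr_gens n" for xs
    using that
  proof (induction xs)
    case Nil
    then show ?case using assms(3) by (simp add: zero_free_monoid_def[symmetric])
  next
    case (Cons g xs)
    have "gen g * Poly_Mapping.single (Word xs) 1 = Poly_Mapping.single (Word (g # xs)) (1 :: 'f)"
      by (simp add: gen_def mult_single plus_free_monoid_def)
    then show ?case using cl[of g] Cons by (metis insert_subset list.simps(15))
  qed
  fix p :: "'f klr_free" assume "p \<in> klr_carrier n"
  then show "p \<in> K"
  proof (induction p rule: free_algebra_induct)
    case zero
    show ?case by (rule fa.subspace_0[OF sub])
  next
    case (add p w c)
    have "Poly_Mapping.keys (Poly_Mapping.single w c + p) = insert w (Poly_Mapping.keys p)"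
      using add(1,2) by (auto simp: in_keys_iff lookup_add lookup_single when_def split: if_splits)
    then have "p \<in> klr_carrier n" "set (letters w) \<subseteq> klr_gens n"
      using add(4) by (auto simp: free_algebra_def)
    then have "p \<in> K" "Poly_Mapping.single w 1 \<in> K"
      using add(3) word[of "letters w"] by auto
    moreover have "Poly_Mapping.single w c = Poly_Mapping.single 0 c * Poly_Mapping.single w 1"
      by (simp add: mult_single)
    ultimately show ?case
      using fa.subspace_add[OF sub] fa.subspace_scale[OF sub] by metis
  qed
qed

text \<open>The elements that annihilate all functions form a two-sided ideal containing the
  relations.\<close>

lemma rep_ideal:
  fixes p :: "'f::field klr_free"
  assumes "n > 0" "p \<in> klr_ideal n"
  shows "rep n p v = 0"
proof -
  define Z :: "'f klr_free set" where "Z = {p \<in> klr_carrier n. \<forall>v. rep n p v = 0}"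
  let ?A = "klr_free_algebra n :: 'f klr_free ring"
  interpret A: ring ?A by (rule ring_free_algebra)
  have neg: "- x \<in> carrier ?A" if "x \<in> carrier ?A" for x
    using that by (simp add: free_algebra_def)
  have inv: "inv\<^bsub>add_monoid ?A\<^esub> x = - x" if "x \<in> carrier ?A" for x
    unfolding a_inv_def[symmetric]
    by (rule A.minus_equality) (use that neg in \<open>auto simp: free_algebra_simps\<close>)
  have "ideal Z ?A"
  proof (rule idealI)
    show "ring ?A" by (rule ring_free_algebra)
    show "subgroup Z (add_monoid ?A)"
    proof (rule subgroup.intro)
      show "inv\<^bsub>add_monoid ?A\<^esub> x \<in> Z" if "x \<in> Z" for x
      proof -
        have "x \<in> carrier ?A" using that by (simp add: Z_def)
        then show ?thesis using that neg unfolding inv[OF \<open>x \<in> carrier ?A\<close>] by (simp add: Z_def rep_uminus)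
      qed
    qed (auto simp: Z_def free_algebra_simps rep_add
        intro: free_algebra_add_closed fa.subspace_0[OF subspace_free_algebra])
  qed (auto simp: Z_def free_algebra_simps rep_mult intro: free_algebra_mult_closed)
  moreover have "{l - r | l r. klr_rel n l r} \<subseteq> Z"
  proof clarify
    fix l r :: "'f klr_free" assume "klr_rel n l r"
    then show "l - r \<in> Z"
      using klr_rel_closed[OF _ assms(1), of l r] rep_klr_rel[OF _ assms(1), of l r]
      by (simp add: Z_def rep_diff free_algebra_diff_closed)
  qed
  ultimately have "klr_ideal n \<subseteq> Z"
    unfolding klr_ideal_def by (rule A.genideal_minimal)
  then show ?thesis using assms(2) by (auto simp: Z_def)
qed

section \<open>The Specht module and the functions of degree \<open>b\<close>\<close>

locale specht_presentation =
  fixes a b n :: nat and field_type :: "'f::field itself"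
  assumes a: "a \<ge> 1" and b: "b \<ge> 1" and n_eq: "n = a + b"
begin

lemma n_gt: "n > 0" "n > 1"
  using a b n_eq by auto

abbreviation "H \<equiv> hecke n :: 'f klr_free set ring"
abbreviation "toH \<equiv> to_hecke n :: 'f klr_free \<Rightarrow> 'f klr_free set"
abbreviation "C \<equiv> klr_carrier n :: 'f klr_free set"
abbreviation "S \<equiv> specht a b :: ('f klr_free set, 'f klr_free set set) module"
abbreviation "z0 \<equiv> delta {2..b + 1} :: nat set \<Rightarrow> 'f"

lemma toH_hom: "toH \<in> ring_hom (klr_free_algebra n) H"
proof -
  have "toH = (+>\<^bsub>klr_free_algebra n\<^esub>) (klr_ideal n)"
    by (rule ext) (simp add: to_hecke_def)
  then show ?thesis
    unfolding hecke_def by (simp only: ideal.rcos_ring_hom[OF ideal_klr_ideal[OF n_gt(1)]])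
qed

lemma toH_mult: "p \<in> C \<Longrightarrow> q \<in> C \<Longrightarrow> toH (p * q) = toH p \<otimes>\<^bsub>H\<^esub> toH q"
  and toH_add: "p \<in> C \<Longrightarrow> q \<in> C \<Longrightarrow> toH (p + q) = toH p \<oplus>\<^bsub>H\<^esub> toH q"
  and toH_closed: "p \<in> C \<Longrightarrow> toH p \<in> carrier H"
  using ring_hom_mult[OF toH_hom] ring_hom_add[OF toH_hom] ring_hom_closed[OF toH_hom]
  by (simp_all add: free_algebra_simps)

lemma carrier_H: "carrier H = toH ` C"
  by (auto simp: hecke_def FactRing_def A_RCOSETS_def RCOSETS_def a_r_coset_def to_hecke_def)

lemma toH_eqD: "p \<in> C \<Longrightarrow> toH p = toH q \<Longrightarrow> p - q \<in> klr_ideal n"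
proof -
  assume p: "p \<in> C" and eq: "toH p = toH q"
  interpret ideal "klr_ideal n" "klr_free_algebra n :: 'f klr_free ring" by (rule ideal_klr_ideal[OF n_gt(1)])
  have "p \<in> toH p" unfolding to_hecke_def by (rule a_rcos_self[OF p])
  then have "p \<in> toH q" using eq by simp
  then obtain h where "h \<in> klr_ideal n" "p = h + q"
    unfolding to_hecke_def a_r_coset_def' by (auto simp: free_algebra_simps)
  then show ?thesis by simp
qed

sublocale P: cyclic_presentation H "toH ` specht_rels a b"
proof (rule cyclic_presentation.intro)
  show "ring H" by (rule ring_hecke[OF n_gt(1)])
  show "toH ` specht_rels a b \<subseteq> carrier H"
    using specht_rels_carrier[OF a, of b] toH_closed unfolding n_eq by blast
qed

lemma S_eq: "S = cyclic_module H (toH ` specht_rels a b)"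
  by (simp add: specht_def n_eq)

text \<open>The preimage of the relations in the free algebra. The Specht module is \<open>C\<close>
  modulo \<open>kern\<close>, one quotient in place of two nested ones, and \<open>kern\<close> is a
  stable subspace in the sense of the recursion.\<close>

definition kern :: "'f klr_free set" where
  "kern = {p \<in> C. toH p \<in> P.N}"

lemma toH_ideal: "p \<in> klr_ideal n \<Longrightarrow> toH p = zero H"
proof -
  assume p: "p \<in> klr_ideal n"
  interpret ideal "klr_ideal n" "klr_free_algebra n :: 'f klr_free ring" by (rule ideal_klr_ideal[OF n_gt(1)])
  show ?thesis using a_rcos_const[OF p] by (simp add: to_hecke_def hecke_def FactRing_def)
qed

lemma kern_mult: "p \<in> C \<Longrightarrow> x \<in> kern \<Longrightarrow> p * x \<in> kern"
  using P.sub.smult_closed[of "toH p" "toH x"]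
  by (auto simp: kern_def toH_mult toH_closed regular_module_simps free_algebra_mult_closed)

lemma subspace_kern: "fa.subspace kern"
proof (rule fa.subspaceI)
  have "zero H \<in> P.N" using P.sub.one_closed by (simp add: regular_module_simps)
  moreover have "toH 0 = zero H"
    by (rule toH_ideal) (rule fa.subspace_0[OF subspace_klr_ideal[OF n_gt(1)]])
  ultimately show "0 \<in> kern"
    by (simp add: kern_def fa.subspace_0[OF subspace_free_algebra])
  show "x + y \<in> kern" if "x \<in> kern" "y \<in> kern" for x y
    using that P.sub.m_closed[of "toH x" "toH y"]
    by (auto simp: kern_def toH_add regular_module_simps free_algebra_add_closed)
  show "Poly_Mapping.single 0 c * x \<in> kern" if "x \<in> kern" for c x
    by (rule kern_mult[OF scalar_closed that])
qed

lemma stable_kern: "stable n n kern"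
  unfolding stable_def
proof (intro conjI ballI subspace_kern)
  have "zero H \<in> P.N" using P.sub.one_closed by (simp add: regular_module_simps)
  then show "klr_ideal n \<subseteq> kern"
    using klr_ideal_subset[OF n_gt(1)] by (auto simp: kern_def toH_ideal)
  show "kern \<subseteq> C" by (auto simp: kern_def)
  show "gen g * x \<in> kern" if "g \<in> level_gens n n" "x \<in> kern" for g x
    using that by (intro kern_mult level_gens_closed) auto
qed

lemma rels_kern: "specht_rels a b \<subseteq> kern"
  using P.S_N specht_rels_carrier[OF a, of b] unfolding kern_def n_eq[symmetric] by blast

lemma specht_vector_one: "specht_vector n n kern b 1"
proof (intro specht_vector.intro klr_level.intro specht_vector_axioms.intro stable_kern n_gt(1) order_refl)
  interpret klr_level n n kern
    by (intro klr_level.intro stable_kern n_gt(1) order_refl)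
  have "hook_seq a b \<in> res_seqs n" unfolding seq_hook[symmetric] n_eq by (rule seq_in_res_seqs)
  moreover have "egen (hook_seq a b) - 1 \<in> kern"
    using rels_kern specht_rels.e[of "hook_seq a b" a b] calculation by (auto simp: n_eq)
  ultimately show "weighted 1"
    by (auto simp: weighted_def one_in_free_algebra)
  show "ygen j * 1 \<in> kern" if "1 \<le> j" "j \<le> n" for j
    using rels_kern specht_rels.y[of j a b] that by (auto simp: n_eq)
  show "psigen j * 1 \<in> kern" if "1 \<le> j" "j < n" "j \<noteq> b + 1" for j
    using rels_kern specht_rels.psi[of j a b] that by (auto simp: n_eq)
qed

text \<open>The recursion at \<open>k = n\<close>, applied to the generator: a stable subspace
  containing 1 is everything.\<close>

lemma kern_bound:
  obtains B where "finite B" "B \<subseteq> C" "card B \<le> (n - 1) choose b"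
    "\<forall>p\<in>C. \<exists>u\<in>kern. p - u \<in> fa.span B"
proof -
  have "C \<subseteq> orbit n n (insert 1 kern)"
    using subset_orbit[of "insert 1 kern" n n] stable_kern
    by (intro stable_one stable_orbit n_gt(1)) (auto simp: stable_def one_in_free_algebra)
  moreover have "b + 1 \<le> n" using a n_eq by simp
  then obtain B where "finite B" "B \<subseteq> C" "card B \<le> (n - 1) choose b"
      "\<forall>x\<in>orbit n n (insert 1 kern). \<exists>u\<in>kern. x - u \<in> fa.span B"
    using specht_vector_bound[OF n_gt(2) specht_vector_one] by blast
  ultimately show thesis using that[of B] by blast
qed

end

lemma (in left_module) submodule_if_closed:
  assumes "X \<subseteq> carrier M" "\<zero>\<^bsub>M\<^esub> \<in> X" "\<And>x y. x \<in> X \<Longrightarrow> y \<in> X \<Longrightarrow> x \<oplus>\<^bsub>M\<^esub> y \<in> X"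
    and "\<And>r x. r \<in> carrier R \<Longrightarrow> x \<in> X \<Longrightarrow> r \<odot>\<^bsub>M\<^esub> x \<in> X"
  shows "submodule X R M"
proof (intro submodule.intro subgroup.intro submodule_axioms.intro)
  fix x assume x: "x \<in> X"
  then have xM: "x \<in> carrier M" using assms(1) by blast
  have "\<zero>\<^bsub>R\<^esub> \<odot>\<^bsub>M\<^esub> x \<oplus>\<^bsub>M\<^esub> \<zero>\<^bsub>R\<^esub> \<odot>\<^bsub>M\<^esub> x = \<zero>\<^bsub>R\<^esub> \<odot>\<^bsub>M\<^esub> x"
    using smult_l_distr[of "\<zero>\<^bsub>R\<^esub>" "\<zero>\<^bsub>R\<^esub>" x] xM by simp
  then have zero: "\<zero>\<^bsub>R\<^esub> \<odot>\<^bsub>M\<^esub> x = \<zero>\<^bsub>M\<^esub>"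
    using smult_closed[OF R.zero_closed xM] by (simp add: M.add.l_cancel_one')
  have "\<ominus>\<^bsub>M\<^esub> x = (\<ominus>\<^bsub>R\<^esub> \<one>\<^bsub>R\<^esub>) \<odot>\<^bsub>M\<^esub> x"
  proof (rule M.minus_equality[OF _ xM])
    show "(\<ominus>\<^bsub>R\<^esub> \<one>\<^bsub>R\<^esub>) \<odot>\<^bsub>M\<^esub> x \<oplus>\<^bsub>M\<^esub> x = \<zero>\<^bsub>M\<^esub>"
      using smult_l_distr[of "\<ominus>\<^bsub>R\<^esub> \<one>\<^bsub>R\<^esub>" "\<one>\<^bsub>R\<^esub>" x] xM by (simp add: smult_one R.l_neg zero)
  qed (simp add: smult_closed xM)
  then show "inv\<^bsub>add_monoid M\<^esub> x \<in> X"
    using assms(4)[OF _ x, of "\<ominus>\<^bsub>R\<^esub> \<one>\<^bsub>R\<^esub>"] by (simp add: a_inv_def)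
qed (use assms in auto)

context specht_presentation
begin

abbreviation "W \<equiv> fock n b :: (nat set \<Rightarrow> 'f) set"

definition ev :: "'f klr_free \<Rightarrow> nat set \<Rightarrow> 'f" where
  "ev p = rep n p z0"

lemma ev_simps: "ev (p + q) = ev p + ev q" "ev (p - q) = ev p - ev q" "ev 0 = 0"
  "ev (p * q) = rep n p (ev q)" "ev 1 = z0" "ev (Poly_Mapping.single 0 c * p) = (\<lambda>J. c * ev p J)"
  by (simp_all add: ev_def rep_add rep_diff rep_mult rep_scalar)

lemma ev_sum: "ev (\<Sum>i\<in>I. f i) = (\<Sum>i\<in>I. ev (f i))"
  by (simp add: ev_def rep_sum)

lemma z0_fock: "z0 \<in> W"
  by (rule delta_fock) (use a n_eq in auto)

lemma ev_fock: "p \<in> C \<Longrightarrow> ev p \<in> W"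
  unfolding ev_def by (rule rep_fock[OF _ z0_fock])

lemma act_y_z0: "1 \<le> k \<Longrightarrow> act_y k z0 = 0"
proof -
  assume k: "1 \<le> k"
  have "hop (k + 1) k z0 = 0" if "even k"
    using k that by (intro hop_delta_zero) auto
  moreover have "hop k (k - 1) z0 = 0" if "odd k" "k \<noteq> 1"
    using k that by (intro hop_delta_zero) (auto elim!: oddE)
  ultimately show ?thesis by (auto simp: fun_eq_iff act_y_def)
qed

lemma act_psi_z0: "1 \<le> j \<Longrightarrow> j \<noteq> b + 1 \<Longrightarrow> act_psi j z0 = 0"
proof -
  assume j: "1 \<le> j" "j \<noteq> b + 1"
  have "hop j (j + 1) z0 = 0"
    using j by (intro hop_delta_zero) auto
  moreover have "hop (j + 2) (j - 1) z0 = 0" if "odd j" "j \<noteq> 1"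
    using j that by (intro hop_delta_zero) (auto elim!: oddE)
  ultimately show ?thesis by (auto simp: fun_eq_iff act_psi_def)
qed

lemma ev_rels: "x \<in> specht_rels a b \<Longrightarrow> ev x = 0"
proof (induction rule: specht_rels.induct)
  case (y k)
  then show ?case unfolding ev_def rep_gen act.simps by (intro act_y_z0) simp
next
  case (e i)
  have "act_e n i z0 = (if i = hook_seq a b then z0 else 0)"
    using seq_hook[of a b] by (auto simp: fun_eq_iff act_e_def delta_def n_eq)
  then have "ev (egen i) = (if i = hook_seq a b then z0 else 0)"
    by (simp only: ev_def rep_gen act.simps)
  then show ?case
    by (cases "i = hook_seq a b") (simp_all only: ev_simps if_True if_False simp_thms diff_self diff_zero)
next
  case (psi j)
  then show ?case unfolding ev_def rep_gen act.simps by (intro act_psi_z0) simp_all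
next
  case psi_prod
  \<comment> \<open>The leftmost factor of the product is \<open>psi_1\<close>, which acts as
    zero.\<close>
  have "[1..<b + 2] = 1 # [2..<b + 2]" by (simp add: upt_rec numeral_2_eq_2)
  moreover have "act_psi 1 v = 0" for v :: "nat set \<Rightarrow> 'f"
    by (simp add: fun_eq_iff act_psi_def)
  ultimately show ?case by (simp only: list.map prod_list.Cons ev_simps(4) rep_gen act.simps)
qed

text \<open>The image in \<open>H\<close> of the annihilator of \<open>z0\<close> is a left ideal
  that contains the relations, hence contains \<open>P.N\<close>. Changing the representative costs
  an element of the ideal, which acts as zero.\<close>

lemma ev_kern: "p \<in> kern \<Longrightarrow> ev p = 0"
proof -
  assume p: "p \<in> kern"
  define X where "X = toH ` {p \<in> C. ev p = 0}"
  have "submodule X H (regular_module H)"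
  proof (rule P.Reg.submodule_if_closed)
    show "X \<subseteq> carrier (regular_module H)" by (auto simp: X_def regular_module_simps toH_closed)
    have "toH 0 = zero H"
      by (rule toH_ideal) (rule fa.subspace_0[OF subspace_klr_ideal[OF n_gt(1)]])
    then show "zero (regular_module H) \<in> X"
      using fa.subspace_0[OF subspace_free_algebra]
      by (auto simp: X_def regular_module_simps ev_simps intro!: image_eqI[of _ _ 0])
    show "x \<oplus>\<^bsub>regular_module H\<^esub> y \<in> X" if "x \<in> X" "y \<in> X" for x y
    proof -
      obtain p q where "p \<in> C" "q \<in> C" "ev p = 0" "ev q = 0" "x = toH p" "y = toH q"
        using \<open>x \<in> X\<close> \<open>y \<in> X\<close> by (auto simp: X_def)
      then show ?thesis
        by (auto simp: X_def regular_module_simps toH_add[symmetric] ev_simps intro!: imageI free_algebra_add_closed)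
    qed
    show "r \<odot>\<^bsub>regular_module H\<^esub> x \<in> X" if "r \<in> carrier H" "x \<in> X" for r x
    proof -
      obtain p q where "p \<in> C" "q \<in> C" "ev q = 0" "r = toH p" "x = toH q"
        using \<open>x \<in> X\<close> \<open>r \<in> carrier H\<close> by (auto simp: X_def carrier_H)
      then show ?thesis
        by (auto simp: X_def regular_module_simps toH_mult[symmetric] ev_simps intro!: imageI free_algebra_mult_closed)
    qed
  qed
  moreover have "toH ` specht_rels a b \<subseteq> X"
    using ev_rels specht_rels_carrier[OF a, of b] unfolding X_def n_eq[symmetric] by blast
  ultimately have "P.N \<subseteq> X" by (rule P.N_minimal)
  then obtain q where q: "q \<in> C" "ev q = 0" "toH p = toH q"
    using p by (auto simp: kern_def X_def)
  have "p - q \<in> klr_ideal n" by (rule toH_eqD[OF _ q(3)]) (use p in \<open>simp add: kern_def\<close>)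
  then have "ev (p - q) = 0" unfolding ev_def by (rule rep_ideal[OF n_gt(1)])
  then show ?thesis using q by (simp add: ev_simps)
qed

lemma ev_surj: "W = ev ` C"
proof
  show "ev ` C \<subseteq> W" using ev_fock by blast
  have sub: "fv.subspace (ev ` C)"
  proof (rule fv.subspaceI)
    show "0 \<in> ev ` C" using fa.subspace_0[OF subspace_free_algebra] ev_simps(3) by (metis imageI)
    show "x + y \<in> ev ` C" if "x \<in> ev ` C" "y \<in> ev ` C" for x y
    proof -
      obtain p q where "p \<in> C" "q \<in> C" "x = ev p" "y = ev q" using \<open>x \<in> _\<close> \<open>y \<in> _\<close> by blast
      then have "x + y = ev (p + q)" "p + q \<in> C" by (simp_all only: ev_simps free_algebra_add_closed)
      then show ?thesis by blast
    qed
    show "(\<lambda>J. c * x J) \<in> ev ` C" if x: "x \<in> ev ` C" for c x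
    proof -
      obtain p where p: "p \<in> C" "x = ev p" using x by blast
      then have "(\<lambda>J. c * x J) = ev (Poly_Mapping.single 0 c * p)" by (simp only: ev_simps(6))
      moreover have "Poly_Mapping.single 0 c * p \<in> C" by (intro free_algebra_mult_closed scalar_closed p(1))
      ultimately show ?thesis by blast
    qed
  qed
  have "delta J \<in> ev ` C" if J: "J \<in> occupied n b" for J
  proof (rule delta_generated[OF sub])
    show "act_psi r v \<in> ev ` C" if r: "2 \<le> r" "r < n" and v: "v \<in> ev ` C" for r v
    proof -
      obtain p where p: "p \<in> C" "v = ev p" using v by blast
      have "psigen r * p \<in> C" using r p by (intro free_algebra_mult_closed psigen_closed) auto
      moreover have "ev (psigen r * p) = act_psi r v" by (simp add: ev_simps p)
      ultimately show ?thesis by (metis imageI)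
    qed
    show "z0 \<in> ev ` C" using one_in_free_algebra ev_simps(5) by (metis imageI)
  qed (use J in \<open>auto simp: occupied_def\<close>)
  then have "fv.span (delta ` occupied n b) \<subseteq> ev ` C"
    by (intro fv.span_minimal sub) auto
  then show "W \<subseteq> ev ` C" by (simp only: span_delta)
qed

text \<open>A set \<open>B\<close> with at most as many elements as the dimension of
  \<open>W\<close> spans \<open>C\<close> modulo \<open>kern\<close>, and its image spans
  \<open>W\<close>. So this image is a basis and \<open>ev\<close> is injective on \<open>B\<close>;
  if \<open>ev p = 0\<close>, all coefficients of \<open>p\<close> modulo \<open>kern\<close>
  vanish.\<close>

lemma ev_eq_0_iff:
  assumes "p \<in> C" shows "ev p = 0 \<longleftrightarrow> p \<in> kern"
proof
  assume p0: "ev p = 0"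
  obtain B where B: "finite B" "B \<subseteq> C" "card B \<le> (n - 1) choose b"
    "\<forall>p\<in>C. \<exists>u\<in>kern. p - u \<in> fa.span B"
    by (rule kern_bound)
  have ev_span: "ev x \<in> fv.span (ev ` B)" if "x \<in> fa.span B" for x
    using that
  proof (induction rule: fa.span_induct_alt)
    case base
    then show ?case by (simp only: ev_simps fv.span_zero)
  next
    case (step c x y)
    from fv.span_add[OF fv.span_scale[OF fv.span_base[OF imageI[OF step(1)]]] step(2)]
    show ?case by (simp only: ev_simps(1,6))
  qed
  have fock_span: "W \<subseteq> fv.span (ev ` B)"
  proof
    fix v assume "v \<in> W"
    then obtain q where q: "q \<in> C" "v = ev q" using ev_surj by auto
    obtain u where u: "u \<in> kern" "q - u \<in> fa.span B" using bspec[OF B(4) q(1)] by blast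
    from ev_span[OF u(2)] show "v \<in> fv.span (ev ` B)"
      using ev_kern[OF u(1)] q by (simp add: ev_simps)
  qed
  have B_fock: "ev ` B \<subseteq> W" using B(2) ev_fock by blast
  obtain B' where B': "B' \<subseteq> ev ` B" "fv.independent B'" "ev ` B \<subseteq> fv.span B'"
    using fv.maximal_independent_subset[of "ev ` B"] by blast
  have "fv.span B' = W"
  proof
    show "fv.span B' \<subseteq> W" using B' B_fock by (intro fv.span_minimal subspace_fock) auto
    show "W \<subseteq> fv.span B'"
      using fock_span fv.span_minimal[OF B'(3) fv.subspace_span] by blast
  qed
  moreover have "fv.span W = W" by (simp only: fv.span_eq_iff subspace_fock)
  ultimately have "fv.span B' = fv.span W" by (simp only:)
  then have "fv.dim W = card B'" by (rule fv.dim_eq_card[OF _ B'(2)])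
  then have "card B' = (n - 1) choose b" by (simp only: dim_fock)
  then have card: "card B \<le> card B'" using B(3) by simp
  have cards: "card B' \<le> card (ev ` B)" "card (ev ` B) \<le> card B"
    using B' B(1) by (auto intro: card_mono card_image_le)
  have "B' = ev ` B"
    using B'(1) B(1) card cards by (intro card_subset_eq) auto
  with B'(2) have ind: "fv.independent (ev ` B)" by simp
  have inj: "inj_on ev B"
    using B(1) card cards by (intro eq_card_imp_inj_on) auto
  obtain u where u: "u \<in> kern" "p - u \<in> fa.span B" using bspec[OF B(4) assms] by blast
  then obtain c where c: "p - u = (\<Sum>x\<in>B. Poly_Mapping.single 0 (c x) * x)"
    unfolding fa.span_finite[OF B(1)] by blast
  define d where "d = (\<lambda>w. c (the_inv_into B ev w))"
  have "0 = ev (p - u)" using p0 ev_kern[OF u(1)] by (simp add: ev_simps)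
  also have "\<dots> = (\<Sum>x\<in>B. (\<lambda>J. c x * ev x J))" by (simp only: c ev_sum ev_simps(6))
  also have "\<dots> = (\<Sum>x\<in>B. (\<lambda>J. d (ev x) * ev x J))"
    by (rule sum.cong[OF refl]) (simp add: d_def the_inv_into_f_f[OF inj])
  also have "\<dots> = (\<Sum>w\<in>ev ` B. (\<lambda>J. d w * w J))"
    by (simp only: sum.reindex[OF inj] o_def)
  finally have "(\<Sum>w\<in>ev ` B. (\<lambda>J. d w * w J)) = 0" by (rule sym)
  then have "d w = 0" if "w \<in> ev ` B" for w
    using fv.independentD[OF ind _ subset_refl _ that] B(1) by blast
  then have "c x = 0" if "x \<in> B" for x
    using that by (force simp: d_def the_inv_into_f_f[OF inj])
  then have "p - u = 0" by (simp add: c)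
  with u(1) show "p \<in> kern" by simp
qed (rule ev_kern)

section \<open>Transport of submodules and decompositions to functions\<close>

lemma carrier_S: "carrier S = (\<lambda>p. P.cl (toH p)) ` C"
  by (auto simp: S_eq P.carrier_cyclic carrier_H)

text \<open>The choice of representative is immaterial by \<open>cl_toH_eq_iff\<close>.\<close>

definition to_fock :: "'f klr_free set set \<Rightarrow> nat set \<Rightarrow> 'f" where
  "to_fock X = ev (SOME p. p \<in> C \<and> P.cl (toH p) = X)"

sublocale SM: left_module H S
  unfolding n_eq using a by (intro left_module_specht) simp

lemma S_add: "p \<in> C \<Longrightarrow> q \<in> C \<Longrightarrow> P.cl (toH p) \<oplus>\<^bsub>S\<^esub> P.cl (toH q) = P.cl (toH (p + q))"
  by (simp add: S_eq P.cl_add toH_closed toH_add)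

lemma S_smult: "p \<in> C \<Longrightarrow> q \<in> C \<Longrightarrow> toH p \<odot>\<^bsub>S\<^esub> P.cl (toH q) = P.cl (toH (p * q))"
  by (simp add: S_eq P.cl_smult toH_closed toH_mult)

lemma S_zero_iff: "p \<in> C \<Longrightarrow> P.cl (toH p) = zero S \<longleftrightarrow> ev p = 0"
  by (simp add: S_eq P.zero_cyclic P.cl_eq_iff toH_closed ev_eq_0_iff kern_def)

lemma cl_toH_eq_iff:
  assumes "p \<in> C" "q \<in> C"
  shows "P.cl (toH p) = P.cl (toH q) \<longleftrightarrow> ev p = ev q"
proof -
  have pq: "p - q \<in> C" by (rule free_algebra_diff_closed[OF assms])
  have carr: "P.cl (toH x) \<in> carrier S" if "x \<in> C" for x
    using that by (auto simp: carrier_S)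
  have "P.cl (toH (p - q)) \<oplus>\<^bsub>S\<^esub> P.cl (toH q) = P.cl (toH p)"
    using S_add[OF pq assms(2)] by simp
  then have "P.cl (toH p) = P.cl (toH q) \<longleftrightarrow> P.cl (toH (p - q)) = zero S"
    using carr[OF pq] carr[OF assms(2)] SM.M.add.l_cancel_one' SM.M.add.r_cancel_one' by metis
  also have "\<dots> \<longleftrightarrow> ev p = ev q"
    using S_zero_iff[OF pq] by (simp add: ev_simps)
  finally show ?thesis .
qed

lemma to_fock_cl: "p \<in> C \<Longrightarrow> to_fock (P.cl (toH p)) = ev p"
proof -
  assume p: "p \<in> C"
  let ?q = "SOME q. q \<in> C \<and> P.cl (toH q) = P.cl (toH p)"
  have "?q \<in> C \<and> P.cl (toH ?q) = P.cl (toH p)" by (rule someI[of _ p]) (use p in simp)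
  then show ?thesis using cl_toH_eq_iff p by (auto simp: to_fock_def)
qed

lemma to_fock_bij: "bij_betw to_fock (carrier S) W"
  unfolding bij_betw_def carrier_S ev_surj
  by (auto simp: inj_on_def to_fock_cl cl_toH_eq_iff image_image)

lemma to_fock_add: "X \<in> carrier S \<Longrightarrow> X' \<in> carrier S \<Longrightarrow> to_fock (X \<oplus>\<^bsub>S\<^esub> X') = to_fock X + to_fock X'"
  by (auto simp: carrier_S S_add to_fock_cl free_algebra_add_closed ev_simps(1))

lemma to_fock_smult: "p \<in> C \<Longrightarrow> X \<in> carrier S \<Longrightarrow> to_fock (toH p \<odot>\<^bsub>S\<^esub> X) = rep n p (to_fock X)"
  by (auto simp: carrier_S S_smult to_fock_cl free_algebra_mult_closed ev_simps(4))

lemma to_fock_zero: "to_fock (zero S) = 0"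
proof -
  have "0 \<in> C" by (rule fa.subspace_0[OF subspace_free_algebra])
  then show ?thesis using to_fock_cl[of 0] S_zero_iff[of 0] by (simp add: ev_simps)
qed

lemma to_fock_inj: "X \<in> carrier S \<Longrightarrow> X' \<in> carrier S \<Longrightarrow> to_fock X = to_fock X' \<Longrightarrow> X = X'"
  using to_fock_bij by (auto simp: bij_betw_def inj_on_def)

text \<open>Scalars belong to \<open>C\<close>, so such sets are linear subspaces (see
  \<open>invariantD\<close>).\<close>

definition invariant :: "(nat set \<Rightarrow> 'f) set \<Rightarrow> bool" where
  "invariant A \<longleftrightarrow> A \<subseteq> W \<and> 0 \<in> A \<and> (\<forall>u\<in>A. \<forall>v\<in>A. u + v \<in> A) \<and> (\<forall>p\<in>C. \<forall>v\<in>A. rep n p v \<in> A)"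

lemma invariant_to_fock:
  assumes "submodule A H S" shows "invariant (to_fock ` A)"
proof -
  interpret A: submodule A H S by (rule assms)
  have A: "A \<subseteq> carrier S" using A.subset by simp
  then have "to_fock ` A \<subseteq> W" using to_fock_bij by (auto simp: bij_betw_def)
  moreover have "0 \<in> to_fock ` A" using A.one_closed to_fock_zero by (metis imageI monoid.simps(2))
  moreover have "to_fock X + to_fock X' \<in> to_fock ` A" if "X \<in> A" "X' \<in> A" for X X'
  proof -
    have "X \<oplus>\<^bsub>S\<^esub> X' \<in> A" "X \<in> carrier S" "X' \<in> carrier S" using that A A.m_closed[of X X'] by auto
    then show ?thesis using to_fock_add[of X X'] by (metis imageI)
  qed
  moreover have "rep n p (to_fock X) \<in> to_fock ` A" if "p \<in> C" "X \<in> A" for p X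
  proof -
    have "toH p \<odot>\<^bsub>S\<^esub> X \<in> A" "X \<in> carrier S" using that A A.smult_closed[of "toH p" X] toH_closed by auto
    then show ?thesis using to_fock_smult[of p X] that by (metis imageI)
  qed
  ultimately show ?thesis by (auto simp: invariant_def)
qed

lemma submodule_preimage:
  assumes "invariant A" shows "submodule {X \<in> carrier S. to_fock X \<in> A} H S"
proof (rule SM.submodule_if_closed)
  fix r X assume "r \<in> carrier H" and X: "X \<in> {X \<in> carrier S. to_fock X \<in> A}"
  then obtain p where p: "p \<in> C" "r = toH p" by (auto simp: carrier_H)
  then show "r \<odot>\<^bsub>S\<^esub> X \<in> {X \<in> carrier S. to_fock X \<in> A}"
    using X assms by (auto simp: to_fock_smult invariant_def intro!: SM.smult_closed toH_closed)
qed (use assms in \<open>auto simp: to_fock_zero to_fock_add invariant_def\<close>)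

lemma indecomposable_iff:
  "indecomposable H S \<longleftrightarrow>
    (\<forall>A B. invariant A \<longrightarrow> invariant B \<longrightarrow> (\<forall>w\<in>W. \<exists>u\<in>A. \<exists>v\<in>B. w = u + v) \<longrightarrow> A \<inter> B = {0}
      \<longrightarrow> A = {0} \<or> B = {0})" (is "_ \<longleftrightarrow> ?R")
proof
  assume ind: "indecomposable H S"
  show ?R
  proof (intro allI impI)
    fix A B assume A: "invariant A" and B: "invariant B" and sum: "\<forall>w\<in>W. \<exists>u\<in>A. \<exists>v\<in>B. w = u + v"
      and int: "A \<inter> B = {0}"
    define A' where "A' = {X \<in> carrier S. to_fock X \<in> A}"
    define B' where "B' = {X \<in> carrier S. to_fock X \<in> B}"
    have surj: "\<exists>X\<in>carrier S. to_fock X = w" if "w \<in> W" for w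
    proof -
      have "w \<in> to_fock ` carrier S" using that to_fock_bij by (simp add: bij_betw_def)
      then show ?thesis by blast
    qed
    have "A' <+>\<^bsub>S\<^esub> B' = carrier S"
    proof
      show "A' <+>\<^bsub>S\<^esub> B' \<subseteq> carrier S" by (auto simp: A'_def B'_def set_add_def')
      show "carrier S \<subseteq> A' <+>\<^bsub>S\<^esub> B'"
      proof
        fix X assume X: "X \<in> carrier S"
        then have "to_fock X \<in> W" using to_fock_bij by (auto simp: bij_betw_def)
        then obtain u v where uv: "u \<in> A" "v \<in> B" "to_fock X = u + v" using sum by blast
        have "u \<in> W" "v \<in> W" using uv A B by (auto simp only: invariant_def)
        obtain X' where X': "X' \<in> carrier S" "to_fock X' = u" using surj[OF \<open>u \<in> W\<close>] by blast
        obtain Z where Z: "Z \<in> carrier S" "to_fock Z = v" using surj[OF \<open>v \<in> W\<close>] by blast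
        have "to_fock (X' \<oplus>\<^bsub>S\<^esub> Z) = to_fock X" by (simp only: to_fock_add[OF X'(1) Z(1)] X' Z uv)
        then have "X = X' \<oplus>\<^bsub>S\<^esub> Z" using X X' Z by (intro to_fock_inj) auto
        then show "X \<in> A' <+>\<^bsub>S\<^esub> B'" using X' Z uv by (auto simp: A'_def B'_def set_add_def')
      qed
    qed
    moreover have "A' \<inter> B' = {zero S}"
    proof -
      have "X = zero S" if "X \<in> A' \<inter> B'" for X
      proof -
        have "to_fock X \<in> A \<inter> B" "X \<in> carrier S" using that by (auto simp: A'_def B'_def)
        then show ?thesis using int to_fock_zero by (intro to_fock_inj) auto
      qed
      moreover have "zero S \<in> A' \<inter> B'" using A B by (auto simp: A'_def B'_def to_fock_zero invariant_def)
      ultimately show ?thesis by blast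
    qed
    ultimately have "A' = {zero S} \<or> B' = {zero S}"
      using ind submodule_preimage[OF A] submodule_preimage[OF B] unfolding indecomposable_def A'_def B'_def by blast
    moreover have "A = to_fock ` A'" "B = to_fock ` B'"
      using A B surj unfolding A'_def B'_def invariant_def by (blast, blast)
    ultimately show "A = {0} \<or> B = {0}" by (auto simp: to_fock_zero)
  qed
next
  assume R: ?R
  have "z0 \<noteq> 0"
  proof
    assume "z0 = 0"
    from fun_cong[OF this, of "{2..b + 1}"] show False by (simp add: delta_def)
  qed
  moreover have "P.cl (toH 1) \<in> carrier S" by (auto simp: carrier_S one_in_free_algebra)
  moreover have "to_fock (P.cl (toH 1)) = z0" by (simp add: to_fock_cl one_in_free_algebra ev_simps)
  ultimately have "carrier S \<noteq> {zero S}" using to_fock_zero by auto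
  moreover have "A = {zero S} \<or> B = {zero S}"
    if A: "submodule A H S" and B: "submodule B H S" and sum: "A <+>\<^bsub>S\<^esub> B = carrier S" and int: "A \<inter> B = {zero S}" for A B
  proof -
    interpret A: submodule A H S by (rule A)
    interpret B: submodule B H S by (rule B)
    have AB: "A \<subseteq> carrier S" "B \<subseteq> carrier S" using A.subset B.subset by simp_all
    have "\<exists>u\<in>to_fock ` A. \<exists>v\<in>to_fock ` B. w = u + v" if w: "w \<in> W" for w
    proof -
      obtain X where X: "X \<in> carrier S" "w = to_fock X" using w to_fock_bij by (auto simp: bij_betw_def)
      then have "X \<in> A <+>\<^bsub>S\<^esub> B" using sum by simp
      then obtain X' Z where "X' \<in> A" "Z \<in> B" "X = X' \<oplus>\<^bsub>S\<^esub> Z" by (auto simp: set_add_def')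
      moreover have "to_fock (X' \<oplus>\<^bsub>S\<^esub> Z) = to_fock X' + to_fock Z"
        using calculation AB by (intro to_fock_add) auto
      ultimately show ?thesis using X by blast
    qed
    moreover have "to_fock ` A \<inter> to_fock ` B = {0}"
    proof -
      have "to_fock ` A \<inter> to_fock ` B = to_fock ` (A \<inter> B)"
        using inj_on_image_Int[of to_fock "carrier S" A B] AB to_fock_bij by (simp add: bij_betw_def)
      then show ?thesis by (simp add: int to_fock_zero)
    qed
    ultimately have "to_fock ` A = {0} \<or> to_fock ` B = {0}"
      using R invariant_to_fock[OF A] invariant_to_fock[OF B] by blast
    moreover have "D = {zero S}" if D: "to_fock ` D = {0}" "D \<subseteq> carrier S" for D
    proof -
      have "X = zero S" if "X \<in> D" for X
        using that D to_fock_zero by (intro to_fock_inj) auto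
      then show ?thesis using D(1) by blast
    qed
    ultimately show ?thesis using AB by blast
  qed
  ultimately show "indecomposable H S" unfolding indecomposable_def by blast
qed

end

section \<open>The action of \<open>sl\<^sub>2\<close> for odd \<open>n\<close>\<close>

text \<open>Exterior multiplication by the bivector of the pair. There are no signs, since a
  bivector is even and its two places are adjacent in the order.\<close>

definition add_pair :: "nat \<Rightarrow> (nat set \<Rightarrow> 'f::field) \<Rightarrow> nat set \<Rightarrow> 'f" where
  "add_pair k v J = (if 2 * k \<in> J \<and> 2 * k + 1 \<in> J then v (put (2 * k) False (put (2 * k + 1) False J)) else 0)"

definition drop_pair :: "nat \<Rightarrow> (nat set \<Rightarrow> 'f::field) \<Rightarrow> nat set \<Rightarrow> 'f" where
  "drop_pair k v J = (if 2 * k \<notin> J \<and> 2 * k + 1 \<notin> J then v (put (2 * k) True (put (2 * k + 1) True J)) else 0)"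

definition up :: "nat \<Rightarrow> (nat set \<Rightarrow> 'f::field) \<Rightarrow> nat set \<Rightarrow> 'f" where
  "up m v J = (\<Sum>k=1..m. add_pair k v J)"

definition down :: "nat \<Rightarrow> (nat set \<Rightarrow> 'f::field) \<Rightarrow> nat set \<Rightarrow> 'f" where
  "down m v J = (\<Sum>k=1..m. drop_pair k v J)"

lemma pair_linear:
  "add_pair k (u + v) = add_pair k u + add_pair k v" "drop_pair k (u + v) = drop_pair k u + drop_pair k v"
  "add_pair k (\<lambda>J. c * v J) = (\<lambda>J. c * add_pair k v J)" "drop_pair k (\<lambda>J. c * v J) = (\<lambda>J. c * drop_pair k v J)"
  by (auto simp: fun_eq_iff add_pair_def drop_pair_def)

lemma up_down_linear:
  "up m (u + v) = up m u + up m v" "down m (u + v) = down m u + down m v"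
  "up m (\<lambda>J. c * v J) = (\<lambda>J. c * up m v J)" "down m (\<lambda>J. c * v J) = (\<lambda>J. c * down m v J)"
  by (simp_all add: fun_eq_iff up_def down_def pair_linear sum.distrib sum_distrib_left)

lemma hop_sum: "hop p q (\<lambda>J. \<Sum>k\<in>I. f k J) = (\<lambda>J. \<Sum>k\<in>I. hop p q (f k) J)"
  by (auto simp: fun_eq_iff hop_def)

lemma act_psi_sum: "act_psi r (\<lambda>J. \<Sum>k\<in>I. f k J) = (\<lambda>J. \<Sum>k\<in>I. act_psi r (f k) J)"
  by (auto simp: fun_eq_iff act_psi_def hop_sum sum_negf sum.distrib sum_distrib_left sum_subtractf)

lemma pair_hop_far:
  assumes "2 * k \<noteq> p" "2 * k + 1 \<noteq> p" "2 * k \<noteq> q" "2 * k + 1 \<noteq> q"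
  shows "add_pair k (hop p q v) = hop p q (add_pair k v)"
    and "drop_pair k (hop p q v) = hop p q (drop_pair k v)"
proof -
  have "put p True (put q False (put (2 * k) x (put (2 * k + 1) x J)))
      = put (2 * k) x (put (2 * k + 1) x (put p True (put q False J)))" for x J
    using assms by (auto simp: put_def)
  then show "add_pair k (hop p q v) = hop p q (add_pair k v)"
    "drop_pair k (hop p q v) = hop p q (drop_pair k v)"
    using assms by (simp_all add: fun_eq_iff hop_def add_pair_def drop_pair_def)
qed

lemma pair_hop_within:
  assumes "{p, q} = {2 * l, 2 * l + 1}"
  shows "add_pair k (hop p q v) = hop p q (add_pair k v)"
    and "drop_pair k (hop p q v) = hop p q (drop_pair k v)"
proof -
  have "add_pair k (hop p q v) = hop p q (add_pair k v) \<and> drop_pair k (hop p q v) = hop p q (drop_pair k v)"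
  proof (cases "k = l")
    case True
    then show ?thesis
      using assms by (auto simp: fun_eq_iff hop_def add_pair_def drop_pair_def doubleton_eq_iff)
  next
    case False
    then have "2 * k \<noteq> 2 * l + 1" "2 * k + 1 \<noteq> 2 * l" by presburger+
    with False have "2 * k \<noteq> p" "2 * k + 1 \<noteq> p" "2 * k \<noteq> q" "2 * k + 1 \<noteq> q"
      using assms by (auto simp: doubleton_eq_iff)
    then show ?thesis using pair_hop_far by blast
  qed
  then show "add_pair k (hop p q v) = hop p q (add_pair k v)"
    "drop_pair k (hop p q v) = hop p q (drop_pair k v)" by blast+
qed

lemma up_down_hop_within:
  assumes "{p, q} = {2 * l, 2 * l + 1}"
  shows "up m (hop p q v) = hop p q (up m v)" "down m (hop p q v) = hop p q (down m v)"
  unfolding up_def[abs_def] down_def[abs_def] hop_sum by (simp_all only: pair_hop_within[OF assms])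

lemma up_down_act_y:
  "up m (act_y r v) = act_y r (up m v)" "down m (act_y r v) = act_y r (down m v)"
proof -
  define q where "q = 2 * (r div 2)"
  obtain c where c: "\<And>v :: nat set \<Rightarrow> 'a. act_y r v = (\<lambda>J. c * hop (q + 1) q v J)"
    using act_y_hop[of r] unfolding q_def by blast
  have pq: "{q + 1, q} = {2 * (r div 2), 2 * (r div 2) + 1}" by (auto simp: q_def)
  show "up m (act_y r v) = act_y r (up m v)" "down m (act_y r v) = act_y r (down m v)"
    by (simp_all only: c up_down_linear up_down_hop_within[OF pq])
qed

lemma pair_act_psi_far:
  assumes "odd r" "2 * k + 1 < r - 1 \<or> r + 2 < 2 * k"
  shows "add_pair k (act_psi r v) = act_psi r (add_pair k v)"
    and "drop_pair k (act_psi r v) = act_psi r (drop_pair k v)"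
proof -
  have ne: "2 * k \<noteq> s" "2 * k + 1 \<noteq> s" if "s \<in> {r - 1, r, r + 1, r + 2}" for s
    using assms(2) that by auto
  have mem: "r \<noteq> 2 * k" "r \<noteq> Suc (2 * k)" "Suc r \<noteq> 2 * k"
    using ne[of r] ne[of "r + 1"] by auto
  have "add_pair k (hop r (r + 1) v) = hop r (r + 1) (add_pair k v)"
    "drop_pair k (hop r (r + 1) v) = hop r (r + 1) (drop_pair k v)"
    "add_pair k (hop (r + 2) (r - 1) v) = hop (r + 2) (r - 1) (add_pair k v)"
    "drop_pair k (hop (r + 2) (r - 1) v) = hop (r + 2) (r - 1) (drop_pair k v)"
    by (intro pair_hop_far ne; blast)+
  note h = this[symmetric]
  show "add_pair k (act_psi r v) = act_psi r (add_pair k v)"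
    unfolding fun_eq_iff act_psi_def h using assms(1)
    by (simp add: add_pair_def mem)
  show "drop_pair k (act_psi r v) = act_psi r (drop_pair k v)"
    unfolding fun_eq_iff act_psi_def h using assms(1)
    by (simp add: drop_pair_def mem)
qed

text \<open>Only the sum over the two pairs commutes. If both pairs are empty, adding either one and
  then applying the crossing leads to the same set, with opposite signs.\<close>

lemma pair_act_psi_near:
  assumes "j \<ge> 1"
  shows "add_pair j (act_psi (2 * j + 1) v) J + add_pair (j + 1) (act_psi (2 * j + 1) v) J
      = act_psi (2 * j + 1) (add_pair j v) J + act_psi (2 * j + 1) (add_pair (j + 1) v) J"
    and "drop_pair j (act_psi (2 * j + 1) v) J + drop_pair (j + 1) (act_psi (2 * j + 1) v) J
      = act_psi (2 * j + 1) (drop_pair j v) J + act_psi (2 * j + 1) (drop_pair (j + 1) v) J"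
proof -
  obtain a where a: "2 * j = a" "a \<noteq> 0" using assms by auto
  have e: "even a" using a by auto
  have a': "2 * (j + 1) = Suc (Suc a)" using a by simp
  show "add_pair j (act_psi (2 * j + 1) v) J + add_pair (j + 1) (act_psi (2 * j + 1) v) J
      = act_psi (2 * j + 1) (add_pair j v) J + act_psi (2 * j + 1) (add_pair (j + 1) v) J"
    unfolding add_pair_def a a' act_psi_def hop_def
    by (cases "a \<in> J"; cases "Suc a \<in> J"; cases "Suc (Suc a) \<in> J"; cases "Suc (Suc (Suc a)) \<in> J";
      simp add: a e put_twist put_idem)
  show "drop_pair j (act_psi (2 * j + 1) v) J + drop_pair (j + 1) (act_psi (2 * j + 1) v) J
      = act_psi (2 * j + 1) (drop_pair j v) J + act_psi (2 * j + 1) (drop_pair (j + 1) v) J"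
    unfolding drop_pair_def a a' act_psi_def hop_def
    by (cases "a \<in> J"; cases "Suc a \<in> J"; cases "Suc (Suc a) \<in> J"; cases "Suc (Suc (Suc a)) \<in> J";
      simp add: a e put_twist put_idem)
qed

lemma sum_split_two:
  fixes f g :: "nat \<Rightarrow> 'a::ab_group_add"
  assumes "1 \<le> j" "j + 1 \<le> m" "f j + f (j + 1) = g j + g (j + 1)"
    and "\<And>k. k \<noteq> j \<Longrightarrow> k \<noteq> j + 1 \<Longrightarrow> f k = g k"
  shows "sum f {1..m} = sum g {1..m}"
proof -
  have m: "{1..m} = {1..m} - {j, j + 1} \<union> {j, j + 1}" using assms by auto
  have "sum h {1..m} = sum h ({1..m} - {j, j + 1}) + (h j + h (j + 1))" for h :: "nat \<Rightarrow> 'a"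
    by (subst m, subst sum.union_disjoint) auto
  moreover have "sum f ({1..m} - {j, j + 1}) = sum g ({1..m} - {j, j + 1})"
    by (rule sum.cong) (use assms(4) in auto)
  ultimately show ?thesis using assms(3) by simp
qed

lemma up_down_act_psi:
  assumes "1 \<le> r" "r < 2 * m + 1"
  shows "up m (act_psi r v) = act_psi r (up m v)" "down m (act_psi r v) = act_psi r (down m v)"
proof -
  have "up m (act_psi r v) = act_psi r (up m v) \<and> down m (act_psi r v) = act_psi r (down m v)"
  proof (cases "even r")
    case True
    then have pq: "{r, r + 1} = {2 * (r div 2), 2 * (r div 2) + 1}" by auto
    have psi: "act_psi r v = (\<lambda>J. (- 1) * hop r (r + 1) v J)" for v :: "nat set \<Rightarrow> 'a"
      using True by (simp add: fun_eq_iff act_psi_def)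
    show ?thesis by (simp only: psi up_down_linear up_down_hop_within[OF pq])
  next
    case False
    show ?thesis
    proof (cases "r = 1")
      case True
      have "act_psi 1 v = (\<lambda>J. 0 * v J)" for v :: "nat set \<Rightarrow> 'a"
        by (simp add: fun_eq_iff act_psi_def)
      then show ?thesis unfolding True by (simp only: up_down_linear)
    next
      case r1: False
      then obtain j where r: "r = 2 * j + 1" "j \<ge> 1" using False by (auto elim!: oddE)
      have far: "2 * k + 1 < r - 1 \<or> r + 2 < 2 * k" if "k \<noteq> j" "k \<noteq> j + 1" for k
        using that r by auto
      have "up m (act_psi r v) J = act_psi r (up m v) J" for J
        unfolding up_def[abs_def] act_psi_sum
      proof (rule sum_split_two[of j])
        show "add_pair k (act_psi r v) J = act_psi r (add_pair k v) J" if "k \<noteq> j" "k \<noteq> j + 1" for k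
          by (simp only: pair_act_psi_far(1)[OF False far[OF that]])
      qed (use pair_act_psi_near(1)[OF r(2), of v J] assms r in auto)
      moreover have "down m (act_psi r v) J = act_psi r (down m v) J" for J
        unfolding down_def[abs_def] act_psi_sum
      proof (rule sum_split_two[of j])
        show "drop_pair k (act_psi r v) J = act_psi r (drop_pair k v) J" if "k \<noteq> j" "k \<noteq> j + 1" for k
          by (simp only: pair_act_psi_far(2)[OF False far[OF that]])
      qed (use pair_act_psi_near(2)[OF r(2), of v J] assms r in auto)
      ultimately show ?thesis by blast
    qed
  qed
  then show "up m (act_psi r v) = act_psi r (up m v)" "down m (act_psi r v) = act_psi r (down m v)"
    by blast+
qed

text \<open>The segments in \<open>wt\<close> contain both points of the pair or neither, so a
  change of the pair alters the counts by an even number.\<close>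

lemma seq_pair:
  assumes "(2 * k \<in> J) = (2 * k + 1 \<in> J)" "k \<ge> 1"
  shows "seq n (put (2 * k) x (put (2 * k + 1) x J)) = seq n J"
proof -
  let ?J = "put (2 * k) x (put (2 * k + 1) x J)"
  have parity: "card (?J \<inter> X) mod 2 = card (J \<inter> X) mod 2"
    if X: "finite X" "(2 * k \<in> X) = (2 * k + 1 \<in> X)" for X
  proof -
    let ?P = "{2 * k, 2 * k + 1}"
    have card: "card (Z \<inter> X) = card ((Z - ?P) \<inter> X) + (if 2 * k \<in> Z \<and> 2 * k \<in> X then 2 else 0)"
      if "(2 * k \<in> Z) = (2 * k + 1 \<in> Z)" for Z
    proof -
      have "Z \<inter> X = (Z - ?P) \<inter> X \<union> (Z \<inter> X \<inter> ?P)" by auto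
      moreover have "card ((Z - ?P) \<inter> X \<union> (Z \<inter> X \<inter> ?P)) = card ((Z - ?P) \<inter> X) + card (Z \<inter> X \<inter> ?P)"
        by (rule card_Un_disjoint) (use X in auto)
      moreover have "Z \<inter> X \<inter> ?P = (if 2 * k \<in> Z \<and> 2 * k \<in> X then ?P else {})"
        using that X by auto
      ultimately show ?thesis by auto
    qed
    define c where "c = card ((J - ?P) \<inter> X)"
    have "?J - ?P = J - ?P" by (auto simp: put_def)
    moreover have "(2 * k \<in> ?J) = (2 * k + 1 \<in> ?J)" by simp
    ultimately have J1: "card (?J \<inter> X) = c + (if 2 * k \<in> ?J \<and> 2 * k \<in> X then 2 else 0)"
      using card[of ?J] by (simp only: c_def)
    have J2: "card (J \<inter> X) = c + (if 2 * k \<in> J \<and> 2 * k \<in> X then 2 else 0)"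
      unfolding c_def by (rule card[OF assms(1)])
    show ?thesis unfolding J1 J2 by simp
  qed
  have "wt ?J r = wt J r" for r
  proof -
    have "card (?J \<inter> {2..r}) mod 2 = card (J \<inter> {2..r}) mod 2" if "odd r"
      by (rule parity) (use that assms(2) in \<open>auto elim!: oddE\<close>)
    moreover have "card (?J \<inter> {2..<r}) mod 2 = card (J \<inter> {2..<r}) mod 2" if "even r"
      by (rule parity) (use that assms(2) in \<open>auto elim!: evenE\<close>)
    ultimately show ?thesis
      unfolding wt_def by presburger
  qed
  then show ?thesis by (simp add: seq_def)
qed

lemma up_down_act_e:
  "up m (act_e n i v) = act_e n i (up m v)" "down m (act_e n i v) = act_e n i (down m v)"
proof -
  have "add_pair k (act_e n i v) J = act_e n i (add_pair k v) J"
    "drop_pair k (act_e n i v) J = act_e n i (drop_pair k v) J" if "k \<in> {1..m}" for k J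
    using seq_pair[of k J n] that by (auto simp: add_pair_def drop_pair_def act_e_def)
  then have "up m (act_e n i v) J = act_e n i (up m v) J" "down m (act_e n i v) J = act_e n i (down m v) J" for J
    by (simp_all add: up_def down_def act_e_def)
  then show "up m (act_e n i v) = act_e n i (up m v)" "down m (act_e n i v) = act_e n i (down m v)"
    by blast+
qed

text \<open>Here \<open>n\<close> is odd: the pairs exhaust \<open>{2..n}\<close>, so both pairs
  touched by a crossing of odd index above 1 occur in the sums.\<close>

lemma up_down_act:
  assumes "g \<in> klr_gens (2 * m + 1)"
  shows "up m (act (2 * m + 1) g v) = act (2 * m + 1) g (up m v)"
    "down m (act (2 * m + 1) g v) = act (2 * m + 1) g (down m v)"
  using assms
  by (cases g; auto simp: klr_gens_def up_down_act_y up_down_act_psi up_down_act_e)+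

lemma rep_commute:
  assumes "\<And>g v. g \<in> klr_gens n \<Longrightarrow> T (act n g v) = act n g (T v)"
    and "\<And>u v. T (u + v) = T u + T v" "\<And>c v. T (\<lambda>J. c * v J) = (\<lambda>J. c * T v J)"
    and "p \<in> klr_carrier n"
  shows "T (rep n p v) = rep n p (T v)"
  using assms(4)
proof (induction p rule: free_algebra_induct)
  case zero
  have "T 0 = 0" using assms(2)[of 0 0] by simp
  then show ?case by (simp only: rep_zero)
next
  case (add p w c)
  have "Poly_Mapping.keys (Poly_Mapping.single w c + p) = insert w (Poly_Mapping.keys p)"
    using add(1,2) by (auto simp: in_keys_iff lookup_add lookup_single when_def split: if_splits)
  then have p: "p \<in> klr_carrier n" and w: "set (letters w) \<subseteq> klr_gens n"
    using add(4) by (auto simp: free_algebra_def)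
  have "T (foldr (act n) xs v) = foldr (act n) xs (T v)" if "set xs \<subseteq> klr_gens n" for xs
    using that by (induction xs) (auto simp: assms(1))
  then have "T (rep n (Poly_Mapping.single w c) v) = rep n (Poly_Mapping.single w c) (T v)"
    using w by (simp only: rep_single assms(3))
  then show ?case using add(3)[OF p] by (simp only: rep_add assms(2))
qed

section \<open>The commutator of \<open>down\<close> and \<open>up\<close>\<close>

lemma drop_add_same: "drop_pair k (add_pair k v) J = (if 2 * k \<notin> J \<and> 2 * k + 1 \<notin> J then v J else 0)"
  by (simp add: drop_pair_def add_pair_def put_twist put_idem)

lemma add_drop_same: "add_pair k (drop_pair k v) J = (if 2 * k \<in> J \<and> 2 * k + 1 \<in> J then v J else 0)"
  by (simp add: drop_pair_def add_pair_def put_twist put_idem)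

lemma drop_add_diff:
  assumes "k \<noteq> l"
  shows "drop_pair k (add_pair l v) J = add_pair l (drop_pair k v) J"
proof -
  have ne: "2 * k \<noteq> 2 * l" "2 * k + 1 \<noteq> 2 * l" "2 * k \<noteq> 2 * l + 1" "2 * k + 1 \<noteq> 2 * l + 1"
    using assms by presburger+
  then have "put (2 * k) True (put (2 * k + 1) True (put (2 * l) False (put (2 * l + 1) False J)))
     = put (2 * l) False (put (2 * l + 1) False (put (2 * k) True (put (2 * k + 1) True J)))"
    by (auto simp: put_def)
  then show ?thesis using ne by (simp add: drop_pair_def add_pair_def)
qed

lemma pair_sum:
  "drop_pair k (\<lambda>J. \<Sum>l\<in>I. f l J) = (\<lambda>J. \<Sum>l\<in>I. drop_pair k (f l) J)"
  "add_pair k (\<lambda>J. \<Sum>l\<in>I. f l J) = (\<lambda>J. \<Sum>l\<in>I. add_pair k (f l) J)"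
  by (auto simp: fun_eq_iff drop_pair_def add_pair_def)

lemma sum_pairs_card:
  fixes J :: "nat set"
  assumes "J \<subseteq> {2..2 * m + 1}"
  shows "(\<Sum>k=1..m. of_bool (2 * k \<in> J) + of_bool (2 * k + 1 \<in> J)) = card J"
proof -
  have "(\<Sum>k=1..m. of_bool (2 * k \<in> J) + of_bool (2 * k + 1 \<in> J)) = card (J \<inter> {2..2 * m + 1})" for m :: nat
  proof (induction m)
    case 0
    then show ?case by simp
  next
    case (Suc m)
    have "J \<inter> {2..2 * Suc m + 1} = J \<inter> {2..2 * m + 1} \<union> (J \<inter> {2 * Suc m, 2 * Suc m + 1})" by auto
    moreover have "card (J \<inter> {2..2 * m + 1} \<union> (J \<inter> {2 * Suc m, 2 * Suc m + 1}))
        = card (J \<inter> {2..2 * m + 1}) + card (J \<inter> {2 * Suc m, 2 * Suc m + 1})"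
      by (rule card_Un_disjoint) auto
    moreover have "card (J \<inter> {2 * Suc m, 2 * Suc m + 1}) = of_bool (2 * Suc m \<in> J) + of_bool (2 * Suc m + 1 \<in> J)"
      by (auto simp: Int_insert_right)
    ultimately show ?case using Suc.IH by simp
  qed
  moreover have "J \<inter> {2..2 * m + 1} = J" using assms by blast
  ultimately show ?thesis by simp
qed

text \<open>Different pairs commute. For a single pair the commutator is 1, 0 or -1 according to
  whether \<open>J\<close> contains none, one or both of its points, that is, 1 minus their number;
  summation over all pairs gives \<open>m - d\<close>.\<close>

lemma down_up:
  assumes v: "v \<in> fock (2 * m + 1) d"
  shows "down m (up m v) = up m (down m v) + (\<lambda>J. (of_nat m - of_nat d) * v J)"
proof
  fix J
  let ?N = "\<lambda>k. if 2 * k \<notin> J \<and> 2 * k + 1 \<notin> J then v J else 0"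
  let ?B = "\<lambda>k. if 2 * k \<in> J \<and> 2 * k + 1 \<in> J then v J else 0"
  have "down m (up m v) J - up m (down m v) J
      = (\<Sum>k=1..m. \<Sum>l=1..m. drop_pair k (add_pair l v) J - add_pair l (drop_pair k v) J)"
    unfolding down_def up_def[abs_def] up_def pair_sum down_def[abs_def]
    by (subst (2) sum.swap) (simp add: sum_subtractf)
  also have "\<dots> = (\<Sum>k=1..m. \<Sum>l=1..m. if l = k then ?N k - ?B k else 0)"
    by (intro sum.cong refl) (auto simp: drop_add_diff drop_add_same add_drop_same)
  also have "\<dots> = (\<Sum>k=1..m. ?N k - ?B k)" by simp
  also have "\<dots> = (of_nat m - of_nat d) * v J"
  proof (cases "v J = 0")
    case True
    then show ?thesis by (simp cong: if_cong)
  next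
    case False
    then have J: "J \<subseteq> {2..2 * m + 1}" "card J = d" using v by (auto simp: fock_def)
    have "(\<Sum>k=1..m. ?N k - ?B k) = (\<Sum>k=1..m. (1 - of_nat (of_bool (2 * k \<in> J) + of_bool (2 * k + 1 \<in> J))) * v J)"
      by (intro sum.cong refl) auto
    also have "\<dots> = (of_nat m - of_nat (\<Sum>k=1..m. of_bool (2 * k \<in> J) + of_bool (2 * k + 1 \<in> J))) * v J"
      by (simp only: sum_distrib_right[symmetric] sum_subtractf of_nat_sum) simp
    finally show ?thesis unfolding sum_pairs_card[OF J(1)] J(2) .
  qed
  finally show "down m (up m v) J = (up m (down m v) + (\<lambda>J. (of_nat m - of_nat d) * v J)) J"
    by (simp add: algebra_simps)
qed

lemma add_pair_fock:
  assumes "v \<in> fock (2 * m + 1) d" "1 \<le> k" "k \<le> m"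
  shows "add_pair k v \<in> fock (2 * m + 1) (d + 2)"
  unfolding fock_def
proof (intro CollectI allI impI)
  fix J assume "add_pair k v J \<noteq> 0"
  then have J: "2 * k \<in> J" "2 * k + 1 \<in> J" "v (J - {2 * k + 1} - {2 * k}) \<noteq> 0"
    by (auto simp: add_pair_def put_def split: if_splits)
  let ?J' = "J - {2 * k + 1} - {2 * k}"
  have J': "?J' \<subseteq> {2..2 * m + 1}" "card ?J' = d" using assms(1) J(3) by (auto simp: fock_def)
  then have "finite ?J'" using finite_subset by blast
  then have "card (insert (2 * k) (insert (2 * k + 1) ?J')) = d + 2" using J'(2) by simp
  moreover have "insert (2 * k) (insert (2 * k + 1) ?J') = J" using J by auto
  moreover have "insert (2 * k) (insert (2 * k + 1) ?J') \<subseteq> {2..2 * m + 1}" using J'(1) assms by auto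
  ultimately show "J \<subseteq> {2..2 * m + 1} \<and> card J = d + 2" by simp
qed

lemma drop_pair_zero: "v \<in> fock n d \<Longrightarrow> d < 2 \<Longrightarrow> drop_pair k v = 0"
proof
  fix J assume v: "v \<in> fock n d" "d < 2"
  show "drop_pair k v J = 0 J"
  proof (rule ccontr)
    assume "drop_pair k v J \<noteq> 0 J"
    then have "v (insert (2 * k) (insert (2 * k + 1) J)) \<noteq> 0"
      by (auto simp: drop_pair_def put_def split: if_splits)
    then have "insert (2 * k) (insert (2 * k + 1) J) \<subseteq> {2..n}" "card (insert (2 * k) (insert (2 * k + 1) J)) = d"
      using v(1) by (auto simp: fock_def)
    moreover from this(1) have "card {2 * k, 2 * k + 1} \<le> card (insert (2 * k) (insert (2 * k + 1) J))"
      by (intro card_mono finite_subset[of "insert (2 * k) (insert (2 * k + 1) J)" "{2..n}"]) auto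
    ultimately show False using v(2) by simp
  qed
qed

lemma drop_pair_fock:
  assumes "v \<in> fock n (d + 2)"
  shows "drop_pair k v \<in> fock n d"
  unfolding fock_def
proof (intro CollectI allI impI)
  fix J assume "drop_pair k v J \<noteq> 0"
  then have J: "2 * k \<notin> J" "2 * k + 1 \<notin> J" "v (insert (2 * k) (insert (2 * k + 1) J)) \<noteq> 0"
    by (auto simp: drop_pair_def put_def split: if_splits)
  then have J': "insert (2 * k) (insert (2 * k + 1) J) \<subseteq> {2..n}" "card (insert (2 * k) (insert (2 * k + 1) J)) = d + 2"
    using assms by (auto simp: fock_def)
  then have "J \<subseteq> {2..n}" by auto
  moreover from this have "finite J" using finite_subset by blast
  ultimately show "J \<subseteq> {2..n} \<and> card J = d" using J J'(2) by simp
qed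

lemma fock_sum: "(\<And>k. k \<in> I \<Longrightarrow> f k \<in> fock n d) \<Longrightarrow> (\<lambda>J. \<Sum>k\<in>I. f k J) \<in> fock n d"
proof -
  assume f: "\<And>k. k \<in> I \<Longrightarrow> f k \<in> fock n d"
  show ?thesis unfolding fock_def
  proof (intro CollectI allI impI)
    fix J assume "(\<Sum>k\<in>I. f k J) \<noteq> 0"
    then obtain k where "k \<in> I" "f k J \<noteq> 0" by (meson sum.neutral)
    then show "J \<subseteq> {2..n} \<and> card J = d" using f by (auto simp: fock_def)
  qed
qed

lemma up_fock: "v \<in> fock (2 * m + 1) d \<Longrightarrow> up m v \<in> fock (2 * m + 1) (d + 2)"
  unfolding up_def[abs_def] by (intro fock_sum add_pair_fock) auto

lemma down_fock: "v \<in> fock n (d + 2) \<Longrightarrow> down m v \<in> fock n d"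
  unfolding down_def[abs_def] by (intro fock_sum drop_pair_fock)

lemma down_zero: "v \<in> fock n d \<Longrightarrow> d < 2 \<Longrightarrow> down m v = 0"
  by (simp add: fun_eq_iff down_def drop_pair_zero)

lemma up_zero [simp]: "up m 0 = 0" and down_0 [simp]: "down m 0 = 0"
  by (simp_all add: fun_eq_iff up_def down_def add_pair_def drop_pair_def cong: if_cong)

lemma up_pow_fock: "v \<in> fock (2 * m + 1) d \<Longrightarrow> (up m ^^ i) v \<in> fock (2 * m + 1) (d + 2 * i)"
  by (induction i) (simp_all add: up_fock[simplified])

text \<open>The coefficient is the sum of the commutators \<open>m - d - 2j\<close> for
  \<open>j \<le> i\<close>.\<close>

lemma down_up_pow:
  assumes v: "v \<in> fock (2 * m + 1) d"
  shows "down m ((up m ^^ Suc i) v) = (up m ^^ Suc i) (down m v)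
    + (\<lambda>J. of_nat (Suc i) * (of_nat m - of_nat d - of_nat i) * (up m ^^ i) v J)"
proof (induction i)
  case 0
  then show ?case by (simp add: down_up[OF v])
next
  case (Suc i)
  let ?u = "(up m ^^ Suc i) v"
  have "down m ((up m ^^ Suc (Suc i)) v) = up m (down m ?u) + (\<lambda>J. (of_nat m - of_nat (d + 2 * Suc i)) * ?u J)"
    using down_up[OF up_pow_fock[OF v, of "Suc i"]] by (simp only: funpow.simps o_apply)
  also have "up m (down m ?u) = (up m ^^ Suc (Suc i)) (down m v)
      + (\<lambda>J. of_nat (Suc i) * (of_nat m - of_nat d - of_nat i) * ?u J)"
    by (simp only: Suc.IH up_down_linear) (simp only: funpow.simps o_apply)
  finally show ?case
    by (simp only: fun_eq_iff plus_fun_apply) (simp add: algebra_simps)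
qed

lemma down_pow_fock: "v \<in> fock n d \<Longrightarrow> 2 * i \<le> d \<Longrightarrow> (down m ^^ i) v \<in> fock n (d - 2 * i)"
proof (induction i)
  case (Suc i)
  then have "(down m ^^ i) v \<in> fock n (d - 2 * Suc i + 2)" by (simp add: Suc_diff_Suc numeral_2_eq_2)
  then show ?case using down_fock by simp
qed simp

lemma down_pow_zero:
  assumes "v \<in> fock n d" "d < 2 * i"
  shows "(down m ^^ i) v = 0"
proof -
  define j where "j = d div 2"
  have "(down m ^^ j) v \<in> fock n (d - 2 * j)" by (rule down_pow_fock[OF assms(1)]) (simp add: j_def)
  then have "(down m ^^ Suc j) v = 0" using down_zero[of "(down m ^^ j) v"] by (simp add: j_def)
  moreover have "i = (i - Suc j) + Suc j" using assms(2) by (simp add: j_def)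
  moreover have "(down m ^^ k) 0 = 0" for k by (induction k) (simp_all only: funpow.simps o_apply id_apply down_0)
  ultimately show ?thesis by (metis funpow_add o_apply)
qed

text \<open>On a fixed degree, twice this operator differs from the Casimir element of
  \<open>sl_2\<close> by a scalar.\<close>

definition casimir :: "nat \<Rightarrow> (nat set \<Rightarrow> 'f::field) \<Rightarrow> nat set \<Rightarrow> 'f" where
  "casimir m v = up m (down m v)"

lemma casimir_linear: "casimir m (u + v) = casimir m u + casimir m v"
  "casimir m (\<lambda>J. c * v J) = (\<lambda>J. c * casimir m v J)"
  by (simp_all only: casimir_def up_down_linear)

lemma casimir_fock: "v \<in> fock (2 * m + 1) d \<Longrightarrow> casimir m v \<in> fock (2 * m + 1) d"
proof (cases "d < 2")
  case True
  assume "v \<in> fock (2 * m + 1) d"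
  then have "casimir m v = 0" using True by (simp add: casimir_def down_zero)
  then show ?thesis using fv.subspace_0[OF subspace_fock] by (simp only:)
next
  case False
  assume v: "v \<in> fock (2 * m + 1) d"
  obtain e where d: "d = e + 2" using False le_Suc_ex[of 2 d] by auto
  show ?thesis using v unfolding casimir_def d by (intro up_fock down_fock)
qed

lemma casimir_rep:
  "p \<in> klr_carrier (2 * m + 1) \<Longrightarrow> casimir m (rep (2 * m + 1) p v) = rep (2 * m + 1) p (casimir m v)"
  by (rule rep_commute) (simp_all only: casimir_linear, simp_all only: casimir_def up_down_act)

lemma casimir_step:
  assumes v: "v \<in> fock (2 * m + 1) d" "2 * i \<le> d"
  shows "casimir m ((up m ^^ i) ((down m ^^ i) v)) = (up m ^^ Suc i) ((down m ^^ Suc i) v)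
    + (\<lambda>J. of_nat i * (of_nat m - of_nat d + of_nat i + 1) * (up m ^^ i) ((down m ^^ i) v) J)"
proof (cases i)
  case 0
  then show ?thesis by (simp add: casimir_def fun_eq_iff)
next
  case (Suc j)
  let ?w = "(down m ^^ i) v"
  have w: "?w \<in> fock (2 * m + 1) (d - 2 * i)" by (rule down_pow_fock[OF v])
  have "casimir m ((up m ^^ i) ?w) = up m ((up m ^^ i) (down m ?w)
      + (\<lambda>J. of_nat i * (of_nat m - of_nat (d - 2 * i) - of_nat j) * (up m ^^ j) ?w J))"
    unfolding casimir_def Suc using down_up_pow[OF w, of j] by (simp only: Suc)
  also have "\<dots> = (up m ^^ Suc i) ((down m ^^ Suc i) v)
      + (\<lambda>J. of_nat i * (of_nat m - of_nat (d - 2 * i) - of_nat j) * (up m ^^ i) ?w J)"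
    by (simp only: up_down_linear Suc funpow.simps o_apply)
  \<comment> \<open>The commutator is taken in degree \<open>d - 2 * i\<close>, with
    \<open>j = i - 1\<close>.\<close>
  also have "of_nat m - of_nat (d - 2 * i) - of_nat j = (of_nat m - of_nat d + of_nat i + 1 :: 'a)"
    using v(2) Suc by (simp add: of_nat_diff algebra_simps)
  finally show ?thesis .
qed

section \<open>Fitting decomposition for a product of linear factors\<close>

fun factors :: "((nat set \<Rightarrow> 'f) \<Rightarrow> nat set \<Rightarrow> 'f) \<Rightarrow> 'f list \<Rightarrow> (nat set \<Rightarrow> 'f) \<Rightarrow> nat set \<Rightarrow> 'f::field" where
  "factors T [] v = v"
| "factors T (c # cs) v = factors T cs (T v - (\<lambda>J. c * v J))"

locale linear_operator =
  fixes T :: "(nat set \<Rightarrow> 'f::field) \<Rightarrow> nat set \<Rightarrow> 'f"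
  assumes T_add: "T (u + v) = T u + T v" and T_scale: "T (\<lambda>J. c * v J) = (\<lambda>J. c * T v J)"
begin

lemma T_uminus: "T (- v) = - T v"
  using T_scale[of "- 1" v] by (simp add: fun_Compl_def)

lemma T_diff: "T (u - v) = T u - T v"
  using T_add[of u "- v"] by (simp add: T_uminus)

lemma T_zero: "T 0 = 0"
  using T_add[of 0 0] by simp

lemma pow_linear: "(T ^^ s) (u + v) = (T ^^ s) u + (T ^^ s) v" "(T ^^ s) (\<lambda>J. c * v J) = (\<lambda>J. c * (T ^^ s) v J)"
  "(T ^^ s) 0 = 0" "(T ^^ s) (u - v) = (T ^^ s) u - (T ^^ s) v"
  by (induction s) (simp_all only: funpow.simps o_apply id_apply T_add T_scale T_zero T_diff)

lemma pow_T: "(T ^^ s) (T v) = T ((T ^^ s) v)"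
  by (metis funpow_swap1)

lemma factor_add: "T (u + v) - (\<lambda>J. c * (u + v) J) = (T u - (\<lambda>J. c * u J)) + (T v - (\<lambda>J. c * v J))"
  by (simp add: T_add fun_eq_iff algebra_simps)

lemma factor_scale: "T (\<lambda>J. d * v J) - (\<lambda>J. c * (d * v J)) = (\<lambda>J. d * (T v - (\<lambda>J. c * v J)) J)"
  by (simp only: T_scale) (simp add: fun_eq_iff right_diff_distrib mult.left_commute)

lemma factors_add: "factors T cs (u + v) = factors T cs u + factors T cs v"
  by (induction cs arbitrary: u v) (simp_all only: factors.simps factor_add)

lemma factors_scale: "factors T cs (\<lambda>J. d * v J) = (\<lambda>J. d * factors T cs v J)"
  by (induction cs arbitrary: v) (simp_all only: factors.simps factor_scale)

lemma factors_zero: "factors T cs 0 = 0"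
  using factors_add[of cs 0 0] by simp

lemma factors_diff: "factors T cs (u - v) = factors T cs u - factors T cs v"
  using factors_add[of cs "u - v" v] by (simp add: algebra_simps)

lemma factors_T: "factors T cs (T v) = T (factors T cs v)"
proof (induction cs arbitrary: v)
  case (Cons c cs)
  have "T (T v) - (\<lambda>J. c * T v J) = T (T v - (\<lambda>J. c * v J))"
    by (simp only: T_diff T_scale)
  then show ?case by (simp only: factors.simps Cons.IH)
qed simp

lemma factors_factor: "factors T cs (T v - (\<lambda>J. c * v J)) = T (factors T cs v) - (\<lambda>J. c * factors T cs v J)"
  by (simp only: factors_diff factors_scale factors_T)

lemma factors_kernel: "T v = 0 \<Longrightarrow> 0 \<notin> set cs \<Longrightarrow> factors T cs v = 0 \<Longrightarrow> v = 0"
proof (induction cs arbitrary: v)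
  case (Cons c cs)
  have "T v - (\<lambda>J. c * v J) = (\<lambda>J. (- c) * v J)"
    unfolding Cons.prems(1) by (simp add: fun_eq_iff)
  then have fac: "factors T cs (\<lambda>J. (- c) * v J) = 0"
    using Cons.prems(3) by (simp only: factors.simps)
  have "T (\<lambda>J. (- c) * v J) = 0"
    by (simp only: T_scale Cons.prems(1)) (simp add: fun_eq_iff)
  then have "(\<lambda>J. (- c) * v J) = 0" by (rule Cons.IH[OF _ _ fac]) (use Cons.prems in simp)
  then have "c * v J = 0" for J by (metis (no_types, lifting) mult_minus_left neg_equal_0_iff_equal zero_fun_apply)
  then show ?case using Cons.prems(2) by (auto simp: fun_eq_iff)
qed simp

text \<open>The claim reduces to the kernel of \<open>T\<close>, on which the product acts as a
  non-zero scalar.\<close>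

lemma fitting_disjoint: "0 \<notin> set cs \<Longrightarrow> (T ^^ s) v = 0 \<Longrightarrow> factors T cs v = 0 \<Longrightarrow> v = 0"
proof (induction s arbitrary: v)
  case (Suc s)
  have "(T ^^ s) (T v) = 0" using Suc.prems(2) by (simp only: funpow.simps o_apply pow_T)
  moreover have "factors T cs (T v) = 0" by (simp only: factors_T Suc.prems(3) T_zero)
  ultimately have "T v = 0" using Suc by blast
  then show ?case using factors_kernel Suc.prems by blast
qed simp

text \<open>For a root \<open>c \<noteq> 0\<close>, \<open>c v\<close> is the difference of
  \<open>T v\<close> and \<open>T v - c v\<close>. The first needs one power of \<open>T\<close>
  fewer, the second one factor fewer, so both fall under the induction on the total number of
  factors.\<close>

lemma fitting_sum:
  assumes W: "fv.subspace W" "\<And>w. w \<in> W \<Longrightarrow> T w \<in> W"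
  shows "0 \<notin> set cs \<Longrightarrow> v \<in> W \<Longrightarrow> factors T cs ((T ^^ s) v) = 0 \<Longrightarrow>
    \<exists>u\<in>W. \<exists>w\<in>W. (T ^^ s) u = 0 \<and> factors T cs w = 0 \<and> v = u + w"
proof (induction "s + length cs" arbitrary: s cs v rule: less_induct)
  case less
  note z = fv.subspace_0[OF W(1)]
  show ?case
  proof (cases s)
    case 0
    then show ?thesis using less.prems z by (intro bexI[of _ 0] bexI[of _ v]) simp_all
  next
    case (Suc s')
    show ?thesis
    proof (cases cs)
      case Nil
      then show ?thesis using less.prems z by (intro bexI[of _ v] bexI[of _ 0]) simp_all
    next
      case (Cons c ds)
      have c: "c \<noteq> 0" and ds: "0 \<notin> set ds" using less.prems(1) Cons by auto
      define v1 where "v1 = T v"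
      define v2 where "v2 = T v - (\<lambda>J. c * v J)"
      have v12: "v1 \<in> W" "v2 \<in> W"
        using less.prems(2) W(2) fv.subspace_diff[OF W(1) _ fv.subspace_scale[OF W(1)]] by (auto simp: v1_def v2_def)
      have "factors T cs ((T ^^ s') v1) = 0"
        using less.prems(3) by (simp only: v1_def Suc funpow_Suc_right o_apply)
      then obtain u1 w1 where 1: "u1 \<in> W" "w1 \<in> W" "(T ^^ s') u1 = 0" "factors T cs w1 = 0" "v1 = u1 + w1"
        using less.hyps[of s' cs v1] less.prems(1) v12 Suc by auto
      have "factors T ds ((T ^^ s) v2) = factors T cs ((T ^^ s) v)"
        by (simp only: v2_def Cons factors.simps pow_linear pow_T)
      then obtain u2 w2 where 2: "u2 \<in> W" "w2 \<in> W" "(T ^^ s) u2 = 0" "factors T ds w2 = 0" "v2 = u2 + w2"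
        using less.hyps[of s ds v2] less.prems(3) ds v12 Cons by auto
      have "(T ^^ s) u1 = 0"
        by (simp only: Suc funpow.simps o_apply 1(3) T_zero)
      have "factors T cs w2 = 0"
        by (simp only: Cons factors.simps factors_factor 2(4) T_zero) (simp add: fun_eq_iff)
      define u where "u = (\<lambda>J. (1 / c) * (u1 - u2) J)"
      define w where "w = (\<lambda>J. (1 / c) * (w1 - w2) J)"
      have "u \<in> W" "w \<in> W"
        unfolding u_def w_def using 1 2 by (intro fv.subspace_scale[OF W(1)] fv.subspace_diff[OF W(1)]; blast)+
      moreover have "(T ^^ s) u = 0"
        by (simp only: u_def pow_linear \<open>(T ^^ s) u1 = 0\<close> 2(3)) (simp add: fun_eq_iff)
      moreover have "factors T cs w = 0"
        by (simp only: w_def factors_scale factors_diff 1(4) \<open>factors T cs w2 = 0\<close>) (simp add: fun_eq_iff)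
      moreover have "v = u + w"
      proof
        fix J
        have "v1 J - v2 J = c * v J" by (simp add: v1_def v2_def)
        then have "c * v J = (u1 J + w1 J) - (u2 J + w2 J)" by (simp add: 1(5) 2(5))
        then have "v J = (1 / c) * ((u1 J + w1 J) - (u2 J + w2 J))" using c by (simp add: field_simps)
        then show "v J = (u + w) J" by (simp add: u_def w_def algebra_simps)
      qed
      ultimately show ?thesis by blast
    qed
  qed
qed

lemma factors_split: "factors T cs v = 0 \<Longrightarrow> factors T (filter (\<lambda>c. c \<noteq> 0) cs) ((T ^^ length cs) v) = 0"
proof (induction cs arbitrary: v)
  case (Cons c cs)
  let ?ds = "filter (\<lambda>c. c \<noteq> 0) cs"
  note IH = Cons.IH[OF Cons.prems[unfolded factors.simps]]
  show ?case
  proof (cases "c = 0")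
    case True
    have "T v - (\<lambda>J. c * v J) = T v" using True by (simp add: fun_eq_iff)
    then have "factors T ?ds ((T ^^ length cs) (T v)) = 0" using IH by (simp only:)
    then show ?thesis using True by (simp add: funpow_swap1)
  next
    case False
    have "factors T (c # ?ds) ((T ^^ Suc (length cs)) v) = T (factors T ?ds ((T ^^ length cs) (T v - (\<lambda>J. c * v J))))"
      by (simp only: factors.simps factors_T[symmetric] pow_linear T_diff T_scale funpow.simps o_apply pow_T)
    also have "\<dots> = 0" by (simp only: IH T_zero)
    finally show ?thesis using False by simp
  qed
qed simp

end

section \<open>Annihilating polynomial and eigenvectors of \<open>casimir\<close>\<close>

lemma linear_operator_casimir: "linear_operator (casimir m)"
  by unfold_locales (rule casimir_linear)+

text \<open>The product telescopes: by \<open>casimir_step\<close> the factor for index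
  \<open>s\<close> turns the \<open>s\<close>-fold \<open>up\<close> after the \<open>s\<close>-fold
  \<open>down\<close> into the \<open>Suc s\<close>-fold ones.\<close>

lemma casimir_factors:
  assumes v: "v \<in> fock (2 * m + 1) d" and s: "s \<le> Suc (d div 2)"
  shows "factors (casimir m) (map (\<lambda>i. of_nat i * (of_nat m - of_nat d + of_nat i + 1)) [0..<s]) v
    = (up m ^^ s) ((down m ^^ s) (v :: nat set \<Rightarrow> 'f::field))"
  using s
proof (induction s)
  case (Suc s)
  interpret linear_operator "casimir m" by (rule linear_operator_casimir)
  let ?c = "\<lambda>i. of_nat i * (of_nat m - of_nat d + of_nat i + 1) :: 'f"
  have snoc: "factors T' (cs @ [c]) x = T' (factors T' cs x) - (\<lambda>J. c * factors T' cs x J)" if "T' = casimir m" for T' cs c and x :: "nat set \<Rightarrow> 'f"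
    unfolding that by (induction cs arbitrary: x) (simp_all only: append.simps factors.simps)
  have "factors (casimir m) (map ?c [0..<Suc s]) v = casimir m ((up m ^^ s) ((down m ^^ s) v))
      - (\<lambda>J. ?c s * (up m ^^ s) ((down m ^^ s) v) J)"
    using snoc[OF refl, of "map ?c [0..<s]" "?c s" v] Suc by (simp only: upt_Suc map_append list.map) simp
  also have "\<dots> = (up m ^^ Suc s) ((down m ^^ Suc s) v)"
    using casimir_step[OF v, of s] Suc.prems by (simp only: add_diff_cancel_right')
  finally show ?case .
qed simp

lemma casimir_annihilated:
  assumes "v \<in> fock (2 * m + 1) d"
  shows "factors (casimir m) (map (\<lambda>i. of_nat i * (of_nat m - of_nat d + of_nat i + 1)) [0..<Suc (d div 2)]) v
    = (0 :: nat set \<Rightarrow> 'f::field)"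
proof -
  have "(down m ^^ Suc (d div 2)) v = 0" by (rule down_pow_zero[OF assms]) simp
  moreover have "(up m ^^ s) 0 = (0 :: nat set \<Rightarrow> 'f)" for s
    by (induction s) (simp_all only: funpow.simps o_apply id_apply up_zero)
  ultimately show ?thesis
    using casimir_factors[OF assms, of "Suc (d div 2)"] by (simp only: order_refl simp_thms)
qed

text \<open>The basis vector of \<open>{2, 4, .., 2d}\<close>. It contains no complete pair and so
  is killed by \<open>down\<close>; applying powers of \<open>up\<close> to it yields eigenvectors
  of \<open>casimir\<close>.\<close>

definition primitive :: "nat \<Rightarrow> nat set \<Rightarrow> 'f::field" where
  "primitive d = delta ((*) 2 ` {1..d})"

lemma primitive_fock: "d \<le> m \<Longrightarrow> primitive d \<in> fock (2 * m + 1) d"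
  unfolding primitive_def by (rule delta_fock) (auto simp: card_image inj_on_def)

lemma down_primitive: "down m (primitive d) = 0"
proof -
  have drop: "drop_pair k (primitive d) = 0" for k
  proof
    fix J
    have "2 * k + 1 \<notin> (*) 2 ` {1..d}" by auto presburger
    then have "put (2 * k) True (put (2 * k + 1) True J) \<noteq> (*) 2 ` {1..d}"
      by (metis (full_types) mem_put)
    then show "drop_pair k (primitive d) J = 0 J" by (simp add: drop_pair_def primitive_def delta_def)
  qed
  show ?thesis by (simp only: fun_eq_iff down_def drop zero_fun_apply) simp
qed

lemma casimir_primitive: "casimir m (primitive d) = 0"
  by (simp only: casimir_def down_primitive up_zero)

lemma down_up_primitive:
  assumes "d \<le> m"
  shows "down m ((up m ^^ Suc i) (primitive d))
    = (\<lambda>J. of_nat (Suc i) * (of_nat m - of_nat d - of_nat i) * (up m ^^ i) (primitive d) J :: 'f::field)"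
proof -
  have pow_0: "(up m ^^ k) 0 = (0 :: nat set \<Rightarrow> 'f)" for k
    by (induction k) (simp_all only: funpow.simps o_apply id_apply up_zero)
  show ?thesis
    by (simp only: down_up_pow[OF primitive_fock[OF assms]] down_primitive pow_0 add_0_left)
qed

lemma casimir_up_primitive:
  assumes "d \<le> m"
  shows "casimir m ((up m ^^ Suc i) (primitive d))
    = (\<lambda>J. of_nat (Suc i) * (of_nat m - of_nat d - of_nat i) * (up m ^^ Suc i) (primitive d) J :: 'f::field)"
  unfolding casimir_def down_up_primitive[OF assms] up_down_linear by simp

text \<open>Applying \<open>down\<close> returns a non-zero multiple of the previous power.\<close>

lemma up_pow_primitive_nonzero:
  assumes "d \<le> m" "\<And>j. j < i \<Longrightarrow> of_nat (Suc j) * (of_nat m - of_nat d - of_nat j) \<noteq> (0 :: 'f::field)"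
  shows "(up m ^^ i) (primitive d) \<noteq> (0 :: nat set \<Rightarrow> 'f)"
  using assms(2)
proof (induction i)
  case 0
  have "primitive d ((*) 2 ` {1..d}) \<noteq> (0 :: 'f)" by (simp add: primitive_def delta_def)
  then show ?case by (metis funpow_0 zero_fun_apply)
next
  case (Suc i)
  then obtain J where J: "(up m ^^ i) (primitive d) J \<noteq> (0 :: 'f)" by (auto simp: fun_eq_iff)
  have "down m ((up m ^^ Suc i) (primitive d)) J \<noteq> (0 :: 'f)"
    unfolding down_up_primitive[OF assms(1)] using J Suc.prems[of i] by simp
  then show ?case by (metis down_0 zero_fun_apply)
qed

section \<open>Decompositions\<close>

lemma two_nonzero:
  assumes "CHAR('f::field) \<noteq> 2" shows "(2 :: 'f) \<noteq> 0"
proof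
  assume "(2 :: 'f) = 0"
  then have "CHAR('f) dvd 2"
    by (metis of_nat_eq_0_iff_char_dvd of_nat_numeral)
  then have "CHAR('f) \<le> 2" by (rule dvd_imp_le) simp
  moreover have "CHAR('f) \<noteq> 0"
    using \<open>CHAR('f) dvd 2\<close> by (metis dvd_0_left_iff zero_neq_numeral)
  moreover have "CHAR('f) \<noteq> 1" by simp
  ultimately show False using assms by linarith
qed

lemma rep_vec_diff: "rep n p (u - v) = rep n p u - rep n p v"
  using rep_vec_add[of n p "u - v" v] by (simp add: algebra_simps)

context specht_presentation
begin

lemma invariantD:
  assumes "invariant A"
  shows "A \<subseteq> W" "0 \<in> A" "u \<in> A \<Longrightarrow> v \<in> A \<Longrightarrow> u + v \<in> A" "p \<in> C \<Longrightarrow> v \<in> A \<Longrightarrow> rep n p v \<in> A"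
    "v \<in> A \<Longrightarrow> (\<lambda>J. c * v J) \<in> A" "u \<in> A \<Longrightarrow> v \<in> A \<Longrightarrow> u - v \<in> A"
proof -
  show 1: "A \<subseteq> W" "0 \<in> A" and add: "u \<in> A \<Longrightarrow> v \<in> A \<Longrightarrow> u + v \<in> A" and rep: "p \<in> C \<Longrightarrow> v \<in> A \<Longrightarrow> rep n p v \<in> A" for u v p
    using assms unfolding invariant_def by blast+
  show scale: "v \<in> A \<Longrightarrow> (\<lambda>J. c * v J) \<in> A" for c v
    using rep[OF scalar_closed, of v c] by (simp only: rep_scalar)
  show "u \<in> A \<Longrightarrow> v \<in> A \<Longrightarrow> u - v \<in> A" for u v
  proof -
    assume "u \<in> A" "v \<in> A"
    then have "u + (\<lambda>J. (- 1) * v J) \<in> A" by (intro add scale)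
    moreover have "u + (\<lambda>J. (- 1) * v J) = u - v" by (simp add: fun_eq_iff)
    ultimately show "u - v \<in> A" by (simp only:)
  qed
qed

text \<open>\<open>A\<close> is the part on which \<open>casimir m\<close> is nilpotent,
  \<open>B\<close> the part on which it is invertible. Both are submodules because
  \<open>casimir m\<close> commutes with the algebra; \<open>primitive b\<close> lies in
  \<open>A\<close>, and an eigenvector with non-zero eigenvalue shows that \<open>B\<close> is
  non-zero.\<close>

lemma decomposable_odd:
  assumes n: "n = 2 * m + 1" and bm: "2 \<le> b" "b \<le> m" and two: "(2 :: 'f) \<noteq> 0"
    and nondeg: "b \<ge> 4 \<or> (of_nat (m - b + 2) :: 'f) \<noteq> 0"
  shows "\<not> indecomposable H S"
proof -
  interpret linear_operator "casimir m" by (rule linear_operator_casimir)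
  define cs where "cs = map (\<lambda>i. of_nat i * (of_nat m - of_nat b + of_nat i + 1) :: 'f) [0..<Suc (b div 2)]"
  define ds where "ds = filter (\<lambda>c. c \<noteq> 0) cs"
  define s where "s = length cs"
  define A where "A = {v \<in> W. (casimir m ^^ s) v = 0}"
  define B where "B = {v \<in> W. factors (casimir m) ds v = 0}"
  have rep_T: "casimir m (rep n p v) = rep n p (casimir m v)" if "p \<in> C" for p v
    using casimir_rep[of p m v] that by (simp only: n)
  have rep_pow: "(casimir m ^^ k) (rep n p v) = rep n p ((casimir m ^^ k) v)" if "p \<in> C" for p v k
    by (induction k) (simp_all only: funpow.simps o_apply id_apply rep_T[OF that])
  have rep_factors: "factors (casimir m) l (rep n p v) = rep n p (factors (casimir m) l v)" if "p \<in> C" for p v l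
  proof (induction l arbitrary: v)
    case (Cons c l)
    have "casimir m (rep n p v) - (\<lambda>J. c * rep n p v J) = rep n p (casimir m v - (\<lambda>J. c * v J))"
      by (simp only: rep_T[OF that] rep_vec_diff rep_vec_scale)
    then show ?case by (simp only: factors.simps Cons.IH)
  qed simp
  note sub = subspace_fock[of n b]
  have inv: "invariant A" "invariant B"
    unfolding invariant_def A_def B_def
    using fv.subspace_0[OF sub] fv.subspace_add[OF sub]
    by (auto simp only: pow_linear factors_zero factors_add mem_Collect_eq rep_pow rep_factors rep_vec_zero
        intro!: rep_fock)
      (simp_all only: add_0_left)
  have TW: "casimir m w \<in> W" if "w \<in> W" for w using that casimir_fock[of w m b] by (simp only: n)
  have ds: "0 \<notin> set ds" by (simp add: ds_def)
  have sum: "\<exists>u\<in>A. \<exists>v\<in>B. w = u + v" if w: "w \<in> W" for w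
  proof -
    have "factors (casimir m) ds ((casimir m ^^ s) w) = 0"
      unfolding ds_def s_def cs_def by (rule factors_split[OF casimir_annihilated]) (use w n in simp)
    from fitting_sum[OF sub TW ds w this] show ?thesis unfolding A_def B_def by blast
  qed
  have int: "A \<inter> B = {0}"
    using fitting_disjoint[OF ds] invariantD(2)[OF inv(1)] invariantD(2)[OF inv(2)] unfolding A_def B_def by blast
  have "primitive b \<in> A"
  proof -
    obtain s' where s: "s = Suc s'" by (simp add: s_def cs_def)
    have "(casimir m ^^ s) (primitive b) = 0"
      by (simp only: s funpow_Suc_right o_apply casimir_primitive pow_linear)
    then show ?thesis using primitive_fock[OF bm(2)] by (simp add: A_def n)
  qed
  moreover have "primitive b \<noteq> (0 :: nat set \<Rightarrow> 'f)"
    using up_pow_primitive_nonzero[OF bm(2), of 0] by simp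
  ultimately have A: "A \<noteq> {0}" by blast
  have "\<exists>e\<in>W. \<exists>c. e \<noteq> 0 \<and> c \<noteq> 0 \<and> casimir m e = (\<lambda>J. c * e J)"
  proof (cases "(of_nat (m - b + 2) :: 'f) = 0")
    case False
    \<comment> \<open>One \<open>up\<close> from \<open>primitive (b - 2)\<close> has the eigenvalue
      \<open>m - b + 2\<close>.\<close>
    have c: "of_nat (Suc 0) * (of_nat m - of_nat (b - 2) - of_nat 0) \<noteq> (0 :: 'f)"
      using False bm by (simp add: of_nat_diff algebra_simps)
    have d: "b - 2 \<le> m" using bm by simp
    have "(up m ^^ Suc 0) (primitive (b - 2)) \<noteq> (0 :: nat set \<Rightarrow> 'f)"
      by (rule up_pow_primitive_nonzero[OF d]) (use c in auto)
    moreover have "(up m ^^ Suc 0) (primitive (b - 2)) \<in> W"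
    proof -
      have "b - 2 + 2 * Suc 0 = b" using bm by simp
      then show ?thesis using up_pow_fock[OF primitive_fock[OF d], of "Suc 0"] by (simp only: n)
    qed
    ultimately show ?thesis using casimir_up_primitive[OF d, of 0] c by blast
  next
    case True
    then have b4: "b \<ge> 4" using nondeg by simp
    have d: "b - 4 \<le> m" using bm by simp
    \<comment> \<open>If \<open>m - b + 2\<close> vanishes, two \<open>up\<close> from
      \<open>primitive (b - 4)\<close> meet the coefficients \<open>1 * 2\<close> and
      \<open>2 * 1\<close>. The second is the eigenvalue; both are non-zero since the characteristic
      is not 2.\<close>
    have e: "of_nat m - of_nat (b - 4) = (2 :: 'f)"
    proof -
      have "of_nat m - of_nat b + 2 = (0 :: 'f)" using True bm by (simp add: of_nat_diff add.commute)
      moreover have "of_nat (b - 4) = (of_nat b - 4 :: 'f)" using b4 by (simp add: of_nat_diff)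
      moreover have "x - (y - 4) = x - y + 2 + 2" for x y :: 'f
        by (simp add: add.assoc)
      ultimately show ?thesis by (simp only: add_0_left)
    qed
    have one: "2 - 1 = (1 :: 'f)" by (simp only: one_add_one[symmetric] add_diff_cancel_left')
    have c: "of_nat (Suc j) * (of_nat m - of_nat (b - 4) - of_nat j) \<noteq> (0 :: 'f)" if "j < Suc (Suc 0)" for j
      unfolding e using that two one by (cases j) auto
    have "(up m ^^ Suc (Suc 0)) (primitive (b - 4)) \<noteq> (0 :: nat set \<Rightarrow> 'f)"
      by (rule up_pow_primitive_nonzero[OF d c])
    moreover have "(up m ^^ Suc (Suc 0)) (primitive (b - 4)) \<in> W"
    proof -
      have "b - 4 + 2 * Suc (Suc 0) = b" using b4 by simp
      then show ?thesis using up_pow_fock[OF primitive_fock[OF d], of "Suc (Suc 0)"] by (simp only: n)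
    qed
    ultimately show ?thesis using casimir_up_primitive[OF d, of "Suc 0"] c[of "Suc 0"] by blast
  qed
  then obtain e c where e: "e \<in> W" "e \<noteq> 0" "c \<noteq> 0" "casimir m e = (\<lambda>J. c * e J)" by blast
  have pow: "(casimir m ^^ k) e = (\<lambda>J. c ^ k * e J)" for k
  proof (induction k)
    case (Suc k)
    then have "(casimir m ^^ Suc k) e = (\<lambda>J. c ^ k * casimir m e J)"
      by (simp only: funpow.simps o_apply casimir_linear)
    also have "\<dots> = (\<lambda>J. c ^ Suc k * e J)"
      by (simp only: e(4) power_Suc2 mult.assoc)
    finally show ?case .
  qed simp
  have B: "B \<noteq> {0}"
  proof
    assume "B = {0}"
    then obtain u where "u \<in> A" "e = u + 0" using sum[OF e(1)] by blast
    then have "(casimir m ^^ s) e = 0" by (simp add: A_def)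
    then have "c ^ s * e J = 0" for J using pow[of s] by (metis zero_fun_apply)
    then have "e = 0" using e(3) by (simp add: fun_eq_iff)
    with e(2) show False by simp
  qed
  show ?thesis
  proof
    assume "indecomposable H S"
    then have "invariant A \<longrightarrow> invariant B \<longrightarrow> (\<forall>w\<in>W. \<exists>u\<in>A. \<exists>v\<in>B. w = u + v) \<longrightarrow> A \<inter> B = {0}
        \<longrightarrow> A = {0} \<or> B = {0}"
      unfolding indecomposable_iff by (elim allE)
    moreover have "\<forall>w\<in>W. \<exists>u\<in>A. \<exists>v\<in>B. w = u + v" using sum by (intro ballI)
    ultimately show False using inv int A B by (simp only: simp_thms)
  qed
qed

text \<open>The coefficient of a set with maximum \<open>p > b + 1\<close> is determined, via \<open>act_psi p\<close>, by that of a set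
  with maximum \<open>p + 2\<close>.\<close>

lemma specht_vector_top:
  assumes v: "v \<in> W" and psi: "\<And>j. 1 \<le> j \<Longrightarrow> j < n \<Longrightarrow> j \<noteq> b + 1 \<Longrightarrow> act_psi j v = 0"
    and top: "\<And>J. n \<in> J \<Longrightarrow> b + 1 < n \<Longrightarrow> v J = 0"
    and J: "v J \<noteq> 0" "p \<in> J" "\<And>x. x \<in> J \<Longrightarrow> x \<le> p"
  shows "p \<le> b + 1"
  using J
proof (induction "n - p" arbitrary: J p rule: less_induct)
  case less
  show ?case
  proof (rule ccontr)
    assume pb: "\<not> p \<le> b + 1"
    have "J \<subseteq> {2..n}" using v less.prems(1) by (auto simp: fock_def)
    then have p2: "2 \<le> p" "p \<le> n" using less.prems(2) by auto
    then have "p \<noteq> n" using top[of J] less.prems pb by auto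
    then have pn: "p < n" using p2 by simp
    define J' where "J' = put (p + 1) True (put p False J)"
    have above: "p + 1 \<notin> J" "p + 2 \<notin> J" using less.prems(3)[of "p + 1"] less.prems(3)[of "p + 2"] by auto
    have back_J: "put p True (put (p + 1) False J') = J"
      using less.prems(2) above by (auto simp: J'_def put_def)
    have hop: "hop p (p + 1) v J' = v J"
      unfolding hop_def back_J by (simp add: J'_def)
    have zero: "act_psi p v J' = 0"
      using psi[of p] pn pb p2 by simp
    show False
    proof (cases "even p")
      case True
      then show False using zero hop less.prems(1) by (simp add: act_psi_def)
    next
      case False
      have "hop (p + 2) (p - 1) v J' \<noteq> 0"
        using zero hop less.prems(1) False p2 unfolding act_psi_def by auto
      then have *: "p - 1 \<in> J'" "v (put (p + 2) True (put (p - 1) False J')) \<noteq> 0"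
        by (auto simp: hop_def split: if_splits)
      let ?J = "put (p + 2) True (put (p - 1) False J')"
      have "?J \<subseteq> {2..n}" using v *(2) by (auto simp: fock_def)
      then have "p + 2 \<le> n" by (auto simp: put_def)
      moreover have "x \<le> p + 2" if "x \<in> ?J" for x
        using that less.prems(3)[of x] by (auto simp: J'_def split: if_splits)
      ultimately have "p + 2 \<le> b + 1"
        using less.hyps[of "p + 2" ?J] *(2) by simp
      then show False using pb by simp
    qed
  qed
qed

text \<open>\<open>{2..b + 1}\<close> is the only subset of \<open>{2..b + 1}\<close> with
  \<open>b\<close> elements, and \<open>specht_vector_top\<close> confines the support to such
  subsets. The guard \<open>b + 1 < n\<close> exempts the case in which the initial set itself
  contains \<open>n\<close>.\<close>

lemma specht_vector_unique:
  assumes v: "v \<in> W" and psi: "\<And>j. 1 \<le> j \<Longrightarrow> j < n \<Longrightarrow> j \<noteq> b + 1 \<Longrightarrow> act_psi j v = 0"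
    and top: "\<And>J. n \<in> J \<Longrightarrow> b + 1 < n \<Longrightarrow> v J = 0"
  shows "v = (\<lambda>J. v {2..b + 1} * z0 J)"
proof
  fix J
  show "v J = v {2..b + 1} * z0 J"
  proof (cases "v J = 0 \<or> J = {2..b + 1}")
    case True
    then show ?thesis by (auto simp: delta_def)
  next
    case False
    then have J: "J \<subseteq> {2..n}" "card J = b" using v by (auto simp: fock_def)
    then have fin: "finite J" using finite_subset by blast
    moreover have "J \<noteq> {}" using J(2) b by auto
    ultimately have "Max J \<le> b + 1"
      using False by (intro specht_vector_top[OF v psi top, of J]) auto
    then have "2 \<le> x \<and> x \<le> b + 1" if "x \<in> J" for x
      using subsetD[OF J(1) that] Max_ge[OF fin that] by simp
    then have "J \<subseteq> {2..b + 1}" by auto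
    moreover have "card J = card {2..b + 1}" using J(2) by simp
    ultimately have "J = {2..b + 1}" by (intro card_subset_eq) auto
    then show ?thesis using False by simp
  qed
qed

section \<open>Components of the generator in a direct sum\<close>

lemma summand_killed:
  assumes A: "invariant A" and B: "invariant B" and int: "A \<inter> B = {0}"
    and uv: "u \<in> A" "v \<in> B" "z0 = u + v" and p: "p \<in> C" "rep n p z0 = 0"
  shows "rep n p u = 0"
proof -
  have "rep n p u + rep n p v = 0" using p(2) by (simp only: uv(3) rep_vec_add)
  then have "rep n p u = 0 - rep n p v" by (metis add_diff_cancel_right')
  then have "rep n p u \<in> B" using invariantD(6)[OF B invariantD(2)[OF B] invariantD(4)[OF B p(1) uv(2)]] by (simp only:)
  then show ?thesis using invariantD(4)[OF A p(1) uv(1)] int by blast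
qed

lemma summand_specht_vector:
  assumes A: "invariant A" and B: "invariant B" and int: "A \<inter> B = {0}"
    and uv: "u \<in> A" "v \<in> B" "z0 = u + v"
  shows "u \<in> W" "\<And>j. 1 \<le> j \<Longrightarrow> j < n \<Longrightarrow> j \<noteq> b + 1 \<Longrightarrow> act_psi j u = 0"
    "\<And>k. 1 \<le> k \<Longrightarrow> k \<le> n \<Longrightarrow> act_y k u = 0" "\<And>J. u J \<noteq> 0 \<Longrightarrow> seq n J = seq n {2..b + 1}"
proof -
  note killed = summand_killed[OF A B int uv]
  show "u \<in> W" using invariantD(1)[OF A] uv(1) by blast
  show "act_psi j u = 0" if "1 \<le> j" "j < n" "j \<noteq> b + 1" for j
  proof -
    have "psigen j \<in> C" by (rule psigen_closed) (use that in simp)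
    moreover have "rep n (psigen j) z0 = 0" by (simp only: rep_gen act.simps act_psi_z0[OF that(1,3)])
    ultimately have "rep n (psigen j) u = 0" by (rule killed)
    then show ?thesis by (simp only: rep_gen act.simps)
  qed
  show "act_y k u = 0" if "1 \<le> k" "k \<le> n" for k
  proof -
    have "ygen k \<in> C" by (rule ygen_closed) (use that in simp)
    moreover have "rep n (ygen k) z0 = 0" by (simp only: rep_gen act.simps act_y_z0[OF that(1)])
    ultimately have "rep n (ygen k) u = 0" by (rule killed)
    then show ?thesis by (simp only: rep_gen act.simps)
  qed
  let ?i = "seq n {2..b + 1}"
  have i: "?i \<in> res_seqs n" by (rule seq_in_res_seqs)
  have "egen ?i - 1 \<in> C" by (intro free_algebra_diff_closed egen_closed[OF i] one_in_free_algebra)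
  moreover have "act_e n ?i z0 = z0" by (auto simp: fun_eq_iff act_e_def delta_def)
  then have "rep n (egen ?i - 1) z0 = 0" by (simp only: rep_diff rep_gen act.simps rep_one diff_self)
  ultimately have "rep n (egen ?i - 1) u = 0" by (rule killed)
  then have "act_e n ?i u = u" by (simp only: rep_diff rep_gen act.simps rep_one right_minus_eq)
  then show "seq n J = seq n {2..b + 1}" if "u J \<noteq> 0" for J
  proof -
    have "act_e n ?i u J \<noteq> 0" using that by (simp only: \<open>act_e n ?i u = u\<close> simp_thms)
    then show ?thesis by (simp only: act_e_def split: if_splits) simp
  qed
qed

text \<open>It suffices to look at the components of the generator: a summand that is all of
  \<open>W\<close> meets the other one only in 0.\<close>

lemma indecomposableI:
  assumes "\<And>A B u v. invariant A \<Longrightarrow> invariant B \<Longrightarrow> A \<inter> B = {0} \<Longrightarrow> u \<in> A \<Longrightarrow> v \<in> B \<Longrightarrow> z0 = u + v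
    \<Longrightarrow> W \<subseteq> A \<or> W \<subseteq> B"
  shows "indecomposable H S"
  unfolding indecomposable_iff
proof (intro allI impI)
  fix A B assume A: "invariant A" and B: "invariant B" and sum: "\<forall>w\<in>W. \<exists>u\<in>A. \<exists>v\<in>B. w = u + v" and int: "A \<inter> B = {0}"
  obtain u v where "u \<in> A" "v \<in> B" "z0 = u + v" using bspec[OF sum z0_fock] by blast
  then have "W \<subseteq> A \<or> W \<subseteq> B" using assms[OF A B int] by blast
  then show "A = {0} \<or> B = {0}"
    using invariantD(1)[OF A] invariantD(1)[OF B] int by blast
qed

lemma invariant_full:
  assumes A: "invariant A" and u: "(\<lambda>J. c * z0 J) \<in> A" "c \<noteq> 0"
  shows "W \<subseteq> A"
proof
  fix w assume "w \<in> W"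
  then obtain p where p: "p \<in> C" "w = rep n p z0" unfolding ev_surj ev_def by blast
  have "(\<lambda>J. (1 / c) * (c * z0 J)) \<in> A" by (rule invariantD(5)[OF A u(1)])
  moreover have "(\<lambda>J. (1 / c) * (c * z0 J)) = z0" using u(2) by (simp add: fun_eq_iff)
  ultimately have "z0 \<in> A" by (simp only:)
  then show "w \<in> A" using invariantD(4)[OF A p(1)] p(2) by (simp only:)
qed

lemma z0_init: "z0 {2..b + 1} = 1"
  by (simp add: delta_def)

text \<open>The residue at the odd position \<open>n - 1\<close> is the parity of the number of leg
  entries up to \<open>n - 1\<close>. It is that of \<open>b\<close> for the initial set, but that
  of \<open>b - 1\<close> for a set containing \<open>n\<close>, if \<open>b + 1 < n\<close>. So a
  Specht vector vanishes on the latter, as \<open>specht_vector_unique\<close> demands.\<close>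

lemma indecomposable_even:
  assumes "even n" shows "indecomposable H S"
proof (rule indecomposableI)
  fix A B u v assume A: "invariant A" and B: "invariant B" and int: "A \<inter> B = {0}" and uv: "u \<in> A" "v \<in> B" "z0 = u + v"
  have multiple: "x = (\<lambda>J. x {2..b + 1} * z0 J)"
    if "invariant X" "invariant X'" "X \<inter> X' = {0}" "x \<in> X" "x' \<in> X'" "z0 = x + x'" for X X' x x'
  proof (rule specht_vector_unique)
    note x = summand_specht_vector[OF that]
    show "x \<in> W" by (rule x(1))
    show "act_psi j x = 0" if "1 \<le> j" "j < n" "j \<noteq> b + 1" for j by (rule x(2)[OF that])
    fix J assume J: "n \<in> J" "b + 1 < n"
    show "x J = 0"
    proof (rule ccontr)
      assume nz: "x J \<noteq> 0"
      have "entry (seq n J) (n - 1) = entry (seq n {2..b + 1}) (n - 1)" by (simp only: x(4)[OF nz])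
      then have "wt J (n - 1) = wt {2..b + 1} (n - 1)"
        using n_gt by (simp only: entry_seq[of "n - 1" n J] entry_seq[of "n - 1" n "{2..b + 1}"])
      moreover have odd: "odd (n - 1)" using assms n_gt by simp
      moreover have inter: "{2..b + 1} \<inter> {2..n - 1} = {2..b + 1}" using J(2) by auto
      ultimately have parity: "card (J \<inter> {2..n - 1}) mod 2 = b mod 2"
        unfolding wt_def if_P[OF odd] inter by simp
      have J2: "J \<subseteq> {2..n}" "card J = b" using x(1) nz by (auto simp: fock_def)
      have "x = n \<or> x \<in> {2..n - 1}" if "x \<in> J" for x
        using subsetD[OF J2(1) that] by auto
      then have "J = insert n (J \<inter> {2..n - 1})" using J(1) by blast
      moreover have "card (insert n (J \<inter> {2..n - 1})) = Suc (card (J \<inter> {2..n - 1}))"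
        by (rule card_insert_disjoint) (use n_gt in auto)
      ultimately have "b = Suc (card (J \<inter> {2..n - 1}))" using J2(2) by simp
      then show False using parity by presburger
    qed
  qed
  have u: "u = (\<lambda>J. u {2..b + 1} * z0 J)" by (rule multiple[OF A B int uv])
  have v: "v = (\<lambda>J. v {2..b + 1} * z0 J)"
    by (rule multiple[OF B A _ uv(2,1)]) (use int uv(3) in \<open>auto simp: add.commute Int_commute\<close>)
  have "u {2..b + 1} + v {2..b + 1} = 1"
    using fun_cong[OF uv(3), of "{2..b + 1}"] by (simp only: z0_init plus_fun_apply)
  then have "u {2..b + 1} \<noteq> 0 \<or> v {2..b + 1} \<noteq> 0" by auto
  then show "W \<subseteq> A \<or> W \<subseteq> B"
    using invariant_full[OF A, of "u {2..b + 1}"] invariant_full[OF B, of "v {2..b + 1}"] uv(1,2) u v by (simp only:) blast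
qed

text \<open>For \<open>n = 2 * m + 1\<close> the set \<open>({2..b + 1} - {2, 3}) \<union> {2 * m, 2 * m + 1}\<close> is the only one containing \<open>n\<close> on which a Specht
  vector may be non-zero. Its coefficient detects \<open>casimir m z0\<close>.\<close>

lemma down_z0_hook:
  assumes "b = 2 \<or> b = 3" "m \<ge> 2"
  shows "down m z0 ({2..b + 1} - {2, 3}) = 1"
proof -
  let ?K = "{2..b + 1} - {2, 3}"
  have K: "?K \<subseteq> {4}" using assms(1) by auto
  have "drop_pair l z0 ?K = (if l = 1 then 1 else 0)" if "l \<in> {1..m}" for l
  proof (cases "l = 1")
    case True
    have "put 2 True (put 3 True ?K) = {2..b + 1}" using assms(1) by (auto simp: put_def)
    then show ?thesis using True by (simp add: drop_pair_def delta_def)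
  next
    case False
    then have "2 \<notin> put (2 * l) True (put (2 * l + 1) True ?K)" using that by auto
    moreover have "2 \<in> {2..b + 1}" using assms(1) by auto
    ultimately have "put (2 * l) True (put (2 * l + 1) True ?K) \<noteq> {2..b + 1}" by blast
    then show ?thesis using False by (simp add: drop_pair_def delta_def)
  qed
  then have "down m z0 ?K = (\<Sum>l=1..m. if l = 1 then 1 else 0 :: 'f)"
    unfolding down_def by (intro sum.cong refl)
  then show ?thesis using assms(2) by simp
qed

text \<open>The last pair is the only complete pair in this set, since what remains is empty or
  \<open>{4}\<close>; so a single term of \<open>up\<close> contributes.\<close>

lemma casimir_z0_last:
  assumes "b = 2 \<or> b = 3" "b \<le> m"
  shows "casimir m z0 (({2..b + 1} - {2, 3}) \<union> {2 * m, 2 * m + 1}) = 1"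
proof -
  let ?K = "{2..b + 1} - {2, 3}"
  let ?J = "?K \<union> {2 * m, 2 * m + 1}"
  have K: "?K \<subseteq> {4}" "b = 2 \<Longrightarrow> ?K = {}" using assms(1) by auto
  have "add_pair k (down m z0) ?J = (if k = m then 1 else 0)" if "k \<in> {1..m}" for k
  proof (cases "k = m")
    case True
    have "2 * m \<notin> ?K" "2 * m + 1 \<notin> ?K" using K assms by auto
    then have "put (2 * m) False (put (2 * m + 1) False ?J) = ?K"
      unfolding put_def by auto
    moreover have "down m z0 ?K = 1" by (rule down_z0_hook) (use assms in auto)
    ultimately show ?thesis using True by (simp only: add_pair_def) simp
  next
    case False
    have "2 * k + 1 \<noteq> 4" by presburger
    then have "2 * k + 1 \<notin> ?K" using K(1) by blast
    moreover have "2 * k + 1 \<noteq> 2 * m" by presburger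
    ultimately have "2 * k + 1 \<notin> ?J" using False by auto
    then show ?thesis using False by (simp only: add_pair_def) simp
  qed
  then have "casimir m z0 ?J = (\<Sum>k=1..m. if k = m then 1 else 0 :: 'f)"
    unfolding casimir_def up_def by (intro sum.cong refl)
  moreover have "1 \<le> m" using assms by auto
  ultimately show ?thesis by simp
qed

text \<open>\<open>down m v\<close> has degree \<open>b - 2 < 2\<close>, so a second
  \<open>down\<close> kills it, and on that degree the commutator is the scalar
  \<open>m - (b - 2)\<close>, which vanishes.\<close>

lemma casimir_sq_zero:
  assumes n: "n = 2 * m + 1" and b: "b = 2 \<or> b = 3" "b \<le> m" and char: "(of_nat (m - b + 2) :: 'f) = 0" and v: "v \<in> W"
  shows "casimir m (casimir m v) = 0"
proof -
  obtain d where d: "b = d + 2" "d < 2" using b(1) by (cases "b = 2") auto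
  have w: "down m v \<in> fock (2 * m + 1) d" using v by (intro down_fock) (simp only: n d)
  have "of_nat m - of_nat d = (0 :: 'f)" using char b(2) d by (simp add: of_nat_diff algebra_simps)
  then have "down m (up m (down m v)) = up m (down m (down m v)) + (\<lambda>J. 0 * down m v J)"
    using down_up[OF w] by (simp only:)
  also have "\<dots> = 0" by (simp only: down_zero[OF w d(2)] up_zero) (simp add: fun_eq_iff)
  finally show ?thesis by (simp only: casimir_def up_zero)
qed

lemma indecomposable_odd:
  assumes n: "n = 2 * m + 1" and b: "b = 2 \<or> b = 3" "b \<le> m" and char: "(of_nat (m - b + 2) :: 'f) = 0"
  shows "indecomposable H S"
proof (rule indecomposableI)
  fix A B u v assume A: "invariant A" and B: "invariant B" and int: "A \<inter> B = {0}" and uv: "u \<in> A" "v \<in> B" "z0 = u + v"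
  interpret linear_operator "casimir m" by (rule linear_operator_casimir)
  let ?T = "casimir m :: (nat set \<Rightarrow> 'f) \<Rightarrow> nat set \<Rightarrow> 'f"
  define K where "K = {2..b + 1} - {2, 3}"
  define J1 where "J1 = K \<union> {2 * m, 2 * m + 1}"
  have T_J1: "?T z0 J1 = 1" unfolding J1_def K_def by (rule casimir_z0_last[OF b])
  have T_W: "?T w \<in> W" if "w \<in> W" for w using that casimir_fock[of w m b] by (simp only: n)
  have T_rep: "?T (rep n p w) = rep n p (?T w)" if "p \<in> C" for p w using casimir_rep[of p m w] that by (simp only: n)
  have T_gen: "?T (act n g w) = act n g (?T w)" if "g \<in> klr_gens n" for g w
    unfolding casimir_def using that by (simp only: n up_down_act)
  have T_psi: "act_psi j (?T z0) = 0" if "1 \<le> j" "j < n" "j \<noteq> b + 1" for j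
  proof -
    have "Psi j \<in> klr_gens n" using that by (simp add: klr_gens_def)
    then have "act_psi j (?T z0) = ?T (act_psi j z0)" using T_gen[of "Psi j" z0] by (simp only: act.simps)
    then show ?thesis by (simp only: act_psi_z0[OF that(1,3)] T_zero)
  qed
  have T_y: "act_y k (?T z0) = 0" if "1 \<le> k" "k \<le> n" for k
  proof -
    have "Y k \<in> klr_gens n" using that by (simp add: klr_gens_def)
    then have "act_y k (?T z0) = ?T (act_y k z0)" using T_gen[of "Y k" z0] by (simp only: act.simps)
    then show ?thesis by (simp only: act_y_z0[OF that(1)] T_zero)
  qed
  \<comment> \<open>The vanishing of the \<open>y\<close> forces the last pair to be complete, which
    settles \<open>b = 2\<close>. For \<open>b = 3\<close> the third element is excluded from
    \<open>{2, 3}\<close> by the residue at 3, forced into \<open>{4, 5}\<close> by the residue at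
    5, and cannot be 5 by the condition on the \<open>y\<close>.\<close>
  have last: "J = J1" if J: "n \<in> J" "J \<subseteq> {2..n}" "card J = b" "seq n J = seq n {2..b + 1}"
    and y: "\<And>k. 2 \<le> k \<Longrightarrow> k \<le> m \<Longrightarrow> 2 * k + 1 \<in> J \<Longrightarrow> 2 * k \<in> J" for J
  proof -
    have m: "2 \<le> m" using b by auto
    have J2: "2 * m + 1 \<in> J" "2 * m \<in> J" using J(1) y[of m] m by (auto simp: n)
    have fin: "finite J" using J(2) finite_subset by blast
    show ?thesis
    proof (cases "b = 2")
      case True
      have "J = {2 * m, 2 * m + 1}"
        using J2 J(3) True fin by (intro card_subset_eq[symmetric]) auto
      then show ?thesis using True by (auto simp: J1_def K_def)
    next
      case False
      then have b3: "b = 3" "m \<ge> 3" using b by auto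
      have "card (J - {2 * m, 2 * m + 1}) = 1"
        using J2 J(3) b3 fin by (subst card_Diff_subset) auto
      then obtain j where j: "J - {2 * m, 2 * m + 1} = {j}" by (auto simp: card_1_singleton_iff)
      then have Jj: "J = {j, 2 * m, 2 * m + 1}" "j \<noteq> 2 * m" "j \<noteq> 2 * m + 1" using J2 by blast+
      have wts: "card (J \<inter> {2..r}) mod 2 = card ({2..4::nat} \<inter> {2..r}) mod 2" if r: "r = 3 \<or> r = 5" for r
      proof -
        have "entry (seq n J) r = entry (seq n {2..b + 1}) r" by (simp only: J(4))
        moreover have "1 \<le> r" "r \<le> n" using r b3 n by auto
        ultimately have "wt J r = wt {2..b + 1} r"
          by (simp only: entry_seq[of r n J] entry_seq[of r n "{2..b + 1}"])
        then show ?thesis using r b3 by (auto simp: wt_def)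
      qed
      have rest: "J \<inter> {2..r} = {j} \<inter> {2..r}" if "r \<le> 5" for r
        using Jj(1) b3 that by auto
      have "j \<notin> {2..3}"
      proof
        assume "j \<in> {2..3}"
        then have "card (J \<inter> {2..3}) = 1" using rest[of 3] by simp
        moreover have "{2..4::nat} \<inter> {2..3} = {2, 3}" by auto
        ultimately show False using wts[of 3] by simp
      qed
      moreover have "j \<in> {2..5}"
      proof (rule ccontr)
        assume "j \<notin> {2..5}"
        then have "card (J \<inter> {2..5}) = 0" using rest[of 5] by simp
        moreover have "{2..4::nat} \<inter> {2..5} = {2, 3, 4}" by auto
        ultimately show False using wts[of 5] by simp
      qed
      ultimately have "j = 4 \<or> j = 5" by auto
      moreover have "j \<noteq> 5" using y[of 2] Jj b3 by auto
      ultimately have "j = 4" by blast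
      moreover have "K = {4}" using b3 by (auto simp: K_def)
      ultimately show ?thesis using Jj(1) by (auto simp: J1_def)
    qed
  qed
  have form: "\<exists>c. x = (\<lambda>J. c * z0 J) + (\<lambda>J. x J1 * ?T z0 J)"
    if "invariant X" "invariant X'" "X \<inter> X' = {0}" "x \<in> X" "x' \<in> X'" "z0 = x + x'" for X X' x x'
  proof -
    note x = summand_specht_vector[OF that]
    \<comment> \<open>\<open>J1\<close> is the only set containing \<open>n\<close> on which
      \<open>x\<close> may be non-zero, and \<open>?T z0\<close> has the value 1 there. Subtracting
      this multiple makes \<open>specht_vector_unique\<close> applicable.\<close>
    define y where "y = x - (\<lambda>J. x J1 * ?T z0 J)"
    have y_W: "y \<in> W"
      unfolding y_def by (intro fv.subspace_diff fv.subspace_scale subspace_fock x(1) T_W z0_fock)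
    have y_ops: "act n g y = 0" if "g \<in> klr_gens n" "act n g x = 0" "act n g (?T z0) = 0" for g
    proof -
      have "rep n (gen g) y = 0"
        unfolding y_def by (simp only: rep_vec_diff rep_vec_scale rep_gen that(2,3)) (simp add: fun_eq_iff)
      then show ?thesis by (simp only: rep_gen)
    qed
    have y_psi: "act_psi j y = 0" if "1 \<le> j" "j < n" "j \<noteq> b + 1" for j
      using y_ops[of "Psi j"] x(2)[OF that] T_psi[OF that] that by (simp add: klr_gens_def)
    have y_y: "act_y k y = 0" if "1 \<le> k" "k \<le> n" for k
      using y_ops[of "Y k"] x(3)[OF that] T_y[OF that] that by (simp add: klr_gens_def)
    have T_seq: "seq n J = seq n {2..b + 1}" if "?T z0 J \<noteq> 0" for J
    proof -
      let ?i = "seq n {2..b + 1}"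
      have "act_e n ?i z0 = z0" by (auto simp: fun_eq_iff act_e_def delta_def)
      then have "act_e n ?i (?T z0) = ?T z0"
        using T_gen[of "E ?i" z0] seq_in_res_seqs[of n] by (simp add: klr_gens_def)
      then have "act_e n ?i (?T z0) J \<noteq> 0" using that by (simp only: simp_thms)
      then show ?thesis by (simp only: act_e_def split: if_splits) simp
    qed
    have "y J = 0" if J: "n \<in> J" "b + 1 < n" for J
    proof (rule ccontr)
      assume nz: "y J \<noteq> 0"
      have "J \<subseteq> {2..n}" "card J = b" using y_W nz by (auto simp: fock_def)
      moreover have "seq n J = seq n {2..b + 1}"
      proof (cases "x J = 0")
        case True
        then have "?T z0 J \<noteq> 0" using nz by (auto simp: y_def)
        then show ?thesis by (rule T_seq)
      qed (rule x(4))
      moreover have "2 * k \<in> J" if k: "2 \<le> k" "k \<le> m" "2 * k + 1 \<in> J" for k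
      proof (rule ccontr)
        assume k': "2 * k \<notin> J"
        \<comment> \<open>At the set with \<open>2 * k + 1\<close> replaced by \<open>2 * k\<close>,
          this operator returns minus the value at \<open>J\<close>.\<close>
        have "act_y (2 * k + 1) y (put (2 * k) True (put (2 * k + 1) False J)) = 0"
          using y_y[of "2 * k + 1"] k n by simp
        moreover have "put (2 * k + 1) True (put (2 * k) False (put (2 * k) True (put (2 * k + 1) False J))) = J"
          using k k' by (auto simp: put_def)
        ultimately show False
          using nz k unfolding act_y_def hop_def by simp
      qed
      ultimately have "J = J1" using last[OF J(1)] by blast
      then show False using nz T_J1 by (simp add: y_def)
    qed
    from specht_vector_unique[OF y_W y_psi this]
    have "y = (\<lambda>J. y {2..b + 1} * z0 J)" .
    moreover have "x = y + (\<lambda>J. x J1 * ?T z0 J)" by (simp add: y_def)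
    ultimately have "x = (\<lambda>J. y {2..b + 1} * z0 J) + (\<lambda>J. x J1 * ?T z0 J)" by (simp only:)
    then show ?thesis by blast
  qed
  note sq = casimir_sq_zero[OF n b char]
  have full: "W \<subseteq> X"
    if X: "invariant X" and x: "x \<in> X" "x = (\<lambda>J. c * z0 J) + (\<lambda>J. d * ?T z0 J)" and c: "c \<noteq> 0" for X x c d
  proof
    fix w assume w: "w \<in> W"
    \<comment> \<open>Since \<open>?T\<close> squares to zero on \<open>W\<close>, this is the
      inverse of \<open>c + d ?T\<close> applied to \<open>w\<close>.\<close>
    define w' where "w' = (\<lambda>J. (1 / c) * (w - (\<lambda>J. (d / c) * ?T w J)) J)"
    have "w' \<in> W"
      unfolding w'_def by (intro fv.subspace_diff fv.subspace_scale subspace_fock w T_W)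
    then obtain p where p: "p \<in> C" "w' = rep n p z0" unfolding ev_surj ev_def by blast
    have "rep n p x = (\<lambda>J. c * w' J) + (\<lambda>J. d * ?T w' J)"
      by (simp only: x(2) rep_vec_add rep_vec_scale T_rep[OF p(1), symmetric] p(2)[symmetric])
    also have "?T w' = (\<lambda>J. (1 / c) * ?T w J)"
      unfolding w'_def T_scale T_diff sq[OF w] by (simp add: fun_eq_iff)
    also have "(\<lambda>J. c * w' J) + (\<lambda>J. d * ((1 / c) * ?T w J)) = w"
      using c by (simp add: w'_def fun_eq_iff field_simps)
    finally show "w \<in> X" using invariantD(4)[OF X p(1) x(1)] by (simp only:)
  qed
  obtain c d where u: "u = (\<lambda>J. c * z0 J) + (\<lambda>J. d * ?T z0 J)" using form[OF A B int uv] by blast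
  have vu: "z0 = v + u" using uv(3) by (simp only: add.commute)
  have "B \<inter> A = {0}" using int by blast
  from form[OF B A this uv(2,1) vu]
  obtain c' d' where v: "v = (\<lambda>J. c' * z0 J) + (\<lambda>J. d' * ?T z0 J)" by blast
  \<comment> \<open>Otherwise \<open>z0\<close> would be a multiple of \<open>?T z0\<close>, and
    \<open>?T z0\<close> would vanish, against its value 1 at \<open>J1\<close>.\<close>
  have "c \<noteq> 0 \<or> c' \<noteq> 0"
  proof (rule ccontr)
    assume "\<not> (c \<noteq> 0 \<or> c' \<noteq> 0)"
    then have "u = (\<lambda>J. d * ?T z0 J)" "v = (\<lambda>J. d' * ?T z0 J)" using u v by (simp_all add: fun_eq_iff)
    then have "?T u = (\<lambda>J. d * ?T (?T z0) J)" "?T v = (\<lambda>J. d' * ?T (?T z0) J)" by (simp_all only: T_scale)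
    then have "?T u J1 = 0" "?T v J1 = 0" by (simp_all only: sq[OF z0_fock]) simp_all
    moreover have "?T z0 = ?T u + ?T v" unfolding uv(3) by (rule T_add)
    ultimately have "?T z0 J1 = 0" by simp
    then show False using T_J1 by simp
  qed
  then show "W \<subseteq> A \<or> W \<subseteq> B"
    using full[OF A uv(1) u] full[OF B uv(2) v] by blast
qed

end

theorem theorem6p12:
  fixes a b n :: nat
  assumes "CHAR('f::field) \<noteq> 2"
    and "a \<ge> 1" and "b \<ge> 2" and "n = a + b"
    and "odd n \<Longrightarrow> real b < real n / 2"
  shows "indecomposable (hecke n) (specht a b :: ('f klr_free set, 'f klr_free set set) module) \<longleftrightarrow>
    even n \<or> (b \<in> {2, 3} \<and> int CHAR('f) dvd \<lceil>real a / 2\<rceil>)"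
proof -
  interpret specht_presentation a b n "TYPE('f)"
    by unfold_locales (use assms in auto)
  show ?thesis
  proof (cases "even n")
    case True
    then show ?thesis using indecomposable_even by simp
  next
    case False
    then obtain m where n: "n = 2 * m + 1" by (auto elim: oddE)
    have bm: "b \<le> m" using assms(5)[OF False] n by linarith
    \<comment> \<open>By \<open>b \<le> m\<close> the subtraction is not truncated and
      \<open>?k\<close> is positive; hence it is non-zero in characteristic 0, where 0 divides only
      0.\<close>
    let ?k = "m - b + 2"
    have char: "(of_nat ?k :: 'f) = 0 \<longleftrightarrow> int CHAR('f) dvd int ?k"
      by (simp only: of_nat_eq_0_iff_char_dvd int_dvd_int_iff)
    \<comment> \<open>\<open>a = 2m + 1 - b\<close> is \<open>2m - 1\<close> for
      \<open>b = 2\<close> and \<open>2m - 2\<close> for \<open>b = 3\<close>; half of it, rounded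
      up, is \<open>m\<close> or \<open>m - 1\<close>.\<close>
    have ceil: "\<lceil>real a / 2\<rceil> = int ?k" if "b = 2 \<or> b = 3"
      using that assms(4) n bm by (auto simp: ceiling_eq_iff)
    have "b = 2 \<or> b = 3 \<or> 4 \<le> b" using assms(3) by linarith
    then have "indecomposable H S \<longleftrightarrow> (b = 2 \<or> b = 3) \<and> (of_nat ?k :: 'f) = 0"
      using indecomposable_odd[OF n _ bm] decomposable_odd[OF n _ bm two_nonzero[OF assms(1)]] assms(3)
      by blast
    then show ?thesis using False ceil char by auto
  qed
qed

end
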